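(* Let $(M,H,J)$ be a non-degenerate CR manifold of dimension $2n+1$. Let $U\subset M$ be an open subset carrying a contact form $\theta$ with $\ker\theta=H$ and an admissible coframe $\{\theta,\theta^\alpha,\theta^{\overline\alpha}\}$, and put $\zeta_0=[\theta\wedge\theta^1\wedge\cdots\wedge\theta^n]$, a section over $U$ of the Fefferman space. Then, on $U$, the chains of $(H,J)$ are (locally, as unparameterized curves) the geodesics of the Kropina metric $$F_{\theta,\zeta_0}=\frac{h_{\alpha\overline\beta}\,\theta^\alpha\cdot\theta^{\overline\beta}}{\theta}-\frac{2}{n+2}\Bigl(\mathrm{Im}\,\omega_\alpha{}^\alpha+\frac{R}{2(n+1)}\theta\Bigr),$$ where $h_{\alpha\overline\beta}$ is the matrix of the Levi form, $\omega_\beta{}^\alpha$ are the Tanaka-Webster connection forms of $\theta$ in the given coframe, and $R$ is the Tanaka-Webster scalar curvature of $\theta$.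
   Context: Kropina metrics. A Kropina metric on a manifold is a function $F(x,\xi)=g_x(\xi,\xi)/\omega_x(\xi)$, defined for tangent vectors $\xi$ with $\omega(\xi)\neq0$, where $\omega$ is a nowhere vanishing 1-form and $g$ is a symmetric 2-tensor field (any signature, possibly degenerate) whose restriction to $\ker\omega$ is non-degenerate. (A sum $g/\omega+\beta$ with a 1-form $\beta$ is again a Kropina metric, namely $(g+\omega\cdot\beta)/\omega$.) A geodesic of $F$ is a smooth regular curve $\gamma(t)$ which solves the Euler-Lagrange equation of the Lagrangian $F$ and satisfies $\omega(\gamma'(t))\ne0$ for all $t$. Geodesics are considered without preferred parameterization. CR manifolds. A CR structure $(H,J)$ on a $(2n+1)$-dimensional manifold $M$ is a corank-1 distribution $H\subset TM$ with a complex structure $J$ on $H$ such that the sections of $T^{1,0}M=\{Z\in\mathbb{C}H: JZ=iZ\}$ are closed under Lie bracket. For a 1-form $\theta$ with $\ker\theta=H$ the Levi form is $h_\theta(X,Y)=d\theta(X,JY)$, $X,Y\in H$. The structure is non-degenerate if $h_\theta$ is non-degenerate; then $H$ is a contact distribution. The Reeb field $T$ of $\theta$ is defined by $\theta(T)=1$, $T\lrcorner d\theta=0$. An admissible frame is a local frame $\{T,Z_\alpha,Z_{\overline\alpha}=\overline{Z_\alpha}\}_{1\le\alpha\le n}$ of $\mathbb{C}TM$ with $\{Z_\alpha\}$ a frame of $T^{1,0}M$; its dual coframe $\{\theta,\theta^\alpha,\theta^{\overline\alpha}\}$ is called an admissible coframe. One has $d\theta=i h_{\alpha\overline\beta}\theta^\alpha\wedge\theta^{\overline\beta}$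 with $h_{\alpha\overline\beta}=h_\theta(Z_\alpha,Z_{\overline\beta})$; indices are raised and lowered with $h$. As a quadratic form, $(h_{\alpha\overline\beta}\theta^\alpha\cdot\theta^{\overline\beta})(\xi,\xi)=h_{\alpha\overline\beta}\theta^\alpha(\xi)\theta^{\overline\beta}(\xi)$. Tanaka-Webster connection. The forms $\omega_\beta{}^\alpha$ and the torsion $A_{\overline\beta}{}^\alpha$ are uniquely determined by $d\theta^\alpha=\theta^\beta\wedge\omega_\beta{}^\alpha+A_{\overline\beta}{}^\alpha\theta\wedge\theta^{\overline\beta}$, $dh_{\alpha\overline\beta}=\omega_{\alpha\overline\beta}+\omega_{\overline\beta\alpha}$, $A_{\alpha\beta}=A_{\beta\alpha}$, where $\omega_{\overline\alpha}{}^{\overline\beta}=\overline{\omega_\alpha{}^\beta}$ and $A_\beta{}^{\overline\alpha}=\overline{A_{\overline\beta}{}^\alpha}$. The Tanaka-Webster Ricci tensor $R_{\beta\overline\gamma}$ is defined by $d\omega_\alpha{}^\alpha\equiv R_{\beta\overline\gamma}\theta^\beta\wedge\theta^{\overline\gamma}$ modulo $\theta$, and $R=R_\beta{}^\beta$ is the scalar curvature. Fefferman metric and chains. Let $K_M=\{\zeta\in\wedge^{n+1}\mathbb{C}T^*M:\overline Z\lrcorner\zeta=0\ \forall Z\in T^{1,0}M\}$, let $K_M^*$ be $K_M$ minus its zero section, and let $\mathcal{C}=K_M^*/\mathbb{R}_+$ (the Fefferman space), a circle bundle over $M$; $[\cdot]$ denotes the class modulo $\mathbb{R}_+$. An admissible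 coframe gives the local section $\zeta_0=[\theta\wedge\theta^1\wedge\cdots\wedge\theta^n]$ and the fiber coordinate $s\in\mathbb{R}/2\pi\mathbb{Z}$ with $\zeta=e^{is}\zeta_0$. Put $\sigma=\frac1{n+2}\bigl(ds-\mathrm{Im}\,\omega_\alpha{}^\alpha-\frac{R}{2(n+1)}\theta\bigr)$ and $G=h_{\alpha\overline\beta}\theta^\alpha\cdot\theta^{\overline\beta}+2\theta\cdot\sigma$ (the Fefferman metric, a pseudo-Riemannian metric on $\mathcal{C}$ whose conformal class does not depend on $\theta$), where $\theta\cdot\sigma$ is the symmetric product with $(\theta\cdot\sigma)(\xi,\xi)=\theta(\xi)\sigma(\xi)$. Let $K=(n+2)S$, where $S$ is the infinitesimal generator of the circle action; $K$ is a null Killing field of $G$ with $K\lrcorner G=\theta$. A chain is a curve on $M$ which is the projection of a null geodesic $\widetilde\gamma$ of $G$ with $G(K,\dot{\widetilde\gamma}(0))\neq0$. *)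

theory Defs
  imports "HOL-Analysis.Analysis"
begin

section \<open>Smooth maps\<close>

primrec Ck_on :: "nat \<Rightarrow> 'a::real_normed_vector set \<Rightarrow> ('a \<Rightarrow> 'b::real_normed_vector) \<Rightarrow> bool" where
  "Ck_on 0 S f \<longleftrightarrow> continuous_on S f"
| "Ck_on (Suc k) S f \<longleftrightarrow>
     f differentiable_on S \<and> (\<forall>v. Ck_on k S (\<lambda>x. frechet_derivative f (at x) v))"

text \<open>Only used for open \<open>S\<close>.\<close>

definition smooth_on :: "'a::real_normed_vector set \<Rightarrow> ('a \<Rightarrow> 'b::real_normed_vector) \<Rightarrow> bool" where
  "smooth_on S f \<longleftrightarrow> (\<forall>k. Ck_on k S f)"

definition open_interval :: "real set \<Rightarrow> bool" where
  "open_interval I \<longleftrightarrow> open I \<and> is_interval I \<and> I \<noteq> {}"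

section \<open>Smooth manifolds, tangent vectors and forms\<close>

text \<open>The manifold is the whole type \<open>'m\<close>, modelled on \<open>'e\<close>. The tangent space at \<open>p\<close> is the
  type \<open>'e\<close>, read in a preferred chart \<open>chart_at A p\<close>; \<open>to_chart\<close> and \<open>from_chart\<close> convert between
  tangent vectors at \<open>p\<close> and their coordinates in another chart. Thus a \<open>k\<close>-tensor field is a
  function of the point and of \<open>k\<close> tangent vectors, and only its representations in charts are
  required to be smooth.\<close>

type_synonym ('m, 'e) chart = "'m set \<times> ('m \<Rightarrow> 'e)"

definition chart_inv :: "('m, 'e) chart \<Rightarrow> 'e \<Rightarrow> 'm" where
  "chart_inv c = inv_into (fst c) (snd c)"

definition smooth_atlas ::
  "('m::{t2_space,second_countable_topology}, 'e::euclidean_space) chart set \<Rightarrow> bool" where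
  "smooth_atlas A \<longleftrightarrow>
     (\<Union>c\<in>A. fst c) = UNIV \<and>
     (\<forall>c\<in>A. open (fst c) \<and> open (snd c ` fst c) \<and>
        homeomorphism (fst c) (snd c ` fst c) (snd c) (chart_inv c)) \<and>
     (\<forall>c\<in>A. \<forall>c'\<in>A. smooth_on (snd c ` (fst c \<inter> fst c')) (snd c' \<circ> chart_inv c))"

definition chart_at :: "('m, 'e) chart set \<Rightarrow> 'm \<Rightarrow> ('m, 'e) chart" where
  "chart_at A p = (SOME c. c \<in> A \<and> p \<in> fst c)"

definition to_chart ::
  "('m, 'e::euclidean_space) chart set \<Rightarrow> ('m, 'e) chart \<Rightarrow> 'm \<Rightarrow> 'e \<Rightarrow> 'e" where
  "to_chart A c p v =
     frechet_derivative (snd c \<circ> chart_inv (chart_at A p)) (at (snd (chart_at A p) p)) v"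

definition from_chart ::
  "('m, 'e::euclidean_space) chart set \<Rightarrow> ('m, 'e) chart \<Rightarrow> 'm \<Rightarrow> 'e \<Rightarrow> 'e" where
  "from_chart A c p u = frechet_derivative (snd (chart_at A p) \<circ> chart_inv c) (at (snd c p)) u"

definition smooth_fun ::
  "('m, 'e::euclidean_space) chart set \<Rightarrow> 'm set \<Rightarrow> ('m \<Rightarrow> 'b::real_normed_vector) \<Rightarrow> bool" where
  "smooth_fun A V f \<longleftrightarrow> (\<forall>c\<in>A. smooth_on (snd c ` (fst c \<inter> V)) (f \<circ> chart_inv c))"

definition field_in_chart ::
  "('m, 'e::euclidean_space) chart set \<Rightarrow> ('m, 'e) chart \<Rightarrow> ('m \<Rightarrow> 'e) \<Rightarrow> 'e \<Rightarrow> 'e" where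
  "field_in_chart A c X y = to_chart A c (chart_inv c y) (X (chart_inv c y))"

definition smooth_field ::
  "('m, 'e::euclidean_space) chart set \<Rightarrow> 'm set \<Rightarrow> ('m \<Rightarrow> 'e) \<Rightarrow> bool" where
  "smooth_field A V X \<longleftrightarrow> (\<forall>c\<in>A. smooth_on (snd c ` (fst c \<inter> V)) (field_in_chart A c X))"

text \<open>\<open>in_chart\<close> is used for 1-forms as well as for Lagrangians, i.e. functions of a point and a
  tangent vector.\<close>

definition in_chart ::
  "('m, 'e::euclidean_space) chart set \<Rightarrow> ('m, 'e) chart \<Rightarrow> ('m \<Rightarrow> 'e \<Rightarrow> 'b) \<Rightarrow> 'e \<Rightarrow> 'e \<Rightarrow> 'b" where
  "in_chart A c a y u = a (chart_inv c y) (from_chart A c (chart_inv c y) u)"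

definition smooth_1form ::
  "('m, 'e::euclidean_space) chart set \<Rightarrow> 'm set \<Rightarrow> ('m \<Rightarrow> 'e \<Rightarrow> 'b::real_normed_vector) \<Rightarrow> bool" where
  "smooth_1form A V a \<longleftrightarrow>
     (\<forall>p\<in>V. linear (a p)) \<and>
     (\<forall>c\<in>A. \<forall>u. smooth_on (snd c ` (fst c \<inter> V)) (\<lambda>y. in_chart A c a y u))"

definition smooth_sym_2tensor ::
  "('m, 'e::euclidean_space) chart set \<Rightarrow> 'm set \<Rightarrow> ('m \<Rightarrow> 'e \<Rightarrow> 'e \<Rightarrow> real) \<Rightarrow> bool" where
  "smooth_sym_2tensor A V g \<longleftrightarrow>
     (\<forall>p\<in>V. (\<forall>u v. g p u v = g p v u) \<and> (\<forall>u. linear (g p u))) \<and>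
     (\<forall>c\<in>A. \<forall>u v. smooth_on (snd c ` (fst c \<inter> V))
        (\<lambda>y. g (chart_inv c y) (from_chart A c (chart_inv c y) u) (from_chart A c (chart_inv c y) v)))"

text \<open>The differential of a function, the exterior derivative of a 1-form and the Lie bracket are
  computed at \<open>p\<close> in the preferred chart, in which tangent vectors at \<open>p\<close> are their own
  coordinates. Normalization: \<open>d\<alpha>(X,Y) = X \<alpha>(Y) - Y \<alpha>(X) - \<alpha>([X,Y])\<close> and
  \<open>(\<alpha> \<and> \<beta>)(X,Y) = \<alpha>(X) \<beta>(Y) - \<alpha>(Y) \<beta>(X)\<close>.\<close>

definition dfun ::
  "('m, 'e::euclidean_space) chart set \<Rightarrow> ('m \<Rightarrow> 'b::real_normed_vector) \<Rightarrow> 'm \<Rightarrow> 'e \<Rightarrow> 'b" where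
  "dfun A f p v =
     (let c = chart_at A p in frechet_derivative (f \<circ> chart_inv c) (at (snd c p)) v)"

definition ext_d ::
  "('m, 'e::euclidean_space) chart set \<Rightarrow> ('m \<Rightarrow> 'e \<Rightarrow> 'b::real_normed_vector) \<Rightarrow> 'm \<Rightarrow> 'e \<Rightarrow> 'e \<Rightarrow> 'b" where
  "ext_d A a p u v =
     (let c = chart_at A p in
        frechet_derivative (\<lambda>y. in_chart A c a y v) (at (snd c p)) u
      - frechet_derivative (\<lambda>y. in_chart A c a y u) (at (snd c p)) v)"

definition lie_bracket ::
  "('m, 'e::euclidean_space) chart set \<Rightarrow> ('m \<Rightarrow> 'e) \<Rightarrow> ('m \<Rightarrow> 'e) \<Rightarrow> 'm \<Rightarrow> 'e" where
  "lie_bracket A X Y p =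
     (let c = chart_at A p in
        frechet_derivative (field_in_chart A c Y) (at (snd c p)) (X p)
      - frechet_derivative (field_in_chart A c X) (at (snd c p)) (Y p))"

definition wedge :: "('e \<Rightarrow> 'b::ring) \<Rightarrow> ('e \<Rightarrow> 'b) \<Rightarrow> 'e \<Rightarrow> 'e \<Rightarrow> 'b" where
  "wedge a b u v = a u * b v - a v * b u"

definition sym_prod :: "('e \<Rightarrow> 'b::field) \<Rightarrow> ('e \<Rightarrow> 'b) \<Rightarrow> 'e \<Rightarrow> 'e \<Rightarrow> 'b" where
  "sym_prod a b u v = (a u * b v + a v * b u) / 2"

text \<open>A complexified tangent vector \<open>X + iY\<close> is the pair \<open>(X, Y)\<close>; \<open>cx1\<close> and \<open>cx2\<close> are the
  complex (bi)linear extensions of real (bi)linear maps.\<close>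

definition cx1 :: "('e \<Rightarrow> complex) \<Rightarrow> 'e \<times> 'e \<Rightarrow> complex" where
  "cx1 a Z = a (fst Z) + \<i> * a (snd Z)"

definition cx2 :: "('e \<Rightarrow> 'e \<Rightarrow> complex) \<Rightarrow> 'e \<times> 'e \<Rightarrow> 'e \<times> 'e \<Rightarrow> complex" where
  "cx2 B Z W = B (fst Z) (fst W) - B (snd Z) (snd W) + \<i> * (B (fst Z) (snd W) + B (snd Z) (fst W))"

definition cx_scale :: "complex \<Rightarrow> 'e::real_vector \<times> 'e \<Rightarrow> 'e \<times> 'e" where
  "cx_scale a Z = (Re a *\<^sub>R fst Z - Im a *\<^sub>R snd Z, Re a *\<^sub>R snd Z + Im a *\<^sub>R fst Z)"

definition cx_conj :: "'e::real_vector \<times> 'e \<Rightarrow> 'e \<times> 'e" where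
  "cx_conj Z = (fst Z, - snd Z)"

definition smooth_cx_field ::
  "('m, 'e::euclidean_space) chart set \<Rightarrow> 'm set \<Rightarrow> ('m \<Rightarrow> 'e \<times> 'e) \<Rightarrow> bool" where
  "smooth_cx_field A V Z \<longleftrightarrow> smooth_field A V (fst \<circ> Z) \<and> smooth_field A V (snd \<circ> Z)"

definition cx_bracket ::
  "('m, 'e::euclidean_space) chart set \<Rightarrow> ('m \<Rightarrow> 'e \<times> 'e) \<Rightarrow> ('m \<Rightarrow> 'e \<times> 'e) \<Rightarrow> 'm \<Rightarrow> 'e \<times> 'e" where
  "cx_bracket A Z W p =
     (lie_bracket A (fst \<circ> Z) (fst \<circ> W) p - lie_bracket A (snd \<circ> Z) (snd \<circ> W) p,
      lie_bracket A (fst \<circ> Z) (snd \<circ> W) p + lie_bracket A (snd \<circ> Z) (fst \<circ> W) p)"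

section \<open>Curves\<close>

definition smooth_curve ::
  "('m::topological_space, 'e::euclidean_space) chart set \<Rightarrow> real set \<Rightarrow> (real \<Rightarrow> 'm) \<Rightarrow> bool" where
  "smooth_curve A I \<gamma> \<longleftrightarrow>
     continuous_on I \<gamma> \<and> (\<forall>c\<in>A. smooth_on {t \<in> I. \<gamma> t \<in> fst c} (snd c \<circ> \<gamma>))"

definition velocity ::
  "('m, 'e::euclidean_space) chart set \<Rightarrow> (real \<Rightarrow> 'm) \<Rightarrow> real \<Rightarrow> 'e" where
  "velocity A \<gamma> t = vector_derivative (snd (chart_at A (\<gamma> t)) \<circ> \<gamma>) (at t)"

definition reparametrization :: "(real \<Rightarrow> real) \<Rightarrow> real set \<Rightarrow> real set \<Rightarrow> bool" where
  "reparametrization \<psi> I' I \<longleftrightarrow>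
     open_interval I' \<and> open_interval I \<and> smooth_on I' \<psi> \<and> bij_betw \<psi> I' I \<and>
     (\<forall>t\<in>I'. deriv \<psi> t \<noteq> 0)"

text \<open>\<open>P I \<gamma>\<close> is a property of parameterized curves \<open>\<gamma>\<close> on an interval \<open>I\<close>.\<close>

definition up_to_reparam ::
  "(real set \<Rightarrow> (real \<Rightarrow> 'm) \<Rightarrow> bool) \<Rightarrow> real set \<Rightarrow> (real \<Rightarrow> 'm) \<Rightarrow> bool" where
  "up_to_reparam P I \<gamma> \<longleftrightarrow> (\<exists>I' \<psi>. reparametrization \<psi> I' I \<and> P I' (\<gamma> \<circ> \<psi>))"

definition locally_on ::
  "(real set \<Rightarrow> (real \<Rightarrow> 'm) \<Rightarrow> bool) \<Rightarrow> real set \<Rightarrow> (real \<Rightarrow> 'm) \<Rightarrow> bool" where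
  "locally_on P I \<gamma> \<longleftrightarrow> (\<forall>t\<in>I. \<exists>I'. open_interval I' \<and> t \<in> I' \<and> I' \<subseteq> I \<and> P I' \<gamma>)"

section \<open>Kropina metrics and their geodesics\<close>

definition kropina_metric ::
  "('m, 'e::euclidean_space) chart set \<Rightarrow> 'm set \<Rightarrow> ('m \<Rightarrow> 'e \<Rightarrow> real) \<Rightarrow> ('m \<Rightarrow> 'e \<Rightarrow> real) \<Rightarrow> bool" where
  "kropina_metric A V \<omega> F \<longleftrightarrow>
     smooth_1form A V \<omega> \<and> (\<forall>p\<in>V. \<exists>u. \<omega> p u \<noteq> 0) \<and>
     (\<exists>g. smooth_sym_2tensor A V g \<and>
        (\<forall>p\<in>V. \<forall>u. \<omega> p u = 0 \<and> (\<forall>v. \<omega> p v = 0 \<longrightarrow> g p u v = 0) \<longrightarrow> u = 0) \<and>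
        (\<forall>p\<in>V. \<forall>u. \<omega> p u \<noteq> 0 \<longrightarrow> F p u = g p u u / \<omega> p u))"

text \<open>The Euler-Lagrange equation \<open>d/dt (\<partial>L/\<partial>\<xi>) = \<partial>L/\<partial>x\<close> at \<open>t\<close>, in coordinates.\<close>

definition euler_lagrange_at ::
  "('e::euclidean_space \<Rightarrow> 'e \<Rightarrow> real) \<Rightarrow> (real \<Rightarrow> 'e) \<Rightarrow> real \<Rightarrow> bool" where
  "euler_lagrange_at L x t \<longleftrightarrow>
     (let x' = (\<lambda>r. vector_derivative x (at r)) in
      \<forall>w. ((\<lambda>r. frechet_derivative (L (x r)) (at (x' r)) w) has_real_derivative
             frechet_derivative (\<lambda>y. L y (x' t)) (at (x t)) w) (at t))"

definition kropina_geodesic ::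
  "('m::topological_space, 'e::euclidean_space) chart set \<Rightarrow> ('m \<Rightarrow> 'e \<Rightarrow> real) \<Rightarrow>
     ('m \<Rightarrow> 'e \<Rightarrow> real) \<Rightarrow> real set \<Rightarrow> (real \<Rightarrow> 'm) \<Rightarrow> bool" where
  "kropina_geodesic A \<omega> F I \<gamma> \<longleftrightarrow>
     open_interval I \<and> smooth_curve A I \<gamma> \<and>
     (\<forall>t\<in>I. velocity A \<gamma> t \<noteq> 0 \<and> \<omega> (\<gamma> t) (velocity A \<gamma> t) \<noteq> 0) \<and>
     (\<forall>c\<in>A. \<forall>t\<in>I. \<gamma> t \<in> fst c \<longrightarrow> euler_lagrange_at (in_chart A c F) (snd c \<circ> \<gamma>) t)"

section \<open>Geodesics of pseudo-Riemannian metrics, in coordinates\<close>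

text \<open>\<open>christoffel g x a b\<close> is the vector with components \<open>\<Gamma>\<^sup>k\<^sub>i\<^sub>j a\<^sup>i b\<^sup>j\<close> of the Levi-Civita
  connection; it is well defined where \<open>g\<close> is non-degenerate.\<close>

definition christoffel ::
  "('a::euclidean_space \<Rightarrow> 'a \<Rightarrow> 'a \<Rightarrow> real) \<Rightarrow> 'a \<Rightarrow> 'a \<Rightarrow> 'a \<Rightarrow> 'a" where
  "christoffel g x a b =
     (THE w. \<forall>v. g x w v =
        (frechet_derivative (\<lambda>y. g y b v) (at x) a
         + frechet_derivative (\<lambda>y. g y a v) (at x) b
         - frechet_derivative (\<lambda>y. g y a b) (at x) v) / 2)"

definition geodesic_at ::
  "('a::euclidean_space \<Rightarrow> 'a \<Rightarrow> 'a \<Rightarrow> real) \<Rightarrow> (real \<Rightarrow> 'a) \<Rightarrow> real \<Rightarrow> bool" where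
  "geodesic_at g x t \<longleftrightarrow>
     (let x' = (\<lambda>r. vector_derivative x (at r)) in
      vector_derivative x' (at t) + christoffel g (x t) (x' t) (x' t) = 0)"

section \<open>CR structures\<close>

definition T10 :: "('m \<Rightarrow> 'e::real_vector set) \<Rightarrow> ('m \<Rightarrow> 'e \<Rightarrow> 'e) \<Rightarrow> 'm \<Rightarrow> ('e \<times> 'e) set" where
  "T10 H J p = {Z. fst Z \<in> H p \<and> snd Z \<in> H p \<and>
                   (J p (fst Z), J p (snd Z)) = cx_scale \<i> Z}"

definition annihilator_form ::
  "('m, 'e::euclidean_space) chart set \<Rightarrow> ('m \<Rightarrow> 'e set) \<Rightarrow> 'm set \<Rightarrow> ('m \<Rightarrow> 'e \<Rightarrow> real) \<Rightarrow> bool" where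
  "annihilator_form A H V \<theta> \<longleftrightarrow> smooth_1form A V \<theta> \<and> (\<forall>p\<in>V. {u. \<theta> p u = 0} = H p)"

definition cr_structure ::
  "('m::{t2_space,second_countable_topology}, 'e::euclidean_space) chart set \<Rightarrow>
     ('m \<Rightarrow> 'e set) \<Rightarrow> ('m \<Rightarrow> 'e \<Rightarrow> 'e) \<Rightarrow> bool" where
  "cr_structure A H J \<longleftrightarrow>
     (\<forall>p. subspace (H p) \<and> dim (H p) + 1 = DIM('e)) \<and>
     (\<forall>p. \<exists>V \<theta>. open V \<and> p \<in> V \<and> annihilator_form A H V \<theta>) \<and>
     (\<forall>p. \<forall>u\<in>H p. J p u \<in> H p \<and> J p (J p u) = - u \<and>
        (\<forall>r. J p (r *\<^sub>R u) = r *\<^sub>R J p u) \<and> (\<forall>v\<in>H p. J p (u + v) = J p u + J p v)) \<and>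
     (\<forall>V X. open V \<and> smooth_field A V X \<and> (\<forall>p\<in>V. X p \<in> H p) \<longrightarrow> smooth_field A V (\<lambda>p. J p (X p))) \<and>
     (\<forall>V Z W. open V \<and> smooth_cx_field A V Z \<and> smooth_cx_field A V W \<and>
        (\<forall>p\<in>V. Z p \<in> T10 H J p \<and> W p \<in> T10 H J p) \<longrightarrow> (\<forall>p\<in>V. cx_bracket A Z W p \<in> T10 H J p))"

definition levi_form ::
  "('m, 'e::euclidean_space) chart set \<Rightarrow> ('m \<Rightarrow> 'e \<Rightarrow> 'e) \<Rightarrow> ('m \<Rightarrow> 'e \<Rightarrow> real) \<Rightarrow> 'm \<Rightarrow> 'e \<Rightarrow> 'e \<Rightarrow> real" where
  "levi_form A J \<theta> p X Y = ext_d A \<theta> p X (J p Y)"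

definition nondegenerate_cr ::
  "('m::{t2_space,second_countable_topology}, 'e::euclidean_space) chart set \<Rightarrow>
     ('m \<Rightarrow> 'e set) \<Rightarrow> ('m \<Rightarrow> 'e \<Rightarrow> 'e) \<Rightarrow> bool" where
  "nondegenerate_cr A H J \<longleftrightarrow>
     cr_structure A H J \<and>
     (\<forall>V \<theta>. open V \<and> annihilator_form A H V \<theta> \<longrightarrow>
        (\<forall>p\<in>V. \<forall>X\<in>H p. (\<forall>Y\<in>H p. levi_form A J \<theta> p X Y = 0) \<longrightarrow> X = 0))"

definition reeb_field ::
  "('m, 'e::euclidean_space) chart set \<Rightarrow> 'm set \<Rightarrow> ('m \<Rightarrow> 'e \<Rightarrow> real) \<Rightarrow> ('m \<Rightarrow> 'e) \<Rightarrow> bool" where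
  "reeb_field A V \<theta> T \<longleftrightarrow>
     smooth_field A V T \<and> (\<forall>p\<in>V. \<theta> p (T p) = 1 \<and> (\<forall>u. ext_d A \<theta> p (T p) u = 0))"

definition admissible_frame ::
  "('m, 'e::euclidean_space) chart set \<Rightarrow> ('m \<Rightarrow> 'e set) \<Rightarrow> ('m \<Rightarrow> 'e \<Rightarrow> 'e) \<Rightarrow> 'm set \<Rightarrow>
     ('m \<Rightarrow> 'e \<Rightarrow> real) \<Rightarrow> ('m \<Rightarrow> 'e) \<Rightarrow> ('n::finite \<Rightarrow> 'm \<Rightarrow> 'e \<times> 'e) \<Rightarrow> bool" where
  "admissible_frame A H J V \<theta> T Z \<longleftrightarrow>
     reeb_field A V \<theta> T \<and>
     (\<forall>\<alpha>. smooth_cx_field A V (Z \<alpha>)) \<and>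
     (\<forall>p\<in>V. (\<forall>\<alpha>. Z \<alpha> p \<in> T10 H J p) \<and>
        (\<forall>W\<in>T10 H J p. \<exists>!a. W = (\<Sum>\<alpha>\<in>UNIV. cx_scale (a \<alpha>) (Z \<alpha> p))))"

text \<open>The forms \<open>\<theta>\<^sup>\<alpha>\<close> are \<open>\<theta>c \<alpha>\<close>, and \<open>\<theta>\<close> with its conjugate index is the pointwise conjugate.\<close>

definition admissible_coframe ::
  "('m, 'e::euclidean_space) chart set \<Rightarrow> ('m \<Rightarrow> 'e set) \<Rightarrow> ('m \<Rightarrow> 'e \<Rightarrow> 'e) \<Rightarrow> 'm set \<Rightarrow>
     ('m \<Rightarrow> 'e \<Rightarrow> real) \<Rightarrow> ('m \<Rightarrow> 'e) \<Rightarrow> ('n::finite \<Rightarrow> 'm \<Rightarrow> 'e \<times> 'e) \<Rightarrow>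
     ('n \<Rightarrow> 'm \<Rightarrow> 'e \<Rightarrow> complex) \<Rightarrow> bool" where
  "admissible_coframe A H J V \<theta> T Z \<theta>c \<longleftrightarrow>
     admissible_frame A H J V \<theta> T Z \<and>
     (\<forall>\<alpha>. smooth_1form A V (\<theta>c \<alpha>)) \<and>
     (\<forall>p\<in>V. \<forall>\<alpha>. \<theta>c \<alpha> p (T p) = 0 \<and>
        (\<forall>\<beta>. cx1 (\<theta>c \<alpha> p) (Z \<beta> p) = (if \<alpha> = \<beta> then 1 else 0) \<and>
             cx1 (\<theta>c \<alpha> p) (cx_conj (Z \<beta> p)) = 0))"

text \<open>\<open>levi_matrix A J \<theta> Z \<alpha> \<beta>\<close> is \<open>h\<close> with lower indices \<open>\<alpha>\<close> and conjugate \<open>\<beta>\<close>. Since \<open>J\<close> is only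
  meaningful on \<open>H\<close>, the complex bilinear extension uses it on real and imaginary parts.\<close>

definition levi_matrix ::
  "('m, 'e::euclidean_space) chart set \<Rightarrow> ('m \<Rightarrow> 'e \<Rightarrow> 'e) \<Rightarrow> ('m \<Rightarrow> 'e \<Rightarrow> real) \<Rightarrow>
     ('n \<Rightarrow> 'm \<Rightarrow> 'e \<times> 'e) \<Rightarrow> 'n \<Rightarrow> 'n \<Rightarrow> 'm \<Rightarrow> complex" where
  "levi_matrix A J \<theta> Z \<alpha> \<beta> p =
     cx2 (\<lambda>X Y. complex_of_real (levi_form A J \<theta> p X Y)) (Z \<alpha> p) (cx_conj (Z \<beta> p))"

section \<open>The Tanaka-Webster connection\<close>

text \<open>\<open>\<omega> \<beta> \<alpha>\<close> is the form with lower index \<open>\<beta>\<close> and upper index \<open>\<alpha>\<close>; \<open>\<tau> \<beta> \<alpha>\<close> is the torsion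
  coefficient with lower conjugate index \<open>\<beta>\<close> and upper index \<open>\<alpha>\<close>. The last condition is the
  symmetry of \<open>A\<^sub>\<alpha>\<^sub>\<beta>\<close>, whose second index is lowered with \<open>h\<close>.\<close>

definition tanaka_webster ::
  "('m, 'e::euclidean_space) chart set \<Rightarrow> ('m \<Rightarrow> 'e \<Rightarrow> 'e) \<Rightarrow> 'm set \<Rightarrow> ('m \<Rightarrow> 'e \<Rightarrow> real) \<Rightarrow>
     ('n::finite \<Rightarrow> 'm \<Rightarrow> 'e \<times> 'e) \<Rightarrow> ('n \<Rightarrow> 'm \<Rightarrow> 'e \<Rightarrow> complex) \<Rightarrow>
     ('n \<Rightarrow> 'n \<Rightarrow> 'm \<Rightarrow> 'e \<Rightarrow> complex) \<Rightarrow> ('n \<Rightarrow> 'n \<Rightarrow> 'm \<Rightarrow> complex) \<Rightarrow> bool" where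
  "tanaka_webster A J V \<theta> Z \<theta>c \<omega> \<tau> \<longleftrightarrow>
     (let h = levi_matrix A J \<theta> Z in
      (\<forall>\<alpha> \<beta>. smooth_1form A V (\<omega> \<beta> \<alpha>) \<and> smooth_fun A V (\<tau> \<beta> \<alpha>)) \<and>
      (\<forall>p\<in>V. \<forall>\<alpha> u v. ext_d A (\<theta>c \<alpha>) p u v =
         (\<Sum>\<beta>\<in>UNIV. wedge (\<theta>c \<beta> p) (\<omega> \<beta> \<alpha> p) u v) +
         (\<Sum>\<beta>\<in>UNIV. \<tau> \<beta> \<alpha> p * wedge (\<lambda>x. complex_of_real (\<theta> p x)) (\<lambda>x. cnj (\<theta>c \<beta> p x)) u v)) \<and>
      (\<forall>p\<in>V. \<forall>\<alpha> \<beta> u. dfun A (h \<alpha> \<beta>) p u =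
         (\<Sum>\<gamma>\<in>UNIV. h \<gamma> \<beta> p * \<omega> \<alpha> \<gamma> p u) + (\<Sum>\<gamma>\<in>UNIV. h \<alpha> \<gamma> p * cnj (\<omega> \<beta> \<gamma> p u))) \<and>
      (\<forall>p\<in>V. \<forall>\<alpha> \<beta>. (\<Sum>\<gamma>\<in>UNIV. h \<beta> \<gamma> p * cnj (\<tau> \<alpha> \<gamma> p)) = (\<Sum>\<gamma>\<in>UNIV. h \<alpha> \<gamma> p * cnj (\<tau> \<beta> \<gamma> p))))"

definition connection_trace ::
  "('n::finite \<Rightarrow> 'n \<Rightarrow> 'm \<Rightarrow> 'e \<Rightarrow> complex) \<Rightarrow> 'm \<Rightarrow> 'e \<Rightarrow> complex" where
  "connection_trace \<omega> p u = (\<Sum>\<alpha>\<in>UNIV. \<omega> \<alpha> \<alpha> p u)"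

text \<open>A congruence of 2-forms modulo \<open>\<theta>\<close> is an equality on \<open>ker \<theta>\<close>.\<close>

definition ricci_tensor ::
  "('m, 'e::euclidean_space) chart set \<Rightarrow> 'm set \<Rightarrow> ('m \<Rightarrow> 'e \<Rightarrow> real) \<Rightarrow>
     ('n::finite \<Rightarrow> 'm \<Rightarrow> 'e \<Rightarrow> complex) \<Rightarrow> ('n \<Rightarrow> 'n \<Rightarrow> 'm \<Rightarrow> 'e \<Rightarrow> complex) \<Rightarrow>
     ('n \<Rightarrow> 'n \<Rightarrow> 'm \<Rightarrow> complex) \<Rightarrow> bool" where
  "ricci_tensor A V \<theta> \<theta>c \<omega> Ric \<longleftrightarrow>
     (\<forall>\<beta> \<gamma>. smooth_fun A V (Ric \<beta> \<gamma>)) \<and>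
     (\<forall>p\<in>V. \<forall>u v. \<theta> p u = 0 \<and> \<theta> p v = 0 \<longrightarrow>
        ext_d A (connection_trace \<omega>) p u v =
          (\<Sum>\<beta>\<in>UNIV. \<Sum>\<gamma>\<in>UNIV. Ric \<beta> \<gamma> p * wedge (\<theta>c \<beta> p) (\<lambda>x. cnj (\<theta>c \<gamma> p x)) u v))"

text \<open>The trace of \<open>Ric\<close> with respect to \<open>h\<close>. It is real, so \<open>Re\<close> is only a coercion; the same
  applies to the Hermitian form below. The inverse matrix \<open>h\<close> with upper indices \<open>\<beta>\<close>,
  conjugate \<open>\<gamma>\<close> has entry \<open>$ \<gamma> $ \<beta>\<close> of \<open>matrix_inv\<close>.\<close>

definition webster_scalar ::
  "('m, 'e::euclidean_space) chart set \<Rightarrow> ('m \<Rightarrow> 'e \<Rightarrow> 'e) \<Rightarrow> ('m \<Rightarrow> 'e \<Rightarrow> real) \<Rightarrow>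
     ('n::finite \<Rightarrow> 'm \<Rightarrow> 'e \<times> 'e) \<Rightarrow> ('n \<Rightarrow> 'n \<Rightarrow> 'm \<Rightarrow> complex) \<Rightarrow> 'm \<Rightarrow> real" where
  "webster_scalar A J \<theta> Z Ric p =
     Re (\<Sum>\<beta>\<in>UNIV. \<Sum>\<gamma>\<in>UNIV.
           matrix_inv (\<chi> \<alpha> \<delta>. levi_matrix A J \<theta> Z \<alpha> \<delta> p) $ \<gamma> $ \<beta> * Ric \<beta> \<gamma> p)"

definition hermitian_part ::
  "('m, 'e::euclidean_space) chart set \<Rightarrow> ('m \<Rightarrow> 'e \<Rightarrow> 'e) \<Rightarrow> ('m \<Rightarrow> 'e \<Rightarrow> real) \<Rightarrow>
     ('n::finite \<Rightarrow> 'm \<Rightarrow> 'e \<times> 'e) \<Rightarrow> ('n \<Rightarrow> 'm \<Rightarrow> 'e \<Rightarrow> complex) \<Rightarrow> 'm \<Rightarrow> 'e \<Rightarrow> 'e \<Rightarrow> real" where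
  "hermitian_part A J \<theta> Z \<theta>c p u v =
     Re (\<Sum>\<alpha>\<in>UNIV. \<Sum>\<beta>\<in>UNIV. levi_matrix A J \<theta> Z \<alpha> \<beta> p *
           sym_prod (\<theta>c \<alpha> p) (\<lambda>x. cnj (\<theta>c \<beta> p x)) u v)"

section \<open>The Fefferman space, the Fefferman metric and chains\<close>

text \<open>A complex valued real multilinear form is identified with its complex multilinear extension.
  The \<open>n + 1\<close> arguments of an \<open>(n + 1)\<close>-form are indexed by \<open>'n option\<close>, so that \<open>\<theta>\<close> corresponds
  to \<open>None\<close> and \<open>\<theta>\<^sup>\<alpha>\<close> to \<open>Some \<alpha>\<close>.\<close>

definition alternating_form :: "(('k \<Rightarrow> 'e::real_vector) \<Rightarrow> complex) \<Rightarrow> bool" where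
  "alternating_form \<zeta> \<longleftrightarrow>
     (\<forall>v j. linear (\<lambda>u. \<zeta> (v(j := u)))) \<and> (\<forall>v j k. j \<noteq> k \<and> v j = v k \<longrightarrow> \<zeta> v = 0)"

definition canonical_fibre ::
  "('m \<Rightarrow> 'e::euclidean_space set) \<Rightarrow> ('m \<Rightarrow> 'e \<Rightarrow> 'e) \<Rightarrow> 'm \<Rightarrow> (('n option \<Rightarrow> 'e) \<Rightarrow> complex) set" where
  "canonical_fibre H J p =
     {\<zeta>. alternating_form \<zeta> \<and>
         (\<forall>Z\<in>T10 H J p. \<forall>v. cx1 (\<lambda>u. \<zeta> (v(None := u))) (cx_conj Z) = 0)}"

definition ray_class :: "('x \<Rightarrow> complex) \<Rightarrow> ('x \<Rightarrow> complex) set" where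
  "ray_class \<zeta> = {(\<lambda>v. complex_of_real r * \<zeta> v) | r. r > 0}"

definition fefferman_space ::
  "('m \<Rightarrow> 'e::euclidean_space set) \<Rightarrow> ('m \<Rightarrow> 'e \<Rightarrow> 'e) \<Rightarrow>
     ('m \<times> (('n option \<Rightarrow> 'e) \<Rightarrow> complex) set) set" where
  "fefferman_space H J = {(p, ray_class \<zeta>) | p \<zeta>. \<zeta> \<in> canonical_fibre H J p \<and> \<zeta> \<noteq> (\<lambda>v. 0)}"

text \<open>\<open>\<theta> \<and> \<theta>\<^sup>1 \<and> \<dots> \<and> \<theta>\<^sup>n\<close>\<close>

definition coframe_volume ::
  "('m \<Rightarrow> 'e \<Rightarrow> real) \<Rightarrow> ('n::finite \<Rightarrow> 'm \<Rightarrow> 'e \<Rightarrow> complex) \<Rightarrow> 'm \<Rightarrow> ('n option \<Rightarrow> 'e) \<Rightarrow> complex" where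
  "coframe_volume \<theta> \<theta>c p v =
     det (\<chi> i j. case i of None \<Rightarrow> complex_of_real (\<theta> p (v j)) | Some \<alpha> \<Rightarrow> \<theta>c \<alpha> p (v j))"

text \<open>The point of the Fefferman space over \<open>p\<close> with fibre coordinate \<open>s\<close> (modulo \<open>2\<pi>\<close>) relative to
  the section \<open>\<zeta>\<^sub>0\<close>.\<close>

definition fefferman_point ::
  "('m \<Rightarrow> 'e \<Rightarrow> real) \<Rightarrow> ('n::finite \<Rightarrow> 'm \<Rightarrow> 'e \<Rightarrow> complex) \<Rightarrow> 'm \<Rightarrow> real \<Rightarrow>
     'm \<times> (('n option \<Rightarrow> 'e) \<Rightarrow> complex) set" where
  "fefferman_point \<theta> \<theta>c p s = (p, ray_class (\<lambda>v. exp (\<i> * complex_of_real s) * coframe_volume \<theta> \<theta>c p v))"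

text \<open>In the coordinates given by the fibre coordinate, a tangent vector of the Fefferman space over
  \<open>p\<close> is a pair \<open>(u, a)\<close>, with \<open>u\<close> its projection and \<open>a\<close> its \<open>ds\<close>-component. The
  forms and the metric below do not depend on \<open>s\<close>, and are given at all points over \<open>p\<close>.\<close>

definition fefferman_sigma ::
  "('m, 'e::euclidean_space) chart set \<Rightarrow> ('m \<Rightarrow> 'e \<Rightarrow> 'e) \<Rightarrow> ('m \<Rightarrow> 'e \<Rightarrow> real) \<Rightarrow>
     ('n::finite \<Rightarrow> 'm \<Rightarrow> 'e \<times> 'e) \<Rightarrow> ('n \<Rightarrow> 'n \<Rightarrow> 'm \<Rightarrow> 'e \<Rightarrow> complex) \<Rightarrow>
     ('n \<Rightarrow> 'n \<Rightarrow> 'm \<Rightarrow> complex) \<Rightarrow> 'm \<Rightarrow> 'e \<times> real \<Rightarrow> real" where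
  "fefferman_sigma A J \<theta> Z \<omega> Ric p \<xi> =
     (snd \<xi> - Im (connection_trace \<omega> p (fst \<xi>))
       - webster_scalar A J \<theta> Z Ric p / (2 * (real CARD('n) + 1)) * \<theta> p (fst \<xi>))
     / (real CARD('n) + 2)"

definition fefferman_metric ::
  "('m, 'e::euclidean_space) chart set \<Rightarrow> ('m \<Rightarrow> 'e \<Rightarrow> 'e) \<Rightarrow> ('m \<Rightarrow> 'e \<Rightarrow> real) \<Rightarrow>
     ('n::finite \<Rightarrow> 'm \<Rightarrow> 'e \<times> 'e) \<Rightarrow> ('n \<Rightarrow> 'm \<Rightarrow> 'e \<Rightarrow> complex) \<Rightarrow>
     ('n \<Rightarrow> 'n \<Rightarrow> 'm \<Rightarrow> 'e \<Rightarrow> complex) \<Rightarrow> ('n \<Rightarrow> 'n \<Rightarrow> 'm \<Rightarrow> complex) \<Rightarrow>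
     'm \<Rightarrow> 'e \<times> real \<Rightarrow> 'e \<times> real \<Rightarrow> real" where
  "fefferman_metric A J \<theta> Z \<theta>c \<omega> Ric p \<xi> \<eta> =
     hermitian_part A J \<theta> Z \<theta>c p (fst \<xi>) (fst \<eta>)
     + 2 * sym_prod (\<lambda>x. \<theta> p (fst x)) (fefferman_sigma A J \<theta> Z \<omega> Ric p) \<xi> \<eta>"

definition fefferman_metric_in_chart ::
  "('m, 'e::euclidean_space) chart set \<Rightarrow> ('m \<Rightarrow> 'e \<Rightarrow> 'e) \<Rightarrow> ('m \<Rightarrow> 'e \<Rightarrow> real) \<Rightarrow>
     ('n::finite \<Rightarrow> 'm \<Rightarrow> 'e \<times> 'e) \<Rightarrow> ('n \<Rightarrow> 'm \<Rightarrow> 'e \<Rightarrow> complex) \<Rightarrow>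
     ('n \<Rightarrow> 'n \<Rightarrow> 'm \<Rightarrow> 'e \<Rightarrow> complex) \<Rightarrow> ('n \<Rightarrow> 'n \<Rightarrow> 'm \<Rightarrow> complex) \<Rightarrow>
     ('m, 'e) chart \<Rightarrow> 'e \<times> real \<Rightarrow> 'e \<times> real \<Rightarrow> 'e \<times> real \<Rightarrow> real" where
  "fefferman_metric_in_chart A J \<theta> Z \<theta>c \<omega> Ric c y \<xi> \<eta> =
     (let p = chart_inv c (fst y) in
      fefferman_metric A J \<theta> Z \<theta>c \<omega> Ric p
        (from_chart A c p (fst \<xi>), snd \<xi>) (from_chart A c p (fst \<eta>), snd \<eta>))"

text \<open>\<open>\<Gamma>\<close> is a curve in the Fefferman space over \<open>V\<close>, written on the interval \<open>I\<close> with a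
  smooth determination \<open>s\<close> of its fibre coordinate. The vector \<open>K = (n + 2) \<partial>/\<partial>s\<close>
  is \<open>(0, n + 2)\<close>.\<close>

definition fefferman_null_geodesic ::
  "('m::topological_space, 'e::euclidean_space) chart set \<Rightarrow> ('m \<Rightarrow> 'e set) \<Rightarrow> ('m \<Rightarrow> 'e \<Rightarrow> 'e) \<Rightarrow>
     'm set \<Rightarrow> ('m \<Rightarrow> 'e \<Rightarrow> real) \<Rightarrow>
     ('n::finite \<Rightarrow> 'm \<Rightarrow> 'e \<times> 'e) \<Rightarrow> ('n \<Rightarrow> 'm \<Rightarrow> 'e \<Rightarrow> complex) \<Rightarrow>
     ('n \<Rightarrow> 'n \<Rightarrow> 'm \<Rightarrow> 'e \<Rightarrow> complex) \<Rightarrow> ('n \<Rightarrow> 'n \<Rightarrow> 'm \<Rightarrow> complex) \<Rightarrow>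
     real set \<Rightarrow> (real \<Rightarrow> 'm \<times> (('n option \<Rightarrow> 'e) \<Rightarrow> complex) set) \<Rightarrow> (real \<Rightarrow> real) \<Rightarrow> bool" where
  "fefferman_null_geodesic A H J V \<theta> Z \<theta>c \<omega> Ric I \<Gamma> s \<longleftrightarrow>
     (let \<gamma> = fst \<circ> \<Gamma>;
          G = fefferman_metric A J \<theta> Z \<theta>c \<omega> Ric
      in
      open_interval I \<and> \<gamma> ` I \<subseteq> V \<and> smooth_curve A I \<gamma> \<and> smooth_on I s \<and>
      (\<forall>t\<in>I. \<Gamma> t \<in> fefferman_space H J \<and> \<Gamma> t = fefferman_point \<theta> \<theta>c (\<gamma> t) (s t)) \<and>
      (\<forall>c\<in>A. \<forall>t\<in>I. \<gamma> t \<in> fst c \<longrightarrow>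
         geodesic_at (fefferman_metric_in_chart A J \<theta> Z \<theta>c \<omega> Ric c) (\<lambda>r. (snd c (\<gamma> r), s r)) t) \<and>
      (\<forall>t\<in>I. G (\<gamma> t) (velocity A \<gamma> t, deriv s t) (velocity A \<gamma> t, deriv s t) = 0))"

definition chain ::
  "('m::topological_space, 'e::euclidean_space) chart set \<Rightarrow> ('m \<Rightarrow> 'e set) \<Rightarrow> ('m \<Rightarrow> 'e \<Rightarrow> 'e) \<Rightarrow>
     'm set \<Rightarrow> ('m \<Rightarrow> 'e \<Rightarrow> real) \<Rightarrow>
     ('n::finite \<Rightarrow> 'm \<Rightarrow> 'e \<times> 'e) \<Rightarrow> ('n \<Rightarrow> 'm \<Rightarrow> 'e \<Rightarrow> complex) \<Rightarrow>
     ('n \<Rightarrow> 'n \<Rightarrow> 'm \<Rightarrow> 'e \<Rightarrow> complex) \<Rightarrow> ('n \<Rightarrow> 'n \<Rightarrow> 'm \<Rightarrow> complex) \<Rightarrow>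
     real set \<Rightarrow> (real \<Rightarrow> 'm) \<Rightarrow> bool" where
  "chain A H J V \<theta> Z \<theta>c \<omega> Ric I \<gamma> \<longleftrightarrow>
     0 \<in> I \<and>
     (\<exists>\<Gamma> s. fefferman_null_geodesic A H J V \<theta> Z \<theta>c \<omega> Ric I \<Gamma> s \<and>
        (\<forall>t\<in>I. fst (\<Gamma> t) = \<gamma> t) \<and>
        fefferman_metric A J \<theta> Z \<theta>c \<omega> Ric (\<gamma> 0)
          (0, real CARD('n) + 2) (velocity A \<gamma> 0, deriv s 0) \<noteq> 0)"

text \<open>\<open>F\<^sub>\<theta>\<^sub>,\<^sub>\<zeta>\<^sub>0\<close>\<close>

definition chain_kropina ::
  "('m, 'e::euclidean_space) chart set \<Rightarrow> ('m \<Rightarrow> 'e \<Rightarrow> 'e) \<Rightarrow> ('m \<Rightarrow> 'e \<Rightarrow> real) \<Rightarrow>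
     ('n::finite \<Rightarrow> 'm \<Rightarrow> 'e \<times> 'e) \<Rightarrow> ('n \<Rightarrow> 'm \<Rightarrow> 'e \<Rightarrow> complex) \<Rightarrow>
     ('n \<Rightarrow> 'n \<Rightarrow> 'm \<Rightarrow> 'e \<Rightarrow> complex) \<Rightarrow> ('n \<Rightarrow> 'n \<Rightarrow> 'm \<Rightarrow> complex) \<Rightarrow> 'm \<Rightarrow> 'e \<Rightarrow> real" where
  "chain_kropina A J \<theta> Z \<theta>c \<omega> Ric p \<xi> =
     hermitian_part A J \<theta> Z \<theta>c p \<xi> \<xi> / \<theta> p \<xi>
     - 2 / (real CARD('n) + 2) *
       (Im (connection_trace \<omega> p \<xi>)
        + webster_scalar A J \<theta> Z Ric p / (2 * (real CARD('n) + 1)) * \<theta> p \<xi>)"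

end

theory Submission
  imports Defs
begin

text \<open>On the Fefferman space, write \<open>n\<close> for the CR dimension and \<open>F\<close> for the Kropina metric of the
  theorem. Then \<open>G(X, X) = \<theta>(X) (F(X) + 2 ds(X) / (n + 2))\<close>, so a curve transverse to \<open>H\<close> is null
  iff \<open>s' = - (n + 2) F / 2\<close>. Since \<open>G\<close> does not depend on \<open>s\<close>, geodesics of \<open>G\<close> have constant
  \<open>\<theta>(X)\<close>, and along a null curve with constant \<open>\<theta>(X) \<noteq> 0\<close> the first variation of the energy
  \<open>G(X, X) / 2\<close> in the directions of \<open>M\<close> is a constant multiple of that of \<open>F\<close>. Conversely, \<open>F\<close> is
  homogeneous of degree one, so that a geodesic of \<open>F\<close> can be reparametrized to make \<open>\<theta>(X) = 1\<close>, and
  integrating \<open>s' = - (n + 2) F / 2\<close> lifts it to a null geodesic.\<close>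

section \<open>Calculus of smooth maps\<close>

text \<open>The product form of \<open>G(X, X)\<close> explains the common first variation. On a
  null curve transverse to \<open>H\<close> the factor \<open>F + 2 s' / (n + 2)\<close> vanishes,
  so the product rule leaves only \<theta>(X) times the variation of \<open>F\<close>. Conservation
  of \<theta>(X) makes this factor a constant and spreads transversality, demanded of a chain at
  parameter 0 alone, to the whole interval. The two equations are written in different terms:
  Christoffel symbols, given by a definite description, for \<open>G\<close>, and Euler-Lagrange
  expressions for \<open>F\<close>. Comparing them rests on \<open>G\<close> being nondegenerate,
  hence on nondegeneracy of the Hermitian form on \<open>H\<close>. That form is identified with
  half the Levi form by the vanishing of d\<theta> on pairs of (1,0)-vectors, which is involutivity
  of \<open>T\<^sup>1\<^sup>,\<^sup>0\<close>. The equations are compared chart by chart; only the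
  constant \<theta>(X), the change of parameter and the integration of \<open>s'\<close> concern the
  whole interval. There smoothness of the coefficients is needed, including the scalar curvature,
  into which the inverse Levi matrix enters.\<close>

lemma frechet_derivative_cong_open:
  assumes "open S" "x \<in> S" "\<And>y. y \<in> S \<Longrightarrow> f y = g y"
  shows "frechet_derivative f (at x) = frechet_derivative g (at x)"
proof -
  have "(f has_derivative D) (at x) \<longleftrightarrow> (g has_derivative D) (at x)" for D
    using has_derivative_transform_within_open[of f D x UNIV S g]
      has_derivative_transform_within_open[of g D x UNIV S f] assms by auto
  then show ?thesis by (simp add: frechet_derivative_def)
qed

lemma differentiable_cong_open:
  assumes "open S" "x \<in> S" "\<And>y. y \<in> S \<Longrightarrow> f y = g y"
  shows "f differentiable at x \<longleftrightarrow> g differentiable at x"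
  unfolding differentiable_def
  using has_derivative_transform_within_open[of f _ x UNIV S g]
      has_derivative_transform_within_open[of g _ x UNIV S f] assms by metis

lemma Ck_on_cong:
  assumes "open S" "\<And>x. x \<in> S \<Longrightarrow> f x = g x"
  shows "Ck_on k S f \<longleftrightarrow> Ck_on k S g"
  using assms
proof (induction k arbitrary: f g)
  case 0
  then show ?case by (simp cong: continuous_on_cong)
next
  case (Suc k)
  have "f differentiable_on S \<longleftrightarrow> g differentiable_on S"
    using Suc.prems differentiable_cong_open[of S _ f g]
    by (auto simp: differentiable_on_eq_differentiable_at)
  moreover have "Ck_on k S (\<lambda>x. frechet_derivative f (at x) v)
      \<longleftrightarrow> Ck_on k S (\<lambda>x. frechet_derivative g (at x) v)" for v
    by (rule Suc.IH) (use Suc.prems frechet_derivative_cong_open[of S _ f g] in auto)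
  ultimately show ?case by simp
qed

lemma Ck_on_SucD:
  assumes "Ck_on (Suc k) S f" "open S"
  shows "\<And>x. x \<in> S \<Longrightarrow> (f has_derivative frechet_derivative f (at x)) (at x)"
    and "\<And>v. Ck_on k S (\<lambda>x. frechet_derivative f (at x) v)"
  using assms by (auto simp: differentiable_on_eq_differentiable_at frechet_derivative_works)

text \<open>Derivatives on an open set are unique, so any explicit formula \<open>D\<close> may
  replace the chosen \<open>frechet_derivative\<close>. This is what allows the closure properties
  below to be proved by induction on \<open>k\<close>.\<close>

lemma Ck_on_SucI:
  assumes "open S" "\<And>x. x \<in> S \<Longrightarrow> (f has_derivative D x) (at x)"
    and "\<And>v. Ck_on k S (\<lambda>x. D x v)"
  shows "Ck_on (Suc k) S f"
proof -
  have "Ck_on k S (\<lambda>x. frechet_derivative f (at x) v) \<longleftrightarrow> Ck_on k S (\<lambda>x. D x v)" for v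
    by (rule Ck_on_cong[OF assms(1)]) (metis assms(2) frechet_derivative_at)
  with assms show ?thesis
    by (auto simp: differentiable_on_eq_differentiable_at differentiable_def)
qed

lemma Ck_on_pred: "open S \<Longrightarrow> Ck_on (Suc k) S f \<Longrightarrow> Ck_on k S f"
proof (induction k arbitrary: f)
  case 0
  then show ?case by (auto intro: differentiable_imp_continuous_on)
next
  case (Suc k)
  then show ?case
    by (intro Ck_on_SucI[OF Suc.prems(1) Ck_on_SucD(1)[OF Suc.prems(2,1)]])
      (use Ck_on_SucD(2)[OF Suc.prems(2,1)] in blast)+
qed

lemma Ck_on_subset:
  "Ck_on k S f \<Longrightarrow> T \<subseteq> S \<Longrightarrow> Ck_on k T f"
  by (induction k arbitrary: f) (auto intro: continuous_on_subset differentiable_on_subset)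

text \<open>Quantities along a curve are smooth in a chart only for nearby times; this lemma glues
  such statements together.\<close>

lemma Ck_on_local:
  assumes "open S" "\<And>x. x \<in> S \<Longrightarrow> \<exists>N. open N \<and> x \<in> N \<and> Ck_on k N f"
  shows "Ck_on k S f"
  using assms(2)
proof (induction k arbitrary: f)
  case 0
  have "continuous (at x) f" if "x \<in> S" for x
    using 0[OF that] by (auto simp: continuous_on_eq_continuous_at)
  then show ?case using assms(1) by (simp add: continuous_on_eq_continuous_at)
next
  case (Suc k)
  have "Ck_on k S (\<lambda>x. frechet_derivative f (at x) v)" for v
    by (rule Suc.IH) (use Suc.prems in fastforce)
  moreover have "f differentiable at x" if "x \<in> S" for x
    using Suc.prems[OF that] by (auto simp: differentiable_on_eq_differentiable_at)
  ultimately show ?case using assms(1) by (simp add: differentiable_on_eq_differentiable_at)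
qed

section \<open>Closure of the C^k maps under algebraic operations and composition\<close>

lemma Ck_on_const: "open S \<Longrightarrow> Ck_on k S (\<lambda>x. c)"
  by (induction k arbitrary: c) (auto simp: differentiable_on_def)

lemma Ck_on_add: "open S \<Longrightarrow> Ck_on k S f \<Longrightarrow> Ck_on k S g \<Longrightarrow> Ck_on k S (\<lambda>x. f x + g x)"
proof (induction k arbitrary: f g)
  case 0
  then show ?case by (auto intro: continuous_intros)
next
  case (Suc k)
  note f = Ck_on_SucD[OF Suc.prems(2,1)] and g = Ck_on_SucD[OF Suc.prems(3,1)]
  show ?case
    by (rule Ck_on_SucI[OF Suc.prems(1)], rule has_derivative_add[OF f(1) g(1)], assumption+)
      (intro Suc.IH Suc.prems f g)
qed

lemma (in bounded_linear) Ck_on: "open S \<Longrightarrow> Ck_on k S g \<Longrightarrow> Ck_on k S (\<lambda>x. f (g x))"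
proof (induction k arbitrary: g)
  case 0
  then show ?case by (auto intro: continuous_on)
next
  case (Suc k)
  note g = Ck_on_SucD[OF Suc.prems(2,1)]
  show ?case
    by (rule Ck_on_SucI[OF Suc.prems(1)], rule has_derivative[OF g(1)], assumption+)
      (intro Suc.IH Suc.prems g)
qed

text \<open>The product rule leaves one factor undifferentiated in each term, so the induction also
  uses that C^(k+1) maps are C^k.\<close>

lemma (in bounded_bilinear) Ck_on:
  "open S \<Longrightarrow> Ck_on k S f \<Longrightarrow> Ck_on k S g \<Longrightarrow> Ck_on k S (\<lambda>x. prod (f x) (g x))"
proof (induction k arbitrary: f g)
  case 0
  then show ?case by (auto intro: continuous_on)
next
  case (Suc k)
  note f = Ck_on_SucD[OF Suc.prems(2,1)] and g = Ck_on_SucD[OF Suc.prems(3,1)]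
  show ?case
    by (rule Ck_on_SucI[OF Suc.prems(1)], rule FDERIV[OF f(1) g(1)], assumption+)
      (intro Ck_on_add Suc.IH Suc.prems f g Ck_on_pred[OF Suc.prems(1,2)] Ck_on_pred[OF Suc.prems(1,3)])
qed

lemma Ck_on_sum:
  assumes "open S" "\<And>i. i \<in> I \<Longrightarrow> Ck_on k S (f i)"
  shows "Ck_on k S (\<lambda>x. \<Sum>i\<in>I. f i x)"
  using assms(2) by (induction I rule: infinite_finite_induct) (auto intro: Ck_on_const Ck_on_add assms(1))

text \<open>Smoothness of a family of linear maps is known for fixed arguments only. This expansion
  turns a moving argument into moving scalars times values at fixed basis vectors, and is used so
  throughout.\<close>

lemma linear_euclidean_expand:
  fixes f :: "'a::euclidean_space \<Rightarrow> 'b::real_vector"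
  assumes "linear f" shows "f u = (\<Sum>b\<in>Basis. (u \<bullet> b) *\<^sub>R f b)"
proof -
  have "f u = f (\<Sum>b\<in>Basis. (u \<bullet> b) *\<^sub>R b)" by (simp add: euclidean_representation)
  also have "\<dots> = (\<Sum>b\<in>Basis. (u \<bullet> b) *\<^sub>R f b)" by (simp add: linear_sum[OF assms] linear_cmul[OF assms])
  finally show ?thesis .
qed

text \<open>The chain rule evaluates the derivative of \<open>f\<close> at a vector that varies with
  \<open>x\<close>, which the induction hypothesis does not cover. Expanding that vector in a basis
  leaves products of inner products with partial derivatives composed with \<open>g\<close>; hence
  the Euclidean codomain of \<open>g\<close>.\<close>

lemma Ck_on_compose:
  fixes g :: "'a::real_normed_vector \<Rightarrow> 'b::euclidean_space"
  assumes "open S" "open T" "g ` S \<subseteq> T"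
  shows "Ck_on k T f \<Longrightarrow> Ck_on k S g \<Longrightarrow> Ck_on k S (\<lambda>x. f (g x))"
proof (induction k arbitrary: f)
  case 0
  then show ?case using assms by (auto intro: continuous_on_compose2)
next
  case (Suc k)
  note f = Ck_on_SucD[OF Suc.prems(1) assms(2)] and g = Ck_on_SucD[OF Suc.prems(2) assms(1)]
  show ?case
  proof (rule Ck_on_SucI[OF assms(1)])
    fix x assume x: "x \<in> S"
    have fx: "(f has_derivative frechet_derivative f (at (g x))) (at (g x))"
      using f(1) x assms(3) by auto
    have "((\<lambda>x. f (g x)) has_derivative
        (\<lambda>v. frechet_derivative f (at (g x)) (frechet_derivative g (at x) v))) (at x)"
      using has_derivative_compose[OF g(1)[OF x] fx] .
    moreover have exp: "frechet_derivative f (at (g x)) u =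
        (\<Sum>b\<in>Basis. (u \<bullet> b) *\<^sub>R frechet_derivative f (at (g x)) b)" for u
      by (rule linear_euclidean_expand) (use fx has_derivative_linear in blast)
    ultimately show "((\<lambda>x. f (g x)) has_derivative
        (\<lambda>v. \<Sum>b\<in>Basis. (frechet_derivative g (at x) v \<bullet> b) *\<^sub>R frechet_derivative f (at (g x)) b)) (at x)"
      unfolding exp[symmetric] by simp
  next
    fix v
    show "Ck_on k S (\<lambda>x. \<Sum>b\<in>Basis. (frechet_derivative g (at x) v \<bullet> b) *\<^sub>R frechet_derivative f (at (g x)) b)"
      by (intro Ck_on_sum assms bounded_bilinear.Ck_on[OF bounded_bilinear_scaleR]
          bounded_linear.Ck_on[OF bounded_linear_inner_left] g Suc.IH f Ck_on_pred[OF assms(1) Suc.prems(2)])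
  qed
qed

lemma Ck_on_inverse:
  fixes f :: "'a::real_normed_vector \<Rightarrow> 'b::real_normed_field"
  assumes "open S" "\<And>x. x \<in> S \<Longrightarrow> f x \<noteq> 0"
  shows "Ck_on k S f \<Longrightarrow> Ck_on k S (\<lambda>x. inverse (f x))"
proof (induction k)
  case 0
  then show ?case using assms by (auto intro: continuous_intros)
next
  case (Suc k)
  note f = Ck_on_SucD[OF Suc.prems assms(1)]
  show ?case
  proof (rule Ck_on_SucI[OF assms(1)])
    show "((\<lambda>x. inverse (f x)) has_derivative
        (\<lambda>v. (- 1) * (inverse (f x) * frechet_derivative f (at x) v * inverse (f x)))) (at x)"
      if "x \<in> S" for x
      using Deriv.has_derivative_inverse[OF assms(2)[OF that] f(1)[OF that]] by simp
  qed (intro bounded_bilinear.Ck_on[OF bounded_bilinear_mult] assms f Ck_on_const Suc.IH Ck_on_pred[OF assms(1) Suc.prems])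
qed

section \<open>Smooth maps, antiderivatives and inverse functions\<close>

lemma smooth_on_cong:
  "open S \<Longrightarrow> (\<And>x. x \<in> S \<Longrightarrow> f x = g x) \<Longrightarrow> smooth_on S f \<longleftrightarrow> smooth_on S g"
  using Ck_on_cong[of S f g] by (auto simp: smooth_on_def)

lemma smooth_on_subset: "smooth_on S f \<Longrightarrow> T \<subseteq> S \<Longrightarrow> smooth_on T f"
  by (auto simp: smooth_on_def intro: Ck_on_subset)

lemma smooth_on_local:
  "open S \<Longrightarrow> (\<And>x. x \<in> S \<Longrightarrow> \<exists>N. open N \<and> x \<in> N \<and> smooth_on N f) \<Longrightarrow> smooth_on S f"
  unfolding smooth_on_def by (metis Ck_on_local)

lemma smooth_on_const [intro!]: "open S \<Longrightarrow> smooth_on S (\<lambda>x. c)"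
  by (auto simp: smooth_on_def Ck_on_const)

lemma smooth_on_add: "open S \<Longrightarrow> smooth_on S f \<Longrightarrow> smooth_on S g \<Longrightarrow> smooth_on S (\<lambda>x. f x + g x)"
  by (auto simp: smooth_on_def Ck_on_add)

lemma (in bounded_linear) smooth_on: "open S \<Longrightarrow> smooth_on S g \<Longrightarrow> smooth_on S (\<lambda>x. f (g x))"
  by (auto simp: smooth_on_def Ck_on)

lemma (in bounded_bilinear) smooth_on:
  "open S \<Longrightarrow> smooth_on S f \<Longrightarrow> smooth_on S g \<Longrightarrow> smooth_on S (\<lambda>x. prod (f x) (g x))"
  by (auto simp: smooth_on_def Ck_on)

lemmas smooth_on_scaleR = bounded_bilinear.smooth_on[OF bounded_bilinear_scaleR]
lemmas smooth_on_mult = bounded_bilinear.smooth_on[OF bounded_bilinear_mult]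
lemmas smooth_on_inner_left = bounded_linear.smooth_on[OF bounded_linear_inner_left]
lemmas smooth_on_Re = bounded_linear.smooth_on[OF bounded_linear_Re]
lemmas smooth_on_Im = bounded_linear.smooth_on[OF bounded_linear_Im]
lemmas smooth_on_cnj = bounded_linear.smooth_on[OF bounded_linear_cnj]
lemmas smooth_on_of_real = bounded_linear.smooth_on[OF bounded_linear_of_real]
lemmas smooth_on_minus = bounded_linear.smooth_on[OF bounded_linear_minus[OF bounded_linear_ident]]

lemma smooth_on_diff:
  "open S \<Longrightarrow> smooth_on S f \<Longrightarrow> smooth_on S g \<Longrightarrow> smooth_on S (\<lambda>x. f x - g x)"
  using smooth_on_add[of S f "\<lambda>x. - g x"] smooth_on_minus[of S g] by simp

lemma smooth_on_sum:
  "open S \<Longrightarrow> (\<And>i. i \<in> I \<Longrightarrow> smooth_on S (f i)) \<Longrightarrow> smooth_on S (\<lambda>x. \<Sum>i\<in>I. f i x)"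
  by (auto simp: smooth_on_def Ck_on_sum)

lemma smooth_on_prod:
  fixes f :: "'i \<Rightarrow> 'a::real_normed_vector \<Rightarrow> 'b::real_normed_field"
  assumes "open S" "\<And>i. i \<in> I \<Longrightarrow> smooth_on S (f i)"
  shows "smooth_on S (\<lambda>x. \<Prod>i\<in>I. f i x)"
  using assms(2)
  by (induction I rule: infinite_finite_induct) (auto intro: smooth_on_mult assms(1))

lemma smooth_on_compose:
  fixes g :: "'a::real_normed_vector \<Rightarrow> 'b::euclidean_space"
  shows "open S \<Longrightarrow> open T \<Longrightarrow> g ` S \<subseteq> T \<Longrightarrow> smooth_on T f \<Longrightarrow> smooth_on S g \<Longrightarrow> smooth_on S (\<lambda>x. f (g x))"
  unfolding smooth_on_def using Ck_on_compose[of S T g _ f] by blast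

lemma smooth_on_inverse:
  fixes f :: "'a::real_normed_vector \<Rightarrow> 'b::real_normed_field"
  shows "open S \<Longrightarrow> (\<And>x. x \<in> S \<Longrightarrow> f x \<noteq> 0) \<Longrightarrow> smooth_on S f \<Longrightarrow> smooth_on S (\<lambda>x. inverse (f x))"
  by (auto simp: smooth_on_def Ck_on_inverse)

lemma smooth_on_divide:
  fixes f :: "'a::real_normed_vector \<Rightarrow> 'b::real_normed_field"
  assumes "open S" "\<And>x. x \<in> S \<Longrightarrow> g x \<noteq> 0" "smooth_on S f" "smooth_on S g"
  shows "smooth_on S (\<lambda>x. f x / g x)"
  unfolding divide_inverse using assms by (intro smooth_on_mult smooth_on_inverse)

lemma smooth_on_has_derivative:
  "smooth_on S f \<Longrightarrow> open S \<Longrightarrow> x \<in> S \<Longrightarrow> (f has_derivative frechet_derivative f (at x)) (at x)"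
  using Ck_on_SucD(1)[of 0 S f] by (auto simp: smooth_on_def simp del: Ck_on.simps)

lemma smooth_on_differentiable: "smooth_on S f \<Longrightarrow> open S \<Longrightarrow> x \<in> S \<Longrightarrow> f differentiable at x"
  using smooth_on_has_derivative differentiable_def by blast

lemma smooth_on_frechet_derivative:
  "smooth_on S f \<Longrightarrow> open S \<Longrightarrow> smooth_on S (\<lambda>x. frechet_derivative f (at x) v)"
  using Ck_on_SucD(2)[of _ S f] by (auto simp: smooth_on_def simp del: Ck_on.simps)

lemma smooth_on_imp_continuous_on: "smooth_on S f \<Longrightarrow> continuous_on S f"
  unfolding smooth_on_def using Ck_on.simps(1) by blast

lemma smooth_on_has_vector_derivative:
  fixes f :: "real \<Rightarrow> 'b::real_normed_vector"
  assumes "smooth_on S f" "open S" "t \<in> S"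
  shows "(f has_vector_derivative vector_derivative f (at t)) (at t)"
  using smooth_on_differentiable[OF assms] vector_derivative_works by blast

lemma smooth_on_vector_derivative:
  fixes f :: "real \<Rightarrow> 'b::real_normed_vector"
  assumes "smooth_on S f" "open S"
  shows "smooth_on S (\<lambda>t. vector_derivative f (at t))"
proof -
  have "frechet_derivative f (at t) 1 = vector_derivative f (at t)" if "t \<in> S" for t
    using frechet_derivative_eq_vector_derivative[OF smooth_on_differentiable[OF assms that]] by simp
  then show ?thesis
    using smooth_on_frechet_derivative[OF assms, of 1] by (subst (asm) smooth_on_cong[OF assms(2)])
qed

lemma Ck_on_Suc_vector_derivative:
  fixes f :: "real \<Rightarrow> 'b::real_normed_vector"
  assumes "open S" "\<And>t. t \<in> S \<Longrightarrow> (f has_vector_derivative g t) (at t)" "Ck_on k S g"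
  shows "Ck_on (Suc k) S f"
  by (rule Ck_on_SucI[OF assms(1), of f "\<lambda>t v. v *\<^sub>R g t"])
    (use assms in \<open>auto simp: has_vector_derivative_def
      intro!: bounded_linear.Ck_on[OF bounded_linear_scaleR_right]\<close>)

lemma smooth_on_antiderivative:
  fixes f :: "real \<Rightarrow> 'b::real_normed_vector"
  assumes "open S" "\<And>t. t \<in> S \<Longrightarrow> (f has_vector_derivative g t) (at t)" "smooth_on S g"
  shows "smooth_on S f"
  unfolding smooth_on_def
proof
  fix k
  have "Ck_on (Suc k) S f"
    using assms by (auto intro!: Ck_on_Suc_vector_derivative simp: smooth_on_def simp del: Ck_on.simps)
  then show "Ck_on k S f" by (rule Ck_on_pred[OF assms(1)])
qed

text \<open>A bootstrap: in the equation \<psi>' = 1 / f(\<psi>) the right-hand side is as regular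
  as \<psi>, so every C^k bound on \<psi> improves to C^(k+1).\<close>

lemma smooth_on_inverse_function:
  fixes \<psi> f :: "real \<Rightarrow> real"
  assumes "open S" "open T" "smooth_on T f" "\<psi> ` S \<subseteq> T" "\<And>t. t \<in> T \<Longrightarrow> f t \<noteq> 0"
    and "\<And>t. t \<in> S \<Longrightarrow> (\<psi> has_vector_derivative inverse (f (\<psi> t))) (at t)"
  shows "smooth_on S \<psi>"
  unfolding smooth_on_def
proof
  fix k
  show "Ck_on k S \<psi>"
  proof (induction k)
    case 0
    have "continuous (at t) \<psi>" if "t \<in> S" for t
      using assms(6)[OF that] by (rule has_vector_derivative_continuous)
    then show ?case using assms(1) by (simp add: continuous_on_eq_continuous_at)
  next
    case (Suc k)
    show ?case
      by (rule Ck_on_Suc_vector_derivative[OF assms(1,6)], assumption)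
        (use assms in \<open>auto simp: smooth_on_def intro!: Ck_on_inverse Ck_on_compose[OF assms(1,2), of \<psi> k f] Suc\<close>)
  qed
qed

section \<open>Symmetry of second derivatives\<close>

lemma has_real_derivative_along_line:
  assumes "(f has_derivative f') (at (a + s *\<^sub>R u))"
  shows "((\<lambda>s. f (a + s *\<^sub>R u)) has_real_derivative f' u) (at s)"
proof -
  have "((\<lambda>s. a + s *\<^sub>R u) has_derivative (\<lambda>r. r *\<^sub>R u)) (at s)"
    by (auto intro!: derivative_eq_intros)
  from has_derivative_compose[OF this assms]
  have "((\<lambda>s. f (a + s *\<^sub>R u)) has_derivative (\<lambda>r. f' (r *\<^sub>R u))) (at s)" .
  moreover have "f' (r *\<^sub>R u) = f' u * r" for r
    using has_derivative_linear[OF assms] by (simp add: linear_cmul)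
  ultimately show ?thesis by (simp add: has_field_derivative_def)
qed

text \<open>The mean value theorem is applied twice: along \<open>u\<close> to the difference of
  \<open>f\<close> and its translate by \<open>h v\<close>, then along \<open>v\<close> to the
  derivative obtained. The quotient is thus a value of the mixed derivative inside a small
  parallelogram at \<open>x\<close>, and continuity of that derivative at \<open>x\<close> gives the
  limit.\<close>

lemma second_difference_tendsto:
  fixes f :: "'a::real_normed_vector \<Rightarrow> real"
  assumes f: "smooth_on S f" and S: "open S" "x \<in> S"
  shows "((\<lambda>h. (f (x + h *\<^sub>R u + h *\<^sub>R v) - f (x + h *\<^sub>R u) - f (x + h *\<^sub>R v) + f x) / (h * h))
    \<longlongrightarrow> frechet_derivative (\<lambda>y. frechet_derivative f (at y) u) (at x) v) (at_right 0)"
    (is "(?Q \<longlongrightarrow> ?L) _")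
proof (rule tendstoI)
  fix e :: real assume e: "e > 0"
  define D where "D = (\<lambda>y. frechet_derivative f (at y) u)"
  define E where "E = (\<lambda>y. frechet_derivative D (at y) v)"
  have D: "smooth_on S D" unfolding D_def by (rule smooth_on_frechet_derivative[OF f S(1)])
  have "smooth_on S E" unfolding E_def by (rule smooth_on_frechet_derivative[OF D S(1)])
  then have "isCont E x"
    using S smooth_on_imp_continuous_on continuous_on_eq_continuous_at by blast
  then obtain r1 where r1: "r1 > 0" "\<And>y. dist y x < r1 \<Longrightarrow> dist (E y) (E x) < e"
    using e unfolding continuous_at_eps_delta by blast
  obtain r2 where r2: "r2 > 0" "ball x r2 \<subseteq> S" using S openE by blast
  define r where "r = min r1 r2"
  \<comment> \<open>For \<open>h < d\<close> the parallelogram spanned by \<open>h u\<close> and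
    \<open>h v\<close> at \<open>x\<close> stays within distance \<open>r\<close> of
    \<open>x\<close>. The summand 1 keeps the denominator positive when \<open>u\<close> and
    \<open>v\<close> vanish.\<close>
  define d where "d = r / (norm u + norm v + 1)"
  have r: "r > 0" using r1 r2 by (simp add: r_def)
  have d: "d > 0" using r by (simp add: d_def add_nonneg_pos)
  have "dist (?Q h) ?L < e" if h: "0 < h" "h < d" for h
  proof -
    have near: "dist (x + s *\<^sub>R u + t *\<^sub>R v) x < r" if "0 \<le> s" "s \<le> h" "0 \<le> t" "t \<le> h" for s t
    proof -
      have "dist (x + s *\<^sub>R u + t *\<^sub>R v) x \<le> s * norm u + t * norm v"
        using norm_triangle_ineq[of "s *\<^sub>R u" "t *\<^sub>R v"] that by (simp add: dist_norm add.assoc)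
      also have "\<dots> \<le> h * norm u + h * norm v"
        using that by (intro add_mono mult_right_mono) auto
      also have "\<dots> \<le> h * (norm u + norm v + 1)" using h by (simp add: algebra_simps)
      also have "\<dots> < r"
        using h by (simp add: d_def pos_less_divide_eq add_nonneg_pos)
      finally show ?thesis .
    qed
    have inS: "x + s *\<^sub>R u + t *\<^sub>R v \<in> S" if "0 \<le> s" "s \<le> h" "0 \<le> t" "t \<le> h" for s t
      using near[OF that] r2 by (auto simp: r_def dist_commute)
    have Df: "((\<lambda>s. f ((x + t *\<^sub>R v) + s *\<^sub>R u)) has_real_derivative D ((x + t *\<^sub>R v) + s *\<^sub>R u)) (at s)"
      if "0 \<le> s" "s \<le> h" "0 \<le> t" "t \<le> h" for s t
      unfolding D_def using inS[OF that]
      by (intro has_real_derivative_along_line smooth_on_has_derivative[OF f S(1)]) (simp add: ac_simps)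
    have "\<exists>\<xi>>0. \<xi> < h \<and> (f ((x + h *\<^sub>R v) + h *\<^sub>R u) - f (x + h *\<^sub>R u))
        - (f ((x + h *\<^sub>R v) + 0 *\<^sub>R u) - f (x + 0 *\<^sub>R u))
        = (h - 0) * (D ((x + h *\<^sub>R v) + \<xi> *\<^sub>R u) - D (x + \<xi> *\<^sub>R u))"
      by (rule MVT2[OF h(1), of "\<lambda>s. f ((x + h *\<^sub>R v) + s *\<^sub>R u) - f (x + s *\<^sub>R u)"])
        (use Df[of _ h] Df[of _ 0] h in \<open>auto intro!: DERIV_diff\<close>)
    then obtain \<xi> where \<xi>: "0 < \<xi>" "\<xi> < h"
      "(f ((x + h *\<^sub>R v) + h *\<^sub>R u) - f (x + h *\<^sub>R u)) - (f (x + h *\<^sub>R v) - f x)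
        = h * (D ((x + h *\<^sub>R v) + \<xi> *\<^sub>R u) - D (x + \<xi> *\<^sub>R u))" by auto
    have "((\<lambda>t. D ((x + \<xi> *\<^sub>R u) + t *\<^sub>R v)) has_real_derivative E ((x + \<xi> *\<^sub>R u) + t *\<^sub>R v)) (at t)"
      if "0 \<le> t" "t \<le> h" for t
      unfolding E_def using inS[of \<xi> t] \<xi> that
      by (intro has_real_derivative_along_line smooth_on_has_derivative[OF D S(1)]) auto
    from MVT2[OF h(1) this] obtain \<eta> where \<eta>: "0 < \<eta>" "\<eta> < h"
      "D ((x + \<xi> *\<^sub>R u) + h *\<^sub>R v) - D (x + \<xi> *\<^sub>R u) = h * E (x + \<xi> *\<^sub>R u + \<eta> *\<^sub>R v)" by auto
    have "?Q h = E (x + \<xi> *\<^sub>R u + \<eta> *\<^sub>R v)"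
      using \<xi>(3) \<eta>(3) h by (simp add: field_simps ac_simps)
    moreover have "dist (E (x + \<xi> *\<^sub>R u + \<eta> *\<^sub>R v)) (E x) < e"
      using near[of \<xi> \<eta>] \<xi> \<eta> r1(2) by (simp add: r_def)
    ultimately show ?thesis by (simp add: E_def D_def)
  qed
  then show "\<forall>\<^sub>F h in at_right 0. dist (?Q h) ?L < e"
    unfolding eventually_at_right_field using d by blast
qed

text \<open>The second difference is symmetric in \<open>u\<close> and \<open>v\<close>, so both
  mixed derivatives are limits of the same quotient. Vector values are treated componentwise, since
  the mean value theorem is for real functions.\<close>

lemma frechet_derivative_commute:
  fixes f :: "'a::real_normed_vector \<Rightarrow> 'b::euclidean_space"
  assumes f: "smooth_on S f" and S: "open S" "x \<in> S"
  shows "frechet_derivative (\<lambda>y. frechet_derivative f (at y) u) (at x) v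
       = frechet_derivative (\<lambda>y. frechet_derivative f (at y) v) (at x) u"
proof (rule euclidean_eqI)
  fix b :: 'b assume "b \<in> Basis"
  define g where "g = (\<lambda>y. f y \<bullet> b)"
  have g: "smooth_on S g" unfolding g_def by (rule smooth_on_inner_left[OF S(1) f])
  have g1: "frechet_derivative g (at y) w = frechet_derivative f (at y) w \<bullet> b" if "y \<in> S" for y w
    using frechet_derivative_at[OF has_derivative_inner_left[OF smooth_on_has_derivative[OF f S(1) that], of b]]
    by (simp add: g_def fun_eq_iff)
  have g2: "frechet_derivative (\<lambda>y. frechet_derivative g (at y) w) (at x) w'
      = frechet_derivative (\<lambda>y. frechet_derivative f (at y) w) (at x) w' \<bullet> b" for w w'
  proof -
    have "frechet_derivative (\<lambda>y. frechet_derivative g (at y) w) (at x)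
      = frechet_derivative (\<lambda>y. frechet_derivative f (at y) w \<bullet> b) (at x)"
      by (rule frechet_derivative_cong_open[OF S]) (rule g1)
    also have "\<dots> = (\<lambda>w'. frechet_derivative (\<lambda>y. frechet_derivative f (at y) w) (at x) w' \<bullet> b)"
      by (rule frechet_derivative_at[symmetric])
        (intro has_derivative_inner_left smooth_on_has_derivative[OF smooth_on_frechet_derivative[OF f S(1)] S])
    finally show ?thesis by simp
  qed
  have "frechet_derivative (\<lambda>y. frechet_derivative g (at y) u) (at x) v
       = frechet_derivative (\<lambda>y. frechet_derivative g (at y) v) (at x) u"
    by (rule tendsto_unique[OF _ second_difference_tendsto[OF g S]])
      (use second_difference_tendsto[OF g S, of v u] in \<open>auto simp: algebra_simps\<close>)
  then show "frechet_derivative (\<lambda>y. frechet_derivative f (at y) u) (at x) v \<bullet> b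
       = frechet_derivative (\<lambda>y. frechet_derivative f (at y) v) (at x) u \<bullet> b"
    by (simp add: g2)
qed

section \<open>Linear maps depending on a point\<close>

lemma linear_frechet_derivative_family:
  fixes B :: "'b::real_normed_vector \<Rightarrow> 'e::real_vector \<Rightarrow> 'c::real_normed_vector"
  assumes N: "open N" "x \<in> N" and B: "\<And>y. y \<in> N \<Longrightarrow> linear (B y)"
    and dB: "\<And>w. (\<lambda>y. B y w) differentiable at x"
  shows "linear (\<lambda>w. frechet_derivative (\<lambda>y. B y w) (at x) z)"
proof (rule linearI)
  let ?D = "\<lambda>w. frechet_derivative (\<lambda>y. B y w) (at x)"
  have D: "((\<lambda>y. B y w) has_derivative ?D w) (at x)" for w
    using dB frechet_derivative_works by blast
  fix s t r
  have "((\<lambda>y. B y (s + t)) has_derivative (\<lambda>v. ?D s v + ?D t v)) (at x)"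
    by (rule has_derivative_transform_within_open[OF has_derivative_add[OF D[of s] D[of t]] N])
      (simp add: linear_add[OF B])
  from fun_cong[OF has_derivative_unique[OF D this]] show "?D (s + t) z = ?D s z + ?D t z" .
  have "((\<lambda>y. B y (r *\<^sub>R s)) has_derivative (\<lambda>v. r *\<^sub>R ?D s v)) (at x)"
    by (rule has_derivative_transform_within_open[OF has_derivative_scaleR_right[OF D[of s]] N])
      (simp add: linear_cmul[OF B])
  from fun_cong[OF has_derivative_unique[OF D this]] show "?D (r *\<^sub>R s) z = r *\<^sub>R ?D s z" .
qed

text \<open>The product rule for a form at a moving point applied to a moving vector. Only the
  values at fixed vectors are assumed differentiable, as in \<open>smooth_1form\<close>; the basis
  expansion, valid as long as \<open>g y\<close> stays in \<open>N\<close>, gives the rest.\<close>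

lemma has_derivative_linear_family:
  fixes B :: "'b::real_normed_vector \<Rightarrow> 'e::euclidean_space \<Rightarrow> 'c::real_normed_vector"
  assumes N: "open N" "g x \<in> N" and B: "\<And>y. y \<in> N \<Longrightarrow> linear (B y)"
    and dB: "\<And>w. (\<lambda>y. B y w) differentiable at (g x)"
    and g: "(g has_derivative g') (at x)" and W: "(W has_derivative W') (at x)"
  shows "((\<lambda>y. B (g y) (W y)) has_derivative
    (\<lambda>v. frechet_derivative (\<lambda>y. B y (W x)) (at (g x)) (g' v) + B (g x) (W' v))) (at x)"
proof -
  let ?D = "\<lambda>w. frechet_derivative (\<lambda>y. B y w) (at (g x))"
  have D: "((\<lambda>y. B y w) has_derivative ?D w) (at (g x))" for w
    using dB frechet_derivative_works by blast
  have D_expand: "?D w z = (\<Sum>b\<in>Basis. (w \<bullet> b) *\<^sub>R ?D b z)" for w z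
    by (rule linear_euclidean_expand[OF linear_frechet_derivative_family[OF N B dB]])
  have main: "((\<lambda>y. \<Sum>b\<in>Basis. (W y \<bullet> b) *\<^sub>R B (g y) b) has_derivative
      (\<lambda>v. \<Sum>b\<in>Basis. (W x \<bullet> b) *\<^sub>R ?D b (g' v) + (W' v \<bullet> b) *\<^sub>R B (g x) b)) (at x)"
    by (intro has_derivative_sum has_derivative_scaleR has_derivative_inner_left W
        has_derivative_compose[OF g D])
  have D_eq: "(\<Sum>b\<in>Basis. (W x \<bullet> b) *\<^sub>R ?D b (g' v) + (W' v \<bullet> b) *\<^sub>R B (g x) b)
      = ?D (W x) (g' v) + B (g x) (W' v)" for v
    using linear_euclidean_expand[OF B[OF N(2)], of "W' v"] D_expand[of "W x" "g' v"]
    by (simp add: sum.distrib)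
  have ev: "\<forall>\<^sub>F y in at x. (\<Sum>b\<in>Basis. (W y \<bullet> b) *\<^sub>R B (g y) b) = B (g y) (W y)"
  proof -
    have "\<forall>\<^sub>F y in at x. g y \<in> N"
      using has_derivative_continuous[OF g] N topological_tendstoD unfolding continuous_within by blast
    then show ?thesis by eventually_elim (rule linear_euclidean_expand[OF B, symmetric])
  qed
  show ?thesis
    by (rule has_derivative_transform_eventually[OF main[unfolded D_eq] ev])
      (rule linear_euclidean_expand[OF B[OF N(2)], symmetric], simp)
qed

lemma smooth_on_linear_family:
  fixes B :: "'b::euclidean_space \<Rightarrow> 'e::euclidean_space \<Rightarrow> 'c::real_normed_vector"
  assumes S: "open S" and N: "open N" "g ` S \<subseteq> N" and B: "\<And>y. y \<in> N \<Longrightarrow> linear (B y)"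
    and smooth: "\<And>w. smooth_on N (\<lambda>y. B y w)" "smooth_on S g" "smooth_on S W"
  shows "smooth_on S (\<lambda>x. B (g x) (W x))"
proof -
  have "B (g x) (W x) = (\<Sum>b\<in>Basis. (W x \<bullet> b) *\<^sub>R B (g x) b)" if "x \<in> S" for x
    using N(2) that by (intro linear_euclidean_expand B) auto
  moreover have "smooth_on S (\<lambda>x. \<Sum>b\<in>Basis. (W x \<bullet> b) *\<^sub>R B (g x) b)"
    by (intro smooth_on_sum smooth_on_scaleR smooth_on_inner_left smooth
        smooth_on_compose[where T = N and f = "\<lambda>y. B y _"] S N)
  ultimately show ?thesis by (subst smooth_on_cong[OF S])
qed

section \<open>Charts\<close>

locale atlas =
  fixes A :: "('m::{t2_space,second_countable_topology}, 'e::euclidean_space) chart set"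
  assumes smooth_atlas: "smooth_atlas A"
begin

text \<open>\<open>from_chart\<close> and \<open>to_chart\<close> are both special cases, with the
  preferred chart at one end, so one cocycle rule yields all conversions of tangent vectors.\<close>

definition transition :: "('m, 'e) chart \<Rightarrow> ('m, 'e) chart \<Rightarrow> 'm \<Rightarrow> 'e \<Rightarrow> 'e" where
  "transition c c' p = frechet_derivative (snd c' \<circ> chart_inv c) (at (snd c p))"

lemma from_chart_eq: "from_chart A c p = transition c (chart_at A p) p"
  and to_chart_eq: "to_chart A c p = transition (chart_at A p) c p"
  by (simp_all add: from_chart_def to_chart_def transition_def fun_eq_iff)

lemma chart_at: "chart_at A p \<in> A" "p \<in> fst (chart_at A p)"
proof -
  have "p \<in> (\<Union>c\<in>A. fst c)" using smooth_atlas unfolding smooth_atlas_def by blast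
  then have "\<exists>c. c \<in> A \<and> p \<in> fst c" by blast
  from someI_ex[OF this] show "chart_at A p \<in> A" "p \<in> fst (chart_at A p)"
    by (auto simp: chart_at_def)
qed

lemma chart_homeomorphism:
  "c \<in> A \<Longrightarrow> homeomorphism (fst c) (snd c ` fst c) (snd c) (chart_inv c)"
  and open_chart_domain: "c \<in> A \<Longrightarrow> open (fst c)"
  and open_chart_range: "c \<in> A \<Longrightarrow> open (snd c ` fst c)"
  using smooth_atlas unfolding smooth_atlas_def by blast+

lemma chart_inv_chart [simp]: "c \<in> A \<Longrightarrow> p \<in> fst c \<Longrightarrow> chart_inv c (snd c p) = p"
  using chart_homeomorphism homeomorphism_apply1 by blast

lemma chart_inv_in: "c \<in> A \<Longrightarrow> y \<in> snd c ` (fst c \<inter> V) \<Longrightarrow> chart_inv c y \<in> fst c \<inter> V"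
  by auto

lemma open_chart_image:
  assumes "c \<in> A" "open V" shows "open (snd c ` (fst c \<inter> V))"
proof -
  have "openin (top_of_set (snd c ` fst c)) (snd c ` (fst c \<inter> V))"
    by (rule homeomorphism_imp_open_map[OF chart_homeomorphism[OF assms(1)]])
      (use assms(2) in \<open>auto simp: openin_open\<close>)
  then show ?thesis using open_chart_range[OF assms(1)] openin_open_trans by blast
qed

lemma smooth_transition:
  "c \<in> A \<Longrightarrow> c' \<in> A \<Longrightarrow> smooth_on (snd c ` (fst c \<inter> fst c')) (snd c' \<circ> chart_inv c)"
  using smooth_atlas unfolding smooth_atlas_def by blast

lemma has_derivative_transition:
  assumes "c \<in> A" "c' \<in> A" "p \<in> fst c" "p \<in> fst c'"
  shows "((snd c' \<circ> chart_inv c) has_derivative transition c c' p) (at (snd c p))"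
  unfolding transition_def
  by (rule smooth_on_has_derivative[OF smooth_transition])
    (use assms open_chart_image open_chart_domain in auto)

lemma linear_transition:
  "c \<in> A \<Longrightarrow> c' \<in> A \<Longrightarrow> p \<in> fst c \<Longrightarrow> p \<in> fst c' \<Longrightarrow> linear (transition c c' p)"
  by (rule has_derivative_linear[OF has_derivative_transition])

lemma transition_compose:
  assumes "c \<in> A" "c' \<in> A" "c'' \<in> A" "p \<in> fst c" "p \<in> fst c'" "p \<in> fst c''"
  shows "transition c' c'' p (transition c c' p u) = transition c c'' p u"
proof -
  let ?S = "snd c ` (fst c \<inter> (fst c' \<inter> fst c''))"
  have S: "open ?S" "snd c p \<in> ?S"
    using assms by (auto intro!: open_chart_image open_Int open_chart_domain)
  have 1: "((snd c' \<circ> chart_inv c) has_derivative transition c c' p) (at (snd c p))"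
    using has_derivative_transition assms by auto
  have "((snd c'' \<circ> chart_inv c') has_derivative transition c' c'' p) (at ((snd c' \<circ> chart_inv c) (snd c p)))"
    using has_derivative_transition[of c' c'' p] assms by simp
  from diff_chain_at[OF 1 this]
  have "((snd c'' \<circ> chart_inv c) has_derivative transition c' c'' p \<circ> transition c c' p) (at (snd c p))"
    by (rule has_derivative_transform_within_open[OF _ S]) (use assms in auto)
  from has_derivative_unique[OF this has_derivative_transition[of c c'' p]] assms
  show ?thesis by (auto simp: fun_eq_iff)
qed

lemma transition_self:
  assumes "c \<in> A" "p \<in> fst c" shows "transition c c p u = u"
proof -
  have S: "open (snd c ` fst c)" "snd c p \<in> snd c ` fst c"
    using assms open_chart_range by auto
  have "((snd c \<circ> chart_inv c) has_derivative (\<lambda>u. u)) (at (snd c p))"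
    by (rule has_derivative_transform_within_open[OF has_derivative_ident S]) (use assms in auto)
  from has_derivative_unique[OF this has_derivative_transition[of c c p]] assms
  show ?thesis by (auto simp: fun_eq_iff)
qed

lemma linear_from_chart: "c \<in> A \<Longrightarrow> p \<in> fst c \<Longrightarrow> linear (from_chart A c p)"
  by (simp add: from_chart_eq linear_transition chart_at)

lemma from_chart_transition:
  "c \<in> A \<Longrightarrow> c' \<in> A \<Longrightarrow> p \<in> fst c \<Longrightarrow> p \<in> fst c' \<Longrightarrow>
    from_chart A c' p (transition c c' p u) = from_chart A c p u"
  by (simp add: from_chart_eq transition_compose chart_at)

lemma from_chart_to_chart [simp]:
  "c \<in> A \<Longrightarrow> p \<in> fst c \<Longrightarrow> from_chart A c p (to_chart A c p v) = v"
  and to_chart_from_chart [simp]: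
  "c \<in> A \<Longrightarrow> p \<in> fst c \<Longrightarrow> to_chart A c p (from_chart A c p u) = u"
  by (simp_all add: from_chart_eq to_chart_eq transition_compose transition_self chart_at)

lemma from_chart_at [simp]: "from_chart A (chart_at A p) p u = u"
  and to_chart_at [simp]: "to_chart A (chart_at A p) p u = u"
  by (simp_all add: from_chart_eq to_chart_eq transition_self chart_at)

section \<open>Fields, 1-forms and exterior derivatives in charts\<close>

lemma from_chart_field:
  "c \<in> A \<Longrightarrow> p \<in> fst c \<Longrightarrow> from_chart A c p (field_in_chart A c X (snd c p)) = X p"
  by (simp add: field_in_chart_def)

lemma in_chart_at:
  "c \<in> A \<Longrightarrow> p \<in> fst c \<Longrightarrow> in_chart A c a (snd c p) u = a p (from_chart A c p u)"
  by (simp add: in_chart_def)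

lemma linear_in_chart:
  "c \<in> A \<Longrightarrow> (\<And>p. p \<in> V \<Longrightarrow> linear (a p)) \<Longrightarrow> y \<in> snd c ` (fst c \<inter> V) \<Longrightarrow> linear (in_chart A c a y)"
  unfolding in_chart_def
  by (rule linear_compose[OF linear_from_chart, unfolded o_def]) auto

lemma in_chart_transition:
  assumes "c \<in> A" "c' \<in> A" "y \<in> snd c ` (fst c \<inter> fst c')"
  shows "in_chart A c a y u = in_chart A c' a ((snd c' \<circ> chart_inv c) y)
    (frechet_derivative (snd c' \<circ> chart_inv c) (at y) u)"
  using assms from_chart_transition[of c c' "chart_inv c y" u]
  by (auto simp: in_chart_def transition_def)

text \<open>\<open>ext_d\<close> is computed in the preferred chart of the point, which may jump
  from one point to the next. Statements about the dependence of the derivative on the point need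
  this version in a fixed chart.\<close>

definition d_in_chart :: "('m, 'e) chart \<Rightarrow> ('m \<Rightarrow> 'e \<Rightarrow> 'b::real_normed_vector) \<Rightarrow> 'e \<Rightarrow> 'e \<Rightarrow> 'e \<Rightarrow> 'b" where
  "d_in_chart c a y u v = frechet_derivative (\<lambda>y. in_chart A c a y v) (at y) u
      - frechet_derivative (\<lambda>y. in_chart A c a y u) (at y) v"

lemma has_derivative_1form:
  assumes a: "smooth_1form A V a" "open V" and c: "c \<in> A" "p \<in> fst c" "p \<in> V"
    and g: "(g has_derivative g') (at x)" "g x = snd c p" and W: "(W has_derivative W') (at x)"
  shows "((\<lambda>y. in_chart A c a (g y) (W y)) has_derivative
    (\<lambda>v. frechet_derivative (\<lambda>y. in_chart A c a y (W x)) (at (snd c p)) (g' v)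
      + in_chart A c a (snd c p) (W' v))) (at x)"
proof -
  let ?N = "snd c ` (fst c \<inter> V)"
  have N: "open ?N" "snd c p \<in> ?N" using open_chart_image c a by auto
  have "(\<lambda>y. in_chart A c a y w) differentiable at (g x)" for w
    using smooth_on_differentiable[OF _ N] a(1) c(1) g(2) by (auto simp: smooth_1form_def)
  moreover have "linear (in_chart A c a y)" if "y \<in> ?N" for y
    using linear_in_chart[OF c(1) _ that] a(1) by (auto simp: smooth_1form_def)
  ultimately show ?thesis
    using has_derivative_linear_family[of ?N g x "in_chart A c a", OF _ _ _ _ g(1) W] N g(2) by auto
qed

text \<open>The pullback of a 1-form commutes with \<open>d\<close>: the second derivatives of the transition map drop
  out by their symmetry.\<close>

lemma ext_d_in_chart:
  assumes a: "smooth_1form A V a" "open V" and c: "c \<in> A" "p \<in> fst c" "p \<in> V"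
  shows "ext_d A a p (from_chart A c p u) (from_chart A c p v) = d_in_chart c a (snd c p) u v"
proof -
  define c0 where "c0 = chart_at A p"
  have c0: "c0 \<in> A" "p \<in> fst c0" by (auto simp: c0_def chart_at)
  define \<tau> where "\<tau> = snd c0 \<circ> chart_inv c"
  let ?S = "snd c ` (fst c \<inter> fst c0)"
  have S: "open ?S" "snd c p \<in> ?S" using open_chart_image open_chart_domain c c0 by auto
  have \<tau>: "smooth_on ?S \<tau>" unfolding \<tau>_def by (rule smooth_transition[OF c(1) c0(1)])
  have \<tau>': "(\<tau> has_derivative frechet_derivative \<tau> (at (snd c p))) (at (snd c p))"
    by (rule smooth_on_has_derivative[OF \<tau> S])
  have \<tau>p: "\<tau> (snd c p) = snd c0 p" using c by (simp add: \<tau>_def)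
  have \<tau>f: "frechet_derivative \<tau> (at (snd c p)) w = from_chart A c p w" for w
    by (simp add: \<tau>_def c0_def from_chart_def)
  have main: "frechet_derivative (\<lambda>y. in_chart A c a y v) (at (snd c p)) u
    = frechet_derivative (\<lambda>z. in_chart A c0 a z (from_chart A c p v)) (at (snd c0 p)) (from_chart A c p u)
      + in_chart A c0 a (snd c0 p) (frechet_derivative (\<lambda>y. frechet_derivative \<tau> (at y) v) (at (snd c p)) u)"
    for u v
  proof -
    have "frechet_derivative (\<lambda>y. in_chart A c a y v) (at (snd c p))
        = frechet_derivative (\<lambda>y. in_chart A c0 a (\<tau> y) (frechet_derivative \<tau> (at y) v)) (at (snd c p))"
      by (rule frechet_derivative_cong_open[OF S])
        (unfold \<tau>_def, rule in_chart_transition[OF c(1) c0(1)])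
    also have "\<dots> = (\<lambda>u. frechet_derivative (\<lambda>z. in_chart A c0 a z (frechet_derivative \<tau> (at (snd c p)) v))
          (at (snd c0 p)) (frechet_derivative \<tau> (at (snd c p)) u)
        + in_chart A c0 a (snd c0 p) (frechet_derivative (\<lambda>y. frechet_derivative \<tau> (at y) v) (at (snd c p)) u))"
      by (rule frechet_derivative_at[symmetric], rule has_derivative_1form[OF a c0 c(3) \<tau>' \<tau>p])
        (rule smooth_on_has_derivative[OF smooth_on_frechet_derivative[OF \<tau> S(1)] S])
    finally show ?thesis by (simp add: \<tau>f)
  qed
  show ?thesis
    unfolding d_in_chart_def main ext_d_def Let_def c0_def[symmetric]
    using frechet_derivative_commute[OF \<tau> S] by simp
qed

lemma ext_d_fields:
  assumes "smooth_1form A V a" "open V" "c \<in> A" "p \<in> fst c" "p \<in> V"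
  shows "ext_d A a p (X p) (Y p)
    = d_in_chart c a (snd c p) (field_in_chart A c X (snd c p)) (field_in_chart A c Y (snd c p))"
  using ext_d_in_chart[OF assms, of "field_in_chart A c X (snd c p)" "field_in_chart A c Y (snd c p)"]
  by (simp add: from_chart_field assms)

lemma bilinear_d_in_chart:
  assumes a: "smooth_1form A V a" "open V" and c: "c \<in> A" and y: "y \<in> snd c ` (fst c \<inter> V)"
  shows "linear (d_in_chart c a y u)" "linear (\<lambda>u. d_in_chart c a y u v)"
proof -
  have y': "open (snd c ` (fst c \<inter> V))" using open_chart_image c a by auto
  have dif: "(\<lambda>y. in_chart A c a y u) differentiable at y" for u
    using a c smooth_on_differentiable[OF _ y' y] unfolding smooth_1form_def by auto
  then have D: "((\<lambda>y. in_chart A c a y u) has_derivative frechet_derivative (\<lambda>y. in_chart A c a y u) (at y)) (at y)" for u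
    using frechet_derivative_works by blast
  have lin: "linear (in_chart A c a z)" if "z \<in> snd c ` (fst c \<inter> V)" for z
    using linear_in_chart[OF c _ that] a unfolding smooth_1form_def by blast
  have 1: "linear (frechet_derivative (\<lambda>y. in_chart A c a y u) (at y))" for u
    using D has_derivative_linear by blast
  have 2: "linear (\<lambda>u. frechet_derivative (\<lambda>y. in_chart A c a y u) (at y) v)" for v
    by (rule linear_frechet_derivative_family[OF y' y lin dif])
  show "linear (d_in_chart c a y u)" "linear (\<lambda>u. d_in_chart c a y u v)"
    unfolding d_in_chart_def by (intro linear_compose_sub 1 2)+
qed

lemma bilinear_ext_d:
  assumes "smooth_1form A V a" "open V" "p \<in> V"
  shows "linear (ext_d A a p u)" "linear (\<lambda>u. ext_d A a p u v)"
proof -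
  have "ext_d A a p = d_in_chart (chart_at A p) a (snd (chart_at A p) p)"
    by (simp add: fun_eq_iff ext_d_def d_in_chart_def Let_def)
  then show "linear (ext_d A a p u)" "linear (\<lambda>u. ext_d A a p u v)"
    using bilinear_d_in_chart[OF assms(1,2) chart_at(1), of "snd (chart_at A p) p" p] assms(3) chart_at(2)[of p]
    by auto
qed

lemma smooth_d_in_chart:
  assumes a: "smooth_1form A V a" "open V" and c: "c \<in> A"
    and X: "smooth_on (snd c ` (fst c \<inter> V)) X" and Y: "smooth_on (snd c ` (fst c \<inter> V)) Y"
  shows "smooth_on (snd c ` (fst c \<inter> V)) (\<lambda>y. d_in_chart c a y (X y) (Y y))"
proof -
  let ?S = "snd c ` (fst c \<inter> V)"
  have S: "open ?S" using open_chart_image c a by auto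
  have "d_in_chart c a y (X y) (Y y)
      = (\<Sum>b\<in>Basis. (X y \<bullet> b) *\<^sub>R (\<Sum>b'\<in>Basis. (Y y \<bullet> b') *\<^sub>R d_in_chart c a y b b'))" if "y \<in> ?S" for y
    by (subst linear_euclidean_expand[OF bilinear_d_in_chart(2)[OF a c that]],
        subst linear_euclidean_expand[OF bilinear_d_in_chart(1)[OF a c that]]) (rule refl)
  moreover have "smooth_on ?S (\<lambda>y. \<Sum>b\<in>Basis. (X y \<bullet> b) *\<^sub>R (\<Sum>b'\<in>Basis. (Y y \<bullet> b') *\<^sub>R d_in_chart c a y b b'))"
    unfolding d_in_chart_def
    by (intro smooth_on_sum smooth_on_scaleR smooth_on_inner_left smooth_on_diff S X Y
        smooth_on_frechet_derivative) (use a c in \<open>auto simp: smooth_1form_def\<close>)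
  ultimately show ?thesis by (subst smooth_on_cong[OF S])
qed

text \<open>In d\<alpha>(X,Y) = X \<alpha>(Y) - Y \<alpha>(X) - \<alpha>([X,Y]) the first two terms
  vanish. In coordinates, differentiating the identity \<open>a(X) = 0\<close> trades the derivative
  of the coefficients of \<open>a\<close> for minus \<open>a\<close> of the derivative of
  \<open>X\<close>.\<close>

lemma ext_d_lie_bracket:
  assumes a: "smooth_1form A V a" "open V" "p \<in> V"
    and X: "smooth_field A V X" "\<And>q. q \<in> V \<Longrightarrow> a q (X q) = 0"
    and Y: "smooth_field A V Y" "\<And>q. q \<in> V \<Longrightarrow> a q (Y q) = 0"
  shows "ext_d A a p (X p) (Y p) = - a p (lie_bracket A X Y p)"
proof -
  define c where "c = chart_at A p"
  have c: "c \<in> A" "p \<in> fst c" by (auto simp: c_def chart_at)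
  let ?S = "snd c ` (fst c \<inter> V)"
  have S: "open ?S" "snd c p \<in> ?S" using open_chart_image c a by auto
  have [simp]: "field_in_chart A c X (snd c p) = X p" for X
    using c by (simp add: field_in_chart_def) (simp add: c_def)
  have [simp]: "in_chart A c a (snd c p) w = a p w" for w
    using c by (simp add: in_chart_def) (simp add: c_def)
  have *: "frechet_derivative (\<lambda>y. in_chart A c a y (X p)) (at (snd c p)) v
      = - a p (frechet_derivative (field_in_chart A c X) (at (snd c p)) v)"
    if X: "smooth_field A V X" "\<And>q. q \<in> V \<Longrightarrow> a q (X q) = 0" for X v
  proof -
    have dX: "(field_in_chart A c X has_derivative frechet_derivative (field_in_chart A c X) (at (snd c p))) (at (snd c p))"
      by (rule smooth_on_has_derivative[OF _ S]) (use X c in \<open>auto simp: smooth_field_def\<close>)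
    have "((\<lambda>y. in_chart A c a y (field_in_chart A c X y)) has_derivative (\<lambda>v. 0)) (at (snd c p))"
      by (rule has_derivative_transform_within_open[OF has_derivative_const S])
        (use c X in \<open>auto simp: in_chart_at from_chart_field\<close>)
    from fun_cong[OF has_derivative_unique[OF has_derivative_1form[OF a(1,2) c a(3) has_derivative_ident refl dX] this], of v]
    show ?thesis by (simp add: add_eq_0_iff)
  qed
  have "a p (u - v) = a p u - a p v" for u v
    using a linear_diff unfolding smooth_1form_def by blast
  then show ?thesis
    unfolding ext_d_def lie_bracket_def Let_def c_def[symmetric] using *[OF X] *[OF Y] by simp
qed

section \<open>Curves in charts\<close>

lemma vector_derivative_transition:
  assumes "(snd c \<circ> \<gamma> has_vector_derivative u) (at t)" "open I" "t \<in> I" "continuous_on I \<gamma>"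
    and c: "c \<in> A" "c' \<in> A" "\<gamma> t \<in> fst c" "\<gamma> t \<in> fst c'"
  shows "((snd c' \<circ> \<gamma>) has_vector_derivative transition c c' (\<gamma> t) u) (at t)"
proof -
  let ?N = "{t \<in> I. \<gamma> t \<in> fst c \<inter> fst c'}"
  have N: "open ?N" "t \<in> ?N"
    using assms continuous_open_preimage[OF assms(4,2) open_Int[OF open_chart_domain open_chart_domain, of c c']]
    by (auto simp: vimage_def Int_def)
  have "((snd c' \<circ> chart_inv c) \<circ> (snd c \<circ> \<gamma>) has_vector_derivative transition c c' (\<gamma> t) u) (at t)"
    by (rule vector_derivative_diff_chain_within[OF assms(1)])
      (use has_derivative_transition[OF c] in \<open>simp add: has_derivative_at_withinI o_def\<close>)
  then show ?thesis
    by (rule has_vector_derivative_transform_within_open[OF _ N]) (use c in auto)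
qed

lemma curve_chart_smooth:
  assumes "smooth_curve A I \<gamma>" "open I" "c \<in> A"
  shows "open {t \<in> I. \<gamma> t \<in> fst c}" "smooth_on {t \<in> I. \<gamma> t \<in> fst c} (snd c \<circ> \<gamma>)"
  using continuous_open_preimage[of I \<gamma> "fst c"] assms open_chart_domain
  by (auto simp: smooth_curve_def vimage_def Int_def)

lemma curve_has_vector_derivative:
  assumes "smooth_curve A I \<gamma>" "open I" "c \<in> A" "t \<in> I" "\<gamma> t \<in> fst c"
  shows "((snd c \<circ> \<gamma>) has_vector_derivative vector_derivative (snd c \<circ> \<gamma>) (at t)) (at t)"
  by (rule smooth_on_has_vector_derivative[OF curve_chart_smooth(2,1)[OF assms(1-3)]]) (use assms in auto)

text \<open>The chart used by \<open>velocity\<close> may change with every \<open>t\<close>;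
  through this identity a whole stretch of a curve can be handled in a single chart.\<close>

lemma velocity_from_chart:
  assumes "smooth_curve A I \<gamma>" "open I" "c \<in> A" "t \<in> I" "\<gamma> t \<in> fst c"
  shows "from_chart A c (\<gamma> t) (vector_derivative (snd c \<circ> \<gamma>) (at t)) = velocity A \<gamma> t"
  using vector_derivative_transition[OF curve_has_vector_derivative[OF assms] assms(2,4) _ assms(3)
      chart_at(1) assms(5) chart_at(2)] assms(1)
  by (auto simp: smooth_curve_def velocity_def from_chart_eq intro!: vector_derivative_at[symmetric])

end

section \<open>Complexified tangent vectors\<close>

lemma cx1_cx_scale:
  assumes "linear f" shows "cx1 f (cx_scale a Z) = a * cx1 f Z"
  using complex_eq[of a]
  by (simp add: cx1_def cx_scale_def linear_diff[OF assms] linear_add[OF assms] linear_cmul[OF assms]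
      scaleR_conv_of_real complex_eq_iff algebra_simps)

lemma cx1_sum: "linear f \<Longrightarrow> cx1 f (\<Sum>i\<in>I. Z i) = (\<Sum>i\<in>I. cx1 f (Z i))"
  by (simp add: cx1_def fst_sum snd_sum linear_sum sum.distrib sum_distrib_left)

lemma cx_conj_cx_scale: "cx_conj (cx_scale a Z) = cx_scale (cnj a) (cx_conj Z)"
  by (simp add: cx_conj_def cx_scale_def)

lemma cx_conj_sum: "cx_conj (\<Sum>i\<in>I. Z i) = (\<Sum>i\<in>I. cx_conj (Z i))"
  by (simp add: cx_conj_def prod_eq_iff fst_sum snd_sum sum_negf)

lemma
  fixes B :: "'e::real_vector \<Rightarrow> 'e \<Rightarrow> real"
  assumes B: "\<And>u. linear (B u)" "\<And>v. linear (\<lambda>u. B u v)"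
  defines "C \<equiv> cx2 (\<lambda>u v. complex_of_real (B u v))"
  shows cx2_scale_left: "C (cx_scale a Z) W = a * C Z W"
    and cx2_scale_right: "C Z (cx_scale a W) = a * C Z W"
    and cx2_sum_left: "C (\<Sum>i\<in>I. Z' i) W = (\<Sum>i\<in>I. C (Z' i) W)"
    and cx2_sum_right: "C Z (\<Sum>i\<in>I. Z' i) = (\<Sum>i\<in>I. C Z (Z' i))"
  using complex_eq[of a]
  by (simp_all add: C_def cx2_def cx_scale_def fst_sum snd_sum linear_sum[OF B(1)] linear_sum[OF B(2)]
      linear_diff[OF B(1)] linear_diff[OF B(2)] linear_add[OF B(1)] linear_add[OF B(2)]
      linear_cmul[OF B(1)] linear_cmul[OF B(2)] sum.distrib sum_subtractf sum_distrib_left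
      complex_eq_iff algebra_simps)

section \<open>Determinants and inverse matrices with smooth entries\<close>

lemma smooth_on_det:
  fixes f :: "'n::finite \<Rightarrow> 'n \<Rightarrow> 'a::real_normed_vector \<Rightarrow> 'b::real_normed_field"
  assumes "open S" "\<And>i j. smooth_on S (f i j)"
  shows "smooth_on S (\<lambda>y. det (\<chi> i j. f i j y))"
  unfolding det_def by (simp, intro smooth_on_sum smooth_on_mult smooth_on_prod smooth_on_const assms)

text \<open>Column \<open>l\<close> of the inverse solves \<open>M *v x = axis l 1\<close>, to which
  Cramer's rule applies. As a quotient of determinants, the entry visibly depends smoothly on the
  entries of \<open>M\<close>.\<close>

lemma matrix_inv_entry:
  fixes M :: "'a::field^'n^'n"
  assumes "det M \<noteq> 0"
  shows "matrix_inv M $ k $ l = det (\<chi> i j. if j = k then (if i = l then 1 else 0) else M $ i $ j) / det M"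
proof -
  have "M *v (matrix_inv M *v axis l 1) = axis l 1"
    using assms someI_ex[of "\<lambda>B. M ** B = mat 1 \<and> B ** M = mat 1"]
    by (simp add: matrix_vector_mul_assoc matrix_inv_def invertible_def flip: invertible_det_nz)
  then have "matrix_inv M *v axis l 1 = (\<chi> k. det (\<chi> i j. if j = k then axis l 1 $ i else M $ i $ j) / det M)"
    by (simp add: cramer[OF assms])
  moreover have "(matrix_inv M *v axis l 1) $ k = matrix_inv M $ k $ l"
    by (simp add: matrix_vector_mult_def axis_def if_distrib[of "\<lambda>x. _ * x"] cong: if_cong)
  moreover have "(\<chi> i j. if j = k then axis l 1 $ i else M $ i $ j)
      = ((\<chi> i j. if j = k then (if i = l then 1 else 0) else M $ i $ j) :: 'a^'n^'n)"
    by (simp add: vec_eq_iff axis_def)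
  ultimately show ?thesis by simp
qed

section \<open>Webster's structure on a CR manifold\<close>

locale cr_coframe = atlas A
  for A :: "('m::{t2_space,second_countable_topology}, 'e::euclidean_space) chart set" +
  fixes H :: "'m \<Rightarrow> 'e set"
    and J :: "'m \<Rightarrow> 'e \<Rightarrow> 'e"
    and U :: "'m set"
    and \<theta> :: "'m \<Rightarrow> 'e \<Rightarrow> real"
    and T :: "'m \<Rightarrow> 'e"
    and Z :: "'n::finite \<Rightarrow> 'm \<Rightarrow> 'e \<times> 'e"
    and \<theta>c :: "'n \<Rightarrow> 'm \<Rightarrow> 'e \<Rightarrow> complex"
    and \<omega> :: "'n \<Rightarrow> 'n \<Rightarrow> 'm \<Rightarrow> 'e \<Rightarrow> complex"
    and \<tau> :: "'n \<Rightarrow> 'n \<Rightarrow> 'm \<Rightarrow> complex"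
    and Ric :: "'n \<Rightarrow> 'n \<Rightarrow> 'm \<Rightarrow> complex"
  assumes cr: "nondegenerate_cr A H J"
    and U: "open U"
    and annihilator: "annihilator_form A H U \<theta>"
    and coframe: "admissible_coframe A H J U \<theta> T Z \<theta>c"
    and webster: "tanaka_webster A J U \<theta> Z \<theta>c \<omega> \<tau>"
    and ricci: "ricci_tensor A U \<theta> \<theta>c \<omega> Ric"
begin

lemma smooth_theta: "smooth_1form A U \<theta>"
  and ker_theta: "p \<in> U \<Longrightarrow> \<theta> p u = 0 \<longleftrightarrow> u \<in> H p"
  using annihilator unfolding annihilator_form_def by auto

lemma smooth_theta_c: "smooth_1form A U (\<theta>c \<alpha>)"
  and smooth_omega: "smooth_1form A U (\<omega> \<alpha> \<beta>)"
  and smooth_Ric: "smooth_fun A U (Ric \<alpha> \<beta>)"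
  and smooth_Z: "smooth_field A U (fst \<circ> Z \<alpha>)" "smooth_field A U (snd \<circ> Z \<alpha>)"
  using coframe webster ricci
  by (simp_all add: admissible_coframe_def admissible_frame_def tanaka_webster_def ricci_tensor_def
      smooth_cx_field_def Let_def)

lemma linear_theta: "p \<in> U \<Longrightarrow> linear (\<theta> p)"
  and linear_theta_c: "p \<in> U \<Longrightarrow> linear (\<theta>c \<alpha> p)"
  and linear_omega: "p \<in> U \<Longrightarrow> linear (\<omega> \<alpha> \<beta> p)"
  using smooth_theta smooth_theta_c[of \<alpha>] smooth_omega[of \<alpha> \<beta>] unfolding smooth_1form_def by blast+

lemma theta_T: "p \<in> U \<Longrightarrow> \<theta> p (T p) = 1"
  and theta_c_T: "p \<in> U \<Longrightarrow> \<theta>c \<alpha> p (T p) = 0"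
  and theta_c_Z: "p \<in> U \<Longrightarrow> cx1 (\<theta>c \<alpha> p) (Z \<beta> p) = (if \<alpha> = \<beta> then 1 else 0)"
  and theta_c_Z_conj: "p \<in> U \<Longrightarrow> cx1 (\<theta>c \<alpha> p) (cx_conj (Z \<beta> p)) = 0"
  and Z_T10: "p \<in> U \<Longrightarrow> Z \<alpha> p \<in> T10 H J p"
  using coframe
  unfolding admissible_coframe_def admissible_frame_def reeb_field_def by blast+

lemma T10_expand:
  "p \<in> U \<Longrightarrow> W \<in> T10 H J p \<Longrightarrow> \<exists>a. W = (\<Sum>\<alpha>\<in>UNIV. cx_scale (a \<alpha>) (Z \<alpha> p))"
  using coframe unfolding admissible_coframe_def admissible_frame_def by blast

lemma subspace_H: "subspace (H p)"
  and J_H: "u \<in> H p \<Longrightarrow> J p u \<in> H p"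
  and J_J: "u \<in> H p \<Longrightarrow> J p (J p u) = - u"
  and J_scale: "u \<in> H p \<Longrightarrow> J p (r *\<^sub>R u) = r *\<^sub>R J p u"
  using cr by (simp_all add: nondegenerate_cr_def cr_structure_def)

lemma J_minus: "u \<in> H p \<Longrightarrow> J p (- u) = - J p u"
  using J_scale[of u p "-1"] by simp

lemma T10_iff: "W \<in> T10 H J p \<longleftrightarrow>
    fst W \<in> H p \<and> snd W \<in> H p \<and> J p (fst W) = - snd W \<and> J p (snd W) = fst W"
  by (auto simp: T10_def cx_scale_def)

abbreviation d\<theta> :: "'m \<Rightarrow> 'e \<Rightarrow> 'e \<Rightarrow> real" where "d\<theta> \<equiv> ext_d A \<theta>"

abbreviation h :: "'n \<Rightarrow> 'n \<Rightarrow> 'm \<Rightarrow> complex" where "h \<equiv> levi_matrix A J \<theta> Z"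

abbreviation d\<theta>c :: "'m \<Rightarrow> 'e \<times> 'e \<Rightarrow> 'e \<times> 'e \<Rightarrow> complex" where
  "d\<theta>c p \<equiv> cx2 (\<lambda>u v. complex_of_real (d\<theta> p u v))"

lemma bilinear_dtheta: "p \<in> U \<Longrightarrow> linear (d\<theta> p u)" "p \<in> U \<Longrightarrow> linear (\<lambda>u. d\<theta> p u v)"
  using bilinear_ext_d[OF smooth_theta U] by auto

lemma dtheta_swap: "d\<theta> p u v = - d\<theta> p v u"
  by (simp add: ext_d_def Let_def)

lemma levi_nondegenerate:
  "p \<in> U \<Longrightarrow> u \<in> H p \<Longrightarrow> (\<And>v. v \<in> H p \<Longrightarrow> d\<theta> p u (J p v) = 0) \<Longrightarrow> u = 0"
  using cr U annihilator unfolding nondegenerate_cr_def levi_form_def by blast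

text \<open>The conjugate of a (1,0)-vector is an eigenvector of \<open>J\<close> for -i. The
  formula removes \<open>J\<close>, which is meaningful on \<open>H\<close> only, and so reduces
  smoothness of the Levi matrix to that of d\<theta> and the frame.\<close>

lemma levi_matrix_eq:
  assumes "p \<in> U" shows "h \<alpha> \<beta> p = - \<i> * d\<theta>c p (Z \<alpha> p) (cx_conj (Z \<beta> p))"
proof -
  note Z = Z_T10[OF assms, unfolded T10_iff]
  have "linear (d\<theta> p u)" for u by (rule bilinear_dtheta(1)[OF assms])
  then show ?thesis
    using Z[of \<alpha>] Z[of \<beta>]
    by (simp add: levi_matrix_def cx2_def levi_form_def cx_conj_def J_minus linear_neg complex_eq_iff)
qed

text \<open>Involutivity of \<open>T\<^sup>1\<^sup>,\<^sup>0\<close>.\<close>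

lemma dtheta_Z_Z:
  assumes p: "p \<in> U" shows "d\<theta>c p (Z \<alpha> p) (Z \<beta> p) = 0"
proof -
  have "\<forall>V Z W. open V \<and> smooth_cx_field A V Z \<and> smooth_cx_field A V W \<and>
      (\<forall>p\<in>V. Z p \<in> T10 H J p \<and> W p \<in> T10 H J p) \<longrightarrow> (\<forall>p\<in>V. cx_bracket A Z W p \<in> T10 H J p)"
    using cr unfolding nondegenerate_cr_def cr_structure_def by (elim conjE)
  from this[rule_format, of U "Z \<alpha>" "Z \<beta>" p]
  have "cx_bracket A (Z \<alpha>) (Z \<beta>) p \<in> T10 H J p"
    using U smooth_Z Z_T10 p by (simp add: smooth_cx_field_def)
  then have br: "\<theta> p (fst (cx_bracket A (Z \<alpha>) (Z \<beta>) p)) = 0" "\<theta> p (snd (cx_bracket A (Z \<alpha>) (Z \<beta>) p)) = 0"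
    using ker_theta[OF p] by (auto simp: T10_iff)
  have Z0: "\<theta> q ((fst \<circ> Z \<gamma>) q) = 0" "\<theta> q ((snd \<circ> Z \<gamma>) q) = 0" if "q \<in> U" for q \<gamma>
    using Z_T10[OF that, of \<gamma>] ker_theta[OF that] by (auto simp: T10_iff)
  note E = ext_d_lie_bracket[OF smooth_theta U p]
  note E' = E[OF smooth_Z(1) Z0(1) smooth_Z(1) Z0(1)] E[OF smooth_Z(1) Z0(1) smooth_Z(2) Z0(2)]
    E[OF smooth_Z(2) Z0(2) smooth_Z(1) Z0(1)] E[OF smooth_Z(2) Z0(2) smooth_Z(2) Z0(2)]
  show ?thesis
    using br E'[of \<alpha> \<beta>]
    by (simp add: cx2_def cx_bracket_def linear_diff[OF linear_theta[OF p]]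
        linear_add[OF linear_theta[OF p]] complex_eq_iff o_def)
qed

text \<open>The left-hand side is the (1,0)-part (u - i J u) / 2 of \<open>u\<close>. Since
  \<open>u\<close> is the sum of this part and its conjugate, and \<theta>c kills conjugates of
  frame vectors, the frame coefficients are the values of \<theta>c at \<open>u\<close>.\<close>

lemma theta_c_expand:
  assumes p: "p \<in> U" and u: "u \<in> H p"
  shows "((1/2) *\<^sub>R u, - (1/2) *\<^sub>R J p u) = (\<Sum>\<alpha>\<in>UNIV. cx_scale (\<theta>c \<alpha> p u) (Z \<alpha> p))" (is "?W = _")
proof -
  have "?W \<in> T10 H J p"
    using u J_H[OF u] subspace_H[of p]
    by (auto simp: T10_iff subspace_scale subspace_neg J_scale J_J J_minus)
  then obtain a where a: "?W = (\<Sum>\<alpha>\<in>UNIV. cx_scale (a \<alpha>) (Z \<alpha> p))" using T10_expand[OF p] by blast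
  have "\<theta>c \<alpha> p u = a \<alpha>" for \<alpha>
  proof -
    note lin = linear_theta_c[OF p, of \<alpha>]
    have "\<theta>c \<alpha> p u = cx1 (\<theta>c \<alpha> p) ?W + cx1 (\<theta>c \<alpha> p) (cx_conj ?W)"
      by (simp add: cx1_def cx_conj_def linear_neg[OF lin] linear_cmul[OF lin] scaleR_conv_of_real)
    also have "\<dots> = a \<alpha>"
      unfolding a
      by (simp add: cx_conj_sum cx1_sum[OF lin] cx_conj_cx_scale cx1_cx_scale[OF lin] theta_c_Z[OF p]
          theta_c_Z_conj[OF p] if_distrib[of "\<lambda>x. _ * x"] cong: if_cong)
    finally show ?thesis .
  qed
  then show ?thesis using a by simp
qed

text \<open>The (1,0)-vector \<open>W\<close> with the prescribed coefficients is made real by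
  adding its conjugate: W + cx_conj W is twice the real part of \<open>W\<close>, and the conjugate
  does not contribute to \<theta>c.\<close>

lemma theta_c_surj:
  assumes p: "p \<in> U" shows "\<exists>u\<in>H p. \<forall>\<alpha>. \<theta>c \<alpha> p u = b \<alpha>"
proof -
  let ?W = "\<Sum>\<alpha>\<in>UNIV. cx_scale (b \<alpha>) (Z \<alpha> p)"
  have "2 *\<^sub>R fst ?W \<in> H p"
    using Z_T10[OF p] subspace_H[of p]
    by (auto simp: fst_sum T10_iff cx_scale_def intro!: subspace_scale subspace_sum subspace_diff)
  moreover have "\<theta>c \<alpha> p (2 *\<^sub>R fst ?W) = b \<alpha>" for \<alpha>
  proof -
    note lin = linear_theta_c[OF p, of \<alpha>]
    have "\<theta>c \<alpha> p (2 *\<^sub>R fst ?W) = cx1 (\<theta>c \<alpha> p) ?W + cx1 (\<theta>c \<alpha> p) (cx_conj ?W)"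
      by (simp add: cx1_def cx_conj_def linear_neg[OF lin] linear_cmul[OF lin] scaleR_conv_of_real)
    also have "\<dots> = b \<alpha>"
      by (simp add: cx_conj_sum cx1_sum[OF lin] cx_conj_cx_scale cx1_cx_scale[OF lin] theta_c_Z[OF p]
          theta_c_Z_conj[OF p] if_distrib[of "\<lambda>x. _ * x"] cong: if_cong)
    finally show ?thesis .
  qed
  ultimately show ?thesis by blast
qed

text \<open>Both claims evaluate the complexified d\<theta> on (u - i J u) / 2 and (v - i J v) / 2.
  It vanishes on two (1,0)-vectors, and the imaginary part of this is the first claim. Conjugating
  the second argument instead produces the Hermitian sum, whose real part is (d\<theta>(u, J v) -
  d\<theta>(J u, v)) / 4; the first claim makes the two terms equal.\<close>

lemma dtheta_J:
  assumes p: "p \<in> U" and u: "u \<in> H p" and v: "v \<in> H p"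
  shows "d\<theta> p (J p u) v = - d\<theta> p u (J p v)"
    and "Re (\<Sum>\<alpha>\<in>UNIV. \<Sum>\<beta>\<in>UNIV. h \<alpha> \<beta> p * (\<theta>c \<alpha> p u * cnj (\<theta>c \<beta> p v))) = d\<theta> p u (J p v) / 2"
proof -
  note bil = bilinear_dtheta[OF p]
  let ?W = "\<lambda>u. ((1/2) *\<^sub>R u, - (1/2) *\<^sub>R J p u)"
  have "d\<theta>c p (?W u) (?W v) = 0"
    unfolding theta_c_expand[OF p u] theta_c_expand[OF p v]
    by (simp add: cx2_sum_left[OF bil] cx2_sum_right[OF bil] cx2_scale_left[OF bil] cx2_scale_right[OF bil]
        dtheta_Z_Z[OF p])
  then show 1: "d\<theta> p (J p u) v = - d\<theta> p u (J p v)"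
    by (simp add: cx2_def complex_eq_iff linear_neg[OF bil(1)] linear_neg[OF bil(2)]
        linear_cmul[OF bil(1)] linear_cmul[OF bil(2)])
  have "(\<Sum>\<alpha>\<in>UNIV. \<Sum>\<beta>\<in>UNIV. h \<alpha> \<beta> p * (\<theta>c \<alpha> p u * cnj (\<theta>c \<beta> p v)))
    = - \<i> * d\<theta>c p (?W u) (cx_conj (?W v))"
    unfolding theta_c_expand[OF p u] theta_c_expand[OF p v] cx_conj_sum cx_conj_cx_scale
    by (simp add: cx2_sum_left[OF bil] cx2_sum_right[OF bil] cx2_scale_left[OF bil] cx2_scale_right[OF bil]
        levi_matrix_eq[OF p] sum_distrib_left mult_ac sum_negf) (rule sum.swap)
  then show "Re (\<Sum>\<alpha>\<in>UNIV. \<Sum>\<beta>\<in>UNIV. h \<alpha> \<beta> p * (\<theta>c \<alpha> p u * cnj (\<theta>c \<beta> p v))) = d\<theta> p u (J p v) / 2"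
    by (simp add: cx2_def cx_conj_def linear_neg[OF bil(1)] linear_neg[OF bil(2)]
        linear_cmul[OF bil(1)] linear_cmul[OF bil(2)] 1)
qed

abbreviation herm :: "'m \<Rightarrow> 'e \<Rightarrow> 'e \<Rightarrow> real" where "herm \<equiv> hermitian_part A J \<theta> Z \<theta>c"

text \<open>\<open>herm\<close> averages the Hermitian sum over both orders of the arguments. By the
  first part of \<open>dtheta_J\<close> and antisymmetry of d\<theta> the two orders agree, so the
  average keeps the factor 1/2.\<close>

lemma herm_levi:
  assumes p: "p \<in> U" and u: "u \<in> H p" and v: "v \<in> H p"
  shows "herm p u v = d\<theta> p u (J p v) / 2"
proof -
  have "herm p u v = (Re (\<Sum>\<alpha>\<in>UNIV. \<Sum>\<beta>\<in>UNIV. h \<alpha> \<beta> p * (\<theta>c \<alpha> p u * cnj (\<theta>c \<beta> p v)))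
      + Re (\<Sum>\<alpha>\<in>UNIV. \<Sum>\<beta>\<in>UNIV. h \<alpha> \<beta> p * (\<theta>c \<alpha> p v * cnj (\<theta>c \<beta> p u)))) / 2"
    by (simp add: hermitian_part_def sym_prod_def sum.distrib[symmetric] sum_divide_distrib Re_divide_numeral
        add_divide_distrib distrib_left distrib_right mult_ac)
  also have "\<dots> = (d\<theta> p u (J p v) / 2 + d\<theta> p v (J p u) / 2) / 2"
    by (simp only: dtheta_J(2)[OF p u v] dtheta_J(2)[OF p v u])
  finally show ?thesis using dtheta_J(1)[OF p u v] dtheta_swap[of p v "J p u"] by simp
qed

lemma herm_nondegenerate:
  assumes p: "p \<in> U" and u: "u \<in> H p" and "\<And>v. v \<in> H p \<Longrightarrow> herm p u v = 0"
  shows "u = 0"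
  by (rule levi_nondegenerate[OF p u]) (use assms herm_levi[OF p u] in auto)

text \<open>A kernel vector is realized by a real \<open>v\<close> in \<open>H\<close>: the Levi
  matrix pairs its second index with conjugates, so the values of \<theta>c at \<open>v\<close> are
  the conjugate entries. Such a \<open>v\<close> is orthogonal to \<open>H\<close> for the Levi
  form.\<close>

lemma det_levi_matrix:
  assumes p: "p \<in> U" shows "det (\<chi> \<alpha> \<beta>. h \<alpha> \<beta> p) \<noteq> 0"
proof -
  let ?M = "\<chi> \<alpha> \<beta>. h \<alpha> \<beta> p"
  have "x = 0" if x: "?M *v x = 0" for x
  proof -
    obtain v where v: "v \<in> H p" "\<And>\<beta>. \<theta>c \<beta> p v = cnj (x $ \<beta>)"
      using theta_c_surj[OF p, of "\<lambda>\<beta>. cnj (x $ \<beta>)"] by blast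
    have "(\<Sum>\<beta>\<in>UNIV. h \<alpha> \<beta> p * x $ \<beta>) = 0" for \<alpha>
      using x by (simp add: vec_eq_iff matrix_vector_mult_def)
    then have "(\<Sum>\<beta>\<in>UNIV. h \<alpha> \<beta> p * (\<theta>c \<alpha> p u * cnj (\<theta>c \<beta> p v))) = 0" for \<alpha> u
      using sum_distrib_left[of "\<theta>c \<alpha> p u" "\<lambda>\<beta>. h \<alpha> \<beta> p * x $ \<beta>" UNIV] by (simp add: v mult_ac)
    then have "d\<theta> p u (J p v) = 0" if "u \<in> H p" for u
      using dtheta_J(2)[OF p that v(1)] by simp
    then have "d\<theta> p v (J p u) = 0" if "u \<in> H p" for u
      using dtheta_J(1)[OF p that v(1)] dtheta_swap[of p v "J p u"] that by simp
    then have "v = 0" by (rule levi_nondegenerate[OF p v(1)])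
    then have "cnj (x $ \<beta>) = 0" for \<beta>
      using v(2)[of \<beta>] linear_0[OF linear_theta_c[OF p]] by simp
    then show "x = 0" by (simp add: vec_eq_iff)
  qed
  then have "\<exists>B. B ** ?M = mat 1" by (subst matrix_left_invertible_ker) blast
  then show ?thesis using invertible_det_nz invertible_left_inverse by blast
qed

section \<open>Smoothness of the coefficients of both metrics\<close>

lemma smooth_levi_matrix: "smooth_fun A U (h \<alpha> \<beta>)"
  unfolding smooth_fun_def
proof
  fix c assume c: "c \<in> A"
  let ?S = "snd c ` (fst c \<inter> U)"
  have S: "open ?S" using open_chart_image c U by auto
  let ?F = "field_in_chart A c"
  let ?d = "\<lambda>X Y y. complex_of_real (d_in_chart c \<theta> y (?F X y) (?F Y y))"
  have "(h \<alpha> \<beta> \<circ> chart_inv c) y = ?d (snd \<circ> Z \<alpha>) (fst \<circ> Z \<beta>) y - ?d (fst \<circ> Z \<alpha>) (snd \<circ> Z \<beta>) y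
      - \<i> * (?d (fst \<circ> Z \<alpha>) (fst \<circ> Z \<beta>) y + ?d (snd \<circ> Z \<alpha>) (snd \<circ> Z \<beta>) y)" if y: "y \<in> ?S" for y
  proof -
    from y obtain p where p: "y = snd c p" "p \<in> fst c" "p \<in> U" by auto
    have *: "?d X Y y = d\<theta> p (X p) (Y p)" for X Y
      unfolding p(1) using ext_d_fields[OF smooth_theta U c p(2,3)] by simp
    have "h \<alpha> \<beta> p = d\<theta> p (snd (Z \<alpha> p)) (fst (Z \<beta> p)) - d\<theta> p (fst (Z \<alpha> p)) (snd (Z \<beta> p))
      - \<i> * (d\<theta> p (fst (Z \<alpha> p)) (fst (Z \<beta> p)) + d\<theta> p (snd (Z \<alpha> p)) (snd (Z \<beta> p)))"
      unfolding levi_matrix_eq[OF p(3)] using linear_neg[OF bilinear_dtheta(1)[OF p(3)]]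
      by (simp add: cx2_def cx_conj_def complex_eq_iff)
    then show ?thesis unfolding * using p c by simp
  qed
  moreover have "smooth_on ?S (\<lambda>y. ?d (snd \<circ> Z \<alpha>) (fst \<circ> Z \<beta>) y - ?d (fst \<circ> Z \<alpha>) (snd \<circ> Z \<beta>) y
      - \<i> * (?d (fst \<circ> Z \<alpha>) (fst \<circ> Z \<beta>) y + ?d (snd \<circ> Z \<alpha>) (snd \<circ> Z \<beta>) y))"
    using smooth_Z[unfolded smooth_field_def] c
    by (intro smooth_on_diff smooth_on_add smooth_on_mult smooth_on_const smooth_on_of_real
        smooth_d_in_chart[OF smooth_theta U c] S) blast+
  ultimately show "smooth_on ?S (h \<alpha> \<beta> \<circ> chart_inv c)" by (subst smooth_on_cong[OF S])
qed

lemma smooth_webster_scalar: "smooth_fun A U (webster_scalar A J \<theta> Z Ric)"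
  unfolding smooth_fun_def
proof
  fix c assume c: "c \<in> A"
  let ?S = "snd c ` (fst c \<inter> U)"
  have S: "open ?S" using open_chart_image c U by auto
  let ?h = "\<lambda>\<alpha> \<beta>. h \<alpha> \<beta> \<circ> chart_inv c"
  have det: "det (\<chi> i j. ?h i j y) \<noteq> 0" if "y \<in> ?S" for y
    using det_levi_matrix chart_inv_in[OF c that] by simp
  have h: "smooth_on ?S (?h \<alpha> \<beta>)" for \<alpha> \<beta> using smooth_levi_matrix c unfolding smooth_fun_def by blast
  have R: "smooth_on ?S (\<lambda>y. Ric \<alpha> \<beta> (chart_inv c y))" for \<alpha> \<beta>
    using smooth_Ric c unfolding smooth_fun_def o_def by blast
  have m: "smooth_on ?S (\<lambda>y. if j = k then if i = l then 1 else 0 else ?h i j y)" for i j k l :: 'n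
    using h[of i j] S by (cases "j = k"; cases "i = l") (auto simp: o_def)
  have "smooth_on ?S (\<lambda>y. Re (\<Sum>\<beta>\<in>UNIV. \<Sum>\<gamma>\<in>UNIV.
      det (\<chi> i j. if j = \<gamma> then (if i = \<beta> then 1 else 0) else ?h i j y) / det (\<chi> i j. ?h i j y)
      * Ric \<beta> \<gamma> (chart_inv c y)))"
    by (intro smooth_on_Re smooth_on_sum smooth_on_mult smooth_on_divide smooth_on_det S R h m det)
  then show "smooth_on ?S (webster_scalar A J \<theta> Z Ric \<circ> chart_inv c)"
    by (subst smooth_on_cong[OF S])
      (use det in \<open>auto simp: webster_scalar_def matrix_inv_entry o_def cong: if_cong simp del: chart_inv_chart times_complex.sel times_divide_eq_left\<close>)
qed

text \<open>Everything in \<sigma> besides \<open>ds\<close>, that is \<sigma> = (ds - \<beta>) / (n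
  + 2). The same form is the 1-form part of the Kropina metric, up to the factor -2 / (n +
  2).\<close>

definition \<beta> :: "'m \<Rightarrow> 'e \<Rightarrow> real" where
  "\<beta> p u = Im (connection_trace \<omega> p u)
    + webster_scalar A J \<theta> Z Ric p / (2 * (real CARD('n) + 1)) * \<theta> p u"

lemma smooth_beta: "smooth_1form A U \<beta>"
  unfolding smooth_1form_def
proof (intro conjI ballI allI)
  fix p assume p: "p \<in> U"
  show "linear (\<beta> p)"
    using linear_theta[OF p] linear_omega[OF p]
    by (intro linearI) (simp_all add: \<beta>_def connection_trace_def linear_add linear_cmul sum.distrib
        algebra_simps sum_distrib_left add_divide_distrib)
next
  fix c u assume c: "c \<in> A"
  let ?S = "snd c ` (fst c \<inter> U)"
  have S: "open ?S" using open_chart_image c U by auto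
  have "smooth_on ?S (\<lambda>y. Im (\<Sum>\<alpha>\<in>UNIV. in_chart A c (\<omega> \<alpha> \<alpha>) y u)
    + (webster_scalar A J \<theta> Z Ric \<circ> chart_inv c) y / (2 * (real CARD('n) + 1)) * in_chart A c \<theta> y u)"
    using smooth_webster_scalar[unfolded smooth_fun_def] smooth_omega[unfolded smooth_1form_def]
      smooth_theta[unfolded smooth_1form_def] c
    by (intro smooth_on_add smooth_on_Im smooth_on_sum smooth_on_mult smooth_on_divide smooth_on_const S)
      (auto simp: o_def)
  then show "smooth_on ?S (\<lambda>y. in_chart A c \<beta> y u)"
    by (simp add: \<beta>_def in_chart_def connection_trace_def)
qed

lemma smooth_herm: "smooth_sym_2tensor A U herm"
  unfolding smooth_sym_2tensor_def
proof (intro conjI ballI allI)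
  fix p assume p: "p \<in> U"
  show "herm p u v = herm p v u" for u v
    by (simp add: hermitian_part_def sym_prod_def add.commute)
  show "linear (herm p u)" for u
    using linear_theta_c[OF p]
    by (intro linearI) (simp_all add: hermitian_part_def sym_prod_def linear_add linear_cmul sum.distrib
        algebra_simps sum_distrib_left add_divide_distrib)
next
  fix c u v assume c: "c \<in> A"
  let ?S = "snd c ` (fst c \<inter> U)"
  have S: "open ?S" using open_chart_image c U by auto
  have "smooth_on ?S (\<lambda>y. Re (\<Sum>\<alpha>\<in>UNIV. \<Sum>\<beta>\<in>UNIV. (h \<alpha> \<beta> \<circ> chart_inv c) y *
      ((in_chart A c (\<theta>c \<alpha>) y u * cnj (in_chart A c (\<theta>c \<beta>) y v)
        + in_chart A c (\<theta>c \<alpha>) y v * cnj (in_chart A c (\<theta>c \<beta>) y u)) / 2)))"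
    using smooth_levi_matrix[unfolded smooth_fun_def] smooth_theta_c[unfolded smooth_1form_def] c
    by (intro smooth_on_add smooth_on_Re smooth_on_sum smooth_on_mult smooth_on_divide smooth_on_cnj
        smooth_on_const S) (auto simp: o_def)
  then show "smooth_on ?S
      (\<lambda>y. herm (chart_inv c y) (from_chart A c (chart_inv c y) u) (from_chart A c (chart_inv c y) v))"
    by (simp add: hermitian_part_def in_chart_def sym_prod_def)
qed

section \<open>The two metrics in terms of the Hermitian form, \<theta> and \<beta>\<close>

lemma fefferman_metric_eq:
  "fefferman_metric A J \<theta> Z \<theta>c \<omega> Ric p \<xi> \<eta> = herm p (fst \<xi>) (fst \<eta>)
    + (\<theta> p (fst \<xi>) * (snd \<eta> - \<beta> p (fst \<eta>)) + \<theta> p (fst \<eta>) * (snd \<xi> - \<beta> p (fst \<xi>))) / (real CARD('n) + 2)"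
proof -
  have "fefferman_sigma A J \<theta> Z \<omega> Ric p \<zeta> = (snd \<zeta> - \<beta> p (fst \<zeta>)) / (real CARD('n) + 2)" for \<zeta>
    by (simp add: fefferman_sigma_def \<beta>_def algebra_simps)
  moreover have "2 * sym_prod a b \<xi> \<eta> = a \<xi> * b \<eta> + a \<eta> * b \<xi>" for a b :: "'e \<times> real \<Rightarrow> real"
    by (simp add: sym_prod_def)
  ultimately show ?thesis
    by (simp only: fefferman_metric_def) (simp add: add_divide_distrib)
qed

lemma chain_kropina_eq:
  "chain_kropina A J \<theta> Z \<theta>c \<omega> Ric p u = herm p u u / \<theta> p u - 2 / (real CARD('n) + 2) * \<beta> p u"
  by (simp add: chain_kropina_def \<beta>_def)

end

section \<open>Null geodesics and Kropina geodesics in coordinates\<close>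

text \<open>\<open>M w\<close> lists the values of \<open>G w\<close> on the standard basis; it is
  injective by nondegeneracy, hence surjective in finite dimension. This supplies the existence
  behind the definite description in \<open>christoffel\<close>.\<close>

lemma nondegenerate_form_represents:
  fixes G :: "'a::euclidean_space \<Rightarrow> 'a \<Rightarrow> real"
  assumes G: "\<And>u. linear (G u)" "\<And>v. linear (\<lambda>u. G u v)"
    and nondeg: "\<And>u. (\<And>v. G u v = 0) \<Longrightarrow> u = 0" and f: "linear f"
  shows "\<exists>w. \<forall>v. G w v = f v"
proof -
  define M where "M w = (\<Sum>b\<in>Basis. G w b *\<^sub>R b)" for w
  have expand: "f v = (\<Sum>b\<in>Basis. (v \<bullet> b) * f b)" if "linear f" for f :: "'a \<Rightarrow> real" and v
    using linear_euclidean_expand[OF that, of v] by simp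
  have lin: "linear M"
    unfolding M_def
    by (intro linearI) (simp_all add: linear_add[OF G(2)] linear_cmul[OF G(2)] scaleR_add_left
        sum.distrib scaleR_sum_right)
  have "inj M"
    unfolding linear_injective_0[OF lin]
  proof (intro allI impI)
    fix w assume "M w = 0"
    then have "G w b = 0" if "b \<in> Basis" for b
      using that inner_sum_left_Basis[of b "G w"] by (simp add: M_def)
    then show "w = 0" by (intro nondeg, subst expand[OF G(1)]) simp
  qed
  then have "surj M" by (rule linear_injective_imp_surjective[OF lin]) simp
  then obtain w where w: "M w = (\<Sum>b\<in>Basis. f b *\<^sub>R b)" by (metis surjD)
  have "G w b = f b" if "b \<in> Basis" for b
    using w that inner_sum_left_Basis[of b "G w"] inner_sum_left_Basis[of b f] by (simp add: M_def)
  then have "G w v = f v" for v by (subst expand[OF G(1)], subst expand[OF f]) simp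
  then show ?thesis by blast
qed

lemma has_real_derivative_cong_open:
  assumes "open I" "t \<in> I" "\<And>r. r \<in> I \<Longrightarrow> f r = g r"
  shows "(f has_real_derivative D) (at t) \<longleftrightarrow> (g has_real_derivative D) (at t)"
  using has_field_derivative_transform_within_open[OF _ assms(1,2), of f D g]
    has_field_derivative_transform_within_open[OF _ assms(1,2), of g D f] assms(3) by auto

text \<open>The data of one chart of the manifold, with \<open>N\<close> in the role of n + 2.
  Nondegeneracy of \<open>g\<close> is asked on the kernel of \<theta> only, because the Hermitian
  form annihilates the Reeb field.\<close>

locale kropina_coordinates =
  fixes S :: "'e::euclidean_space set"
    and g :: "'e \<Rightarrow> 'e \<Rightarrow> 'e \<Rightarrow> real"
    and \<theta> \<beta> :: "'e \<Rightarrow> 'e \<Rightarrow> real"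
    and N :: real
  assumes S: "open S" and N: "N > 0"
    and linear_\<theta>: "\<And>y. y \<in> S \<Longrightarrow> linear (\<theta> y)"
    and linear_\<beta>: "\<And>y. y \<in> S \<Longrightarrow> linear (\<beta> y)"
    and linear_g: "\<And>y u. y \<in> S \<Longrightarrow> linear (g y u)"
    and sym_g: "\<And>y u v. y \<in> S \<Longrightarrow> g y u v = g y v u"
    and smooth_\<theta>: "\<And>u. smooth_on S (\<lambda>y. \<theta> y u)"
    and smooth_\<beta>: "\<And>u. smooth_on S (\<lambda>y. \<beta> y u)"
    and smooth_g: "\<And>u v. smooth_on S (\<lambda>y. g y u v)"
    and \<theta>_nonzero: "\<And>y. y \<in> S \<Longrightarrow> \<exists>u. \<theta> y u \<noteq> 0"
    and nondegenerate: "\<And>y u. y \<in> S \<Longrightarrow> \<theta> y u = 0 \<Longrightarrow> (\<And>v. \<theta> y v = 0 \<Longrightarrow> g y u v = 0) \<Longrightarrow> u = 0"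
begin

definition F :: "'e \<Rightarrow> 'e \<Rightarrow> real" where
  "F y u = g y u u / \<theta> y u - 2 / N * \<beta> y u"

definition G :: "'e \<times> real \<Rightarrow> 'e \<times> real \<Rightarrow> 'e \<times> real \<Rightarrow> real" where
  "G Y \<xi> \<eta> = g (fst Y) (fst \<xi>) (fst \<eta>)
    + (\<theta> (fst Y) (fst \<xi>) * (snd \<eta> - \<beta> (fst Y) (fst \<eta>))
     + \<theta> (fst Y) (fst \<eta>) * (snd \<xi> - \<beta> (fst Y) (fst \<xi>))) / N"

lemma linear_g': "y \<in> S \<Longrightarrow> linear (\<lambda>u. g y u v)"
proof -
  assume y: "y \<in> S"
  have "(\<lambda>u. g y u v) = g y v" by (rule ext) (rule sym_g[OF y])
  then show ?thesis using linear_g[OF y, of v] by (simp only:)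
qed

lemma has_derivative_\<theta>: "y \<in> S \<Longrightarrow> ((\<lambda>y. \<theta> y u) has_derivative frechet_derivative (\<lambda>y. \<theta> y u) (at y)) (at y)"
  and has_derivative_\<beta>: "y \<in> S \<Longrightarrow> ((\<lambda>y. \<beta> y u) has_derivative frechet_derivative (\<lambda>y. \<beta> y u) (at y)) (at y)"
  and has_derivative_g: "y \<in> S \<Longrightarrow> ((\<lambda>y. g y u v) has_derivative frechet_derivative (\<lambda>y. g y u v) (at y)) (at y)"
  by (rule smooth_on_has_derivative[OF _ S], rule smooth_\<theta> smooth_\<beta> smooth_g, assumption)+

lemma has_derivative_G:
  assumes "fst Y \<in> S"
  shows "((\<lambda>Y. G Y \<xi> \<eta>) has_derivative (\<lambda>V.
    frechet_derivative (\<lambda>y. g y (fst \<xi>) (fst \<eta>)) (at (fst Y)) (fst V)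
    + (frechet_derivative (\<lambda>y. \<theta> y (fst \<xi>)) (at (fst Y)) (fst V) * (snd \<eta> - \<beta> (fst Y) (fst \<eta>))
       - \<theta> (fst Y) (fst \<xi>) * frechet_derivative (\<lambda>y. \<beta> y (fst \<eta>)) (at (fst Y)) (fst V)
     + (frechet_derivative (\<lambda>y. \<theta> y (fst \<eta>)) (at (fst Y)) (fst V) * (snd \<xi> - \<beta> (fst Y) (fst \<xi>))
       - \<theta> (fst Y) (fst \<eta>) * frechet_derivative (\<lambda>y. \<beta> y (fst \<xi>)) (at (fst Y)) (fst V))) / N)) (at Y)"
proof -
  have fst: "(fst has_derivative fst) (at Y)" by (rule bounded_linear_imp_has_derivative[OF bounded_linear_fst])
  note D = has_derivative_compose[OF fst has_derivative_\<theta>[OF assms]]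
    has_derivative_compose[OF fst has_derivative_\<beta>[OF assms]]
    has_derivative_compose[OF fst has_derivative_g[OF assms]]
  show ?thesis
    unfolding G_def using N by (auto intro!: derivative_eq_intros D simp: divide_simps)
qed

lemma differentiable_G: "fst Y \<in> S \<Longrightarrow> (\<lambda>Y. G Y \<xi> \<eta>) differentiable at Y"
  using has_derivative_G differentiable_def by blast

lemma linear_G: "fst Y \<in> S \<Longrightarrow> linear (G Y \<xi>)"
  using linear_g[of "fst Y"] linear_\<theta>[of "fst Y"] linear_\<beta>[of "fst Y"]
  by (intro linearI) (simp_all add: G_def linear_add linear_cmul algebra_simps add_divide_distrib diff_divide_distrib)

lemma sym_G: "fst Y \<in> S \<Longrightarrow> G Y \<xi> \<eta> = G Y \<eta> \<xi>"
  using sym_g by (simp add: G_def add.commute)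

lemma linear_G': "fst Y \<in> S \<Longrightarrow> linear (\<lambda>\<xi>. G Y \<xi> \<eta>)"
proof -
  assume y: "fst Y \<in> S"
  have "(\<lambda>\<xi>. G Y \<xi> \<eta>) = G Y \<eta>" by (rule ext) (rule sym_G[OF y])
  then show ?thesis using linear_G[OF y, of \<eta>] by (simp only:)
qed

text \<open>The fibre direction is null and pairs with a vector through its \<theta>-component, so
  testing with \<open>(0, 1)\<close> puts \<open>fst \<xi>\<close> into the kernel of \<theta>.
  Vectors of that kernel then force \<open>fst \<xi> = 0\<close>, and a vector transverse to it
  forces \<open>snd \<xi> = 0\<close>.\<close>

lemma nondegenerate_G:
  assumes y: "fst Y \<in> S" and "\<And>\<eta>. G Y \<xi> \<eta> = 0"
  shows "\<xi> = 0"
proof -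
  have \<theta>0: "\<theta> (fst Y) 0 = 0" and \<beta>0: "\<beta> (fst Y) 0 = 0" and g0: "g (fst Y) u 0 = 0" for u
    using linear_0 linear_\<theta>[OF y] linear_\<beta>[OF y] linear_g[OF y] by blast+
  have 1: "\<theta> (fst Y) (fst \<xi>) = 0" using assms(2)[of "(0, 1)"] N \<theta>0 \<beta>0 g0 by (simp add: G_def)
  have "g (fst Y) (fst \<xi>) v = 0" if "\<theta> (fst Y) v = 0" for v
    using assms(2)[of "(v, 0)"] that 1 by (simp add: G_def)
  then have 2: "fst \<xi> = 0" using nondegenerate[OF y 1] by blast
  obtain u where u: "\<theta> (fst Y) u \<noteq> 0" using \<theta>_nonzero[OF y] by blast
  have "g (fst Y) 0 u = 0" using linear_0[OF linear_g'[OF y]] .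
  then have "snd \<xi> = 0" using assms(2)[of "(u, 0)"] u N by (simp add: G_def 2 \<theta>0 \<beta>0)
  with 2 show ?thesis by (simp add: prod_eq_iff)
qed

text \<open>The geodesic equation is the Euler-Lagrange equation of the energy \<open>G(X', X') / 2\<close>.\<close>

lemma geodesic_at_iff:
  assumes X: "(X has_vector_derivative X' t) (at t)" "(X' has_vector_derivative X'' ) (at t)" "fst (X t) \<in> S"
    and I: "open I" "t \<in> I" "\<And>r. r \<in> I \<Longrightarrow> vector_derivative X (at r) = X' r"
  shows "geodesic_at G X t \<longleftrightarrow> (\<forall>V. ((\<lambda>r. G (X r) (X' r) V) has_real_derivative
      frechet_derivative (\<lambda>Y. G Y (X' t) (X' t)) (at (X t)) V / 2) (at t))"
proof -
  let ?Q = "X t" and ?v = "X' t"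
  have Q: "open (S \<times> (UNIV :: real set))" "?Q \<in> S \<times> UNIV" using S X(3) by (auto simp: open_Times mem_Times_iff)
  note dG = differentiable_G[OF X(3)]
  let ?D = "\<lambda>\<xi> \<eta>. frechet_derivative (\<lambda>Y. G Y \<xi> \<eta>) (at ?Q)"
  \<comment> \<open>The momentum changes through the variation of the metric along the curve and
    through the acceleration; the second term is what the geodesic equation prescribes.\<close>
  have D: "((\<lambda>r. G (X r) (X' r) V) has_real_derivative ?D ?v V ?v + G ?Q X'' V) (at t)" for V
  proof -
    have "linear (\<lambda>\<xi>. G Y \<xi> V)" if "Y \<in> S \<times> UNIV" for Y
      using linear_G'[of Y V] that by (auto simp: mem_Times_iff)
    from has_derivative_linear_family[of "S \<times> UNIV" X t "\<lambda>Y \<xi>. G Y \<xi> V", OF Q this dG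
        X(1)[unfolded has_vector_derivative_def] X(2)[unfolded has_vector_derivative_def]]
    have "((\<lambda>r. G (X r) (X' r) V) has_derivative (\<lambda>z. ?D ?v V (z *\<^sub>R ?v) + G ?Q (z *\<^sub>R X'') V)) (at t)" .
    moreover have "?D ?v V (z *\<^sub>R ?v) + G ?Q (z *\<^sub>R X'') V = (?D ?v V ?v + G ?Q X'' V) * z" for z
      using linear_cmul[OF linear_G'[OF X(3)], of z X''] 
        linear_cmul[OF has_derivative_linear[OF dG[of ?v V, unfolded frechet_derivative_works]], of z ?v]
      by (simp add: algebra_simps)
    ultimately show ?thesis by (simp add: has_field_derivative_def)
  qed
  \<comment> \<open>The Christoffel symbol of the velocity with itself, lowered by \<open>G\<close>.
    Nondegeneracy provides exactly one vector \<open>w\<close> with this lowering, so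
    \<open>christoffel\<close> denotes it.\<close>
  let ?rhs = "\<lambda>v. (?D ?v v ?v + ?D ?v v ?v - ?D ?v ?v v) / 2"
  have l1: "linear (\<lambda>v. ?D ?v v ?v)"
    by (rule linear_frechet_derivative_family[OF Q _ dG]) (auto intro: linear_G)
  have l2: "linear (?D ?v ?v)"
    using dG frechet_derivative_works has_derivative_linear by blast
  have "linear ?rhs"
    by (intro linearI) (simp_all add: linear_add[OF l1] linear_cmul[OF l1] linear_add[OF l2] linear_cmul[OF l2]
        algebra_simps add_divide_distrib diff_divide_distrib)
  then obtain w where w: "\<And>v. G ?Q w v = ?rhs v"
    using nondegenerate_form_represents[of "G ?Q", OF linear_G[OF X(3)] linear_G'[OF X(3)] nondegenerate_G[OF X(3)]] by blast
  have unique: "w' = w" if "\<forall>v. G ?Q w' v = ?rhs v" for w'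
  proof -
    have "G ?Q (w' - w) v = 0" for v
      using linear_diff[OF linear_G'[OF X(3)], of w' w v] that w by (simp only: diff_self)
    then show ?thesis using nondegenerate_G[OF X(3), of "w' - w"] by simp
  qed
  have chr: "christoffel G ?Q ?v ?v = w"
    unfolding christoffel_def by (rule the_equality) (use w unique in auto)
  have "vector_derivative (\<lambda>r. vector_derivative X (at r)) (at t) = X''"
    by (rule vector_derivative_at, rule has_vector_derivative_transform_within_open[OF X(2) I(1,2)])
      (simp add: I(3))
  then have "geodesic_at G X t \<longleftrightarrow> X'' + w = 0"
    unfolding geodesic_at_def Let_def I(3)[OF I(2)] chr by simp
  also have "\<dots> \<longleftrightarrow> - X'' = w" by (metis add.inverse_inverse add_eq_0_iff)
  also have "\<dots> \<longleftrightarrow> (\<forall>v. G ?Q (- X'') v = ?rhs v)" using w unique[of "- X''"] by blast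
  also have "\<dots> \<longleftrightarrow> (\<forall>V. ?D ?v V ?v + G ?Q X'' V = ?D ?v ?v V / 2)"
  proof -
    have "- a = (b + b - c) / 2 \<longleftrightarrow> b + a = c / 2" for a b c :: real by auto
    then show ?thesis by (simp only: linear_neg[OF linear_G'[OF X(3)], of X''])
  qed
  also have "\<dots> \<longleftrightarrow> (\<forall>V. ((\<lambda>r. G (X r) (X' r) V) has_real_derivative ?D ?v ?v V / 2) (at t))"
  proof -
    have "?D ?v V ?v + G ?Q X'' V = ?D ?v ?v V / 2 \<longleftrightarrow>
        ((\<lambda>r. G (X r) (X' r) V) has_real_derivative ?D ?v ?v V / 2) (at t)" for V
    proof
      assume eq: "?D ?v V ?v + G ?Q X'' V = ?D ?v ?v V / 2"
      show "((\<lambda>r. G (X r) (X' r) V) has_real_derivative ?D ?v ?v V / 2) (at t)"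
        using D[of V] unfolding eq .
    qed (rule DERIV_unique[OF D])
    then show ?thesis by (simp only:)
  qed
  finally show ?thesis .
qed

section \<open>Derivatives of the Kropina metric in the fibre and in the base\<close>

lemma frechet_derivative_F_fibre:
  assumes y: "y \<in> S" and u: "\<theta> y u \<noteq> 0"
  shows "frechet_derivative (F y) (at u) w
    = (2 * g y u w * \<theta> y u - g y u u * \<theta> y w) / (\<theta> y u * \<theta> y u) - 2 / N * \<beta> y w"
proof -
  have "bounded_bilinear (g y)"
    using linear_g[OF y] linear_g'[OF y] by (simp add: bilinear_conv_bounded_bilinear[symmetric] bilinear_def)
  from bounded_bilinear.FDERIV[OF this has_derivative_ident has_derivative_ident]
  have g: "((\<lambda>u. g y u u) has_derivative (\<lambda>w. g y u w + g y w u)) (at u)" .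
  note lin = linear_imp_has_derivative[OF linear_\<theta>[OF y]] linear_imp_has_derivative[OF linear_\<beta>[OF y]]
  have "(F y has_derivative (\<lambda>w. ((g y u w + g y w u) * \<theta> y u - g y u u * \<theta> y w) / (\<theta> y u * \<theta> y u)
      - 2 / N * \<beta> y w)) (at u)"
    unfolding F_def[abs_def]
    by (intro has_derivative_diff has_derivative_divide' has_derivative_mult_right g lin u)
  from fun_cong[OF frechet_derivative_at[OF this], of w] show ?thesis by (simp add: sym_g[OF y, of w])
qed

lemma has_derivative_F_base:
  assumes y: "y \<in> S" and u: "\<theta> y u \<noteq> 0"
  shows "((\<lambda>y. F y u) has_derivative (\<lambda>w. (frechet_derivative (\<lambda>y. g y u u) (at y) w * \<theta> y u
      - g y u u * frechet_derivative (\<lambda>y. \<theta> y u) (at y) w)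
       / (\<theta> y u * \<theta> y u) - 2 / N * frechet_derivative (\<lambda>y. \<beta> y u) (at y) w)) (at y)"
  unfolding F_def
  by (intro has_derivative_diff has_derivative_divide' has_derivative_mult_right u
      has_derivative_g has_derivative_\<theta> has_derivative_\<beta> y)

lemmas frechet_derivative_F_base = fun_cong[OF frechet_derivative_at[OF has_derivative_F_base], symmetric]

lemma differentiable_F: "y \<in> S \<Longrightarrow> \<theta> y u \<noteq> 0 \<Longrightarrow> (\<lambda>y. F y u) differentiable at y"
  using has_derivative_F_base differentiable_def by blast

lemma F_scale:
  assumes "y \<in> S" shows "F y (r *\<^sub>R u) = r * F y u"
  using linear_cmul[OF linear_g[OF assms]] linear_cmul[OF linear_g'[OF assms]]
    linear_cmul[OF linear_\<theta>[OF assms]] linear_cmul[OF linear_\<beta>[OF assms]]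
  by (simp add: F_def algebra_simps)

context
  fixes x :: "real \<Rightarrow> 'e" and s :: "real \<Rightarrow> real" and I :: "real set"
  assumes x: "smooth_on I x" "x ` I \<subseteq> S" and s: "smooth_on I s" and I: "open I"
begin

private abbreviation "X' r \<equiv> (vector_derivative x (at r), vector_derivative s (at r))"

lemma lift_geodesic_at_iff:
  assumes t: "t \<in> I"
  shows "geodesic_at G (\<lambda>r. (x r, s r)) t \<longleftrightarrow>
    (\<forall>V. ((\<lambda>r. G (x r, s r) (X' r) V) has_real_derivative
      frechet_derivative (\<lambda>Y. G Y (X' t) (X' t)) (at (x t, s t)) V / 2) (at t))"
proof -
  have X: "((\<lambda>r. (x r, s r)) has_vector_derivative X' r) (at r)" if "r \<in> I" for r
    by (intro has_vector_derivative_Pair smooth_on_has_vector_derivative[OF _ I that] x s)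
  have "(X' has_vector_derivative vector_derivative X' (at t)) (at t)"
  proof -
    have D: "(X' has_vector_derivative (vector_derivative (\<lambda>r. vector_derivative x (at r)) (at t),
        vector_derivative (\<lambda>r. vector_derivative s (at r)) (at t))) (at t)"
      by (intro has_vector_derivative_Pair smooth_on_has_vector_derivative[OF smooth_on_vector_derivative[OF _ I] I t] x s)
    then show ?thesis by (simp only: vector_derivative_at[OF D])
  qed
  then show ?thesis
    by (rule geodesic_at_iff[where X = "\<lambda>r. (x r, s r)" and X' = X', OF X[OF t] _ _ I t]) (use x(2) t vector_derivative_at[OF X] in auto)
qed

text \<open>The momentum conjugate to the Killing field \<open>\<partial>/\<partial>s\<close>.\<close>

lemma geodesic_theta_constant:
  assumes t: "t \<in> I" and geo: "geodesic_at G (\<lambda>r. (x r, s r)) t"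
  shows "((\<lambda>r. \<theta> (x r) (vector_derivative x (at r))) has_real_derivative 0) (at t)"
proof -
  have xS: "x r \<in> S" if "r \<in> I" for r using x(2) that by auto
  \<comment> \<open>The test vector is the Killing field \<open>K\<close>; its length
    \<open>N\<close> cancels the denominator in \<open>G\<close>, so the momentum is exactly
    \<theta>(x').\<close>
  have "((\<lambda>r. G (x r, s r) (X' r) (0, N)) has_real_derivative
      frechet_derivative (\<lambda>Y. G Y (X' t) (X' t)) (at (x t, s t)) (0, N) / 2) (at t)"
    using geo unfolding lift_geodesic_at_iff[OF t] by blast
  also have "frechet_derivative (\<lambda>Y. G Y (X' t) (X' t)) (at (x t, s t)) (0, N) = 0"
    using xS[OF t] linear_0[OF has_derivative_linear[OF has_derivative_g]]
      linear_0[OF has_derivative_linear[OF has_derivative_\<theta>]] linear_0[OF has_derivative_linear[OF has_derivative_\<beta>]]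
    by (simp flip: frechet_derivative_at[OF has_derivative_G])
  finally have 1: "((\<lambda>r. G (x r, s r) (X' r) (0, N)) has_real_derivative 0) (at t)" by simp
  show ?thesis
    by (rule has_field_derivative_transform_within_open[OF 1 I t])
      (use N xS linear_0[OF linear_\<theta>] linear_0[OF linear_\<beta>] linear_0[OF linear_g] in \<open>simp add: G_def\<close>)
qed

text \<open>For a null curve with \<open>\<theta>(x') = k\<close> constant, the energy \<open>G(X', X') / 2 = \<theta>(x') (F + 2 s' / N) / 2\<close>
  has the same first variation as \<open>k F / 2\<close>.\<close>

lemma null_geodesic_iff_euler_lagrange:
  assumes k: "k \<noteq> 0" "\<And>r. r \<in> I \<Longrightarrow> \<theta> (x r) (vector_derivative x (at r)) = k"
    and null: "\<And>r. r \<in> I \<Longrightarrow> G (x r, s r) (X' r) (X' r) = 0" and t: "t \<in> I"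
  shows "geodesic_at G (\<lambda>r. (x r, s r)) t \<longleftrightarrow> euler_lagrange_at F x t"
proof -
  have xS: "x r \<in> S" if "r \<in> I" for r using x(2) that by auto
  let ?x' = "\<lambda>r. vector_derivative x (at r)"
  let ?L = "\<lambda>V r. G (x r, s r) (X' r) V"
  let ?R = "\<lambda>V. frechet_derivative (\<lambda>Y. G Y (X' t) (X' t)) (at (x t, s t)) V / 2"
  \<comment> \<open>The null condition g(x', x') + 2 k (s' - \<beta>(x')) / N = 0, solved for the
    velocity in the fibre.\<close>
  have s': "vector_derivative s (at r) - \<beta> (x r) (?x' r) = - N * g (x r) (?x' r) (?x' r) / (2 * k)"
    if "r \<in> I" for r
    using null[OF that] k N that by (simp add: G_def field_simps)
  \<comment> \<open>The energy carries the factor k / 2 in front of the derivative of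
    \<open>F\<close>. As \<open>k\<close> is constant along the curve, its reciprocal
    \<open>2 / k\<close> passes through the time derivative; the same factor appears in
    \<open>R\<close>.\<close>
  have L: "frechet_derivative (F (x r)) (at (?x' r)) w = (2 / k) * ?L (w, 0) r" if "r \<in> I" for r w
  proof -
    have "frechet_derivative (F (x r)) (at (?x' r)) w
      = (2 * g (x r) (?x' r) w * k - g (x r) (?x' r) (?x' r) * \<theta> (x r) w) / (k * k) - 2 / N * \<beta> (x r) w"
      using frechet_derivative_F_fibre[OF xS[OF that], of "?x' r" w] k that by simp
    also have "\<dots> = (2 / k) * ?L (w, 0) r"
      using k N that by (simp add: G_def s'[OF that]) (simp add: field_simps)
    finally show ?thesis .
  qed
  have R: "frechet_derivative (\<lambda>y. F y (?x' t)) (at (x t)) w = (2 / k) * ?R (w, 0)" for w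
  proof -
    have "frechet_derivative (\<lambda>y. F y (?x' t)) (at (x t)) w
      = (frechet_derivative (\<lambda>y. g y (?x' t) (?x' t)) (at (x t)) w * k
         - g (x t) (?x' t) (?x' t) * frechet_derivative (\<lambda>y. \<theta> y (?x' t)) (at (x t)) w) / (k * k)
         - 2 / N * frechet_derivative (\<lambda>y. \<beta> y (?x' t)) (at (x t)) w"
      using frechet_derivative_F_base[OF xS[OF t], of "?x' t" w] k t by simp
    also have "\<dots> = (2 / k) * ?R (w, 0)"
      using k N xS[OF t] t by (simp add: s'[OF t] flip: frechet_derivative_at[OF has_derivative_G])
        (simp add: field_simps)
    finally show ?thesis .
  qed
  \<comment> \<open>The fibre component of the equation holds for free: the momentum
    \<open>k * a / N\<close> is constant and \<open>G\<close> does not vary along the fibre.\<close>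
  have zero: "(?L (0, a) has_real_derivative ?R (0, a)) (at t)" for a
  proof -
    have "?R (0, a) = 0"
      using xS[OF t] linear_0[OF has_derivative_linear[OF has_derivative_g]]
        linear_0[OF has_derivative_linear[OF has_derivative_\<theta>]] linear_0[OF has_derivative_linear[OF has_derivative_\<beta>]]
      by (simp flip: frechet_derivative_at[OF has_derivative_G])
    moreover have "(?L (0, a) has_real_derivative 0) (at t)"
      by (rule has_field_derivative_transform_within_open[OF DERIV_const[of "k * a / N"] I t])
        (use xS k linear_0[OF linear_\<theta>] linear_0[OF linear_\<beta>] linear_0[OF linear_g] in \<open>simp add: G_def\<close>)
    ultimately show ?thesis by simp
  qed
  have "linear (frechet_derivative (\<lambda>Y. G Y (X' t) (X' t)) (at (x t, s t)))" (is "linear ?f")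
    using differentiable_G[of "(x t, s t)" "X' t" "X' t"] xS[OF t] frechet_derivative_works has_derivative_linear
    by fastforce
  then have linR: "linear ?R"
    by (intro linearI) (simp_all only: linear_add[of ?f] linear_cmul[of ?f] add_divide_distrib real_scaleR_def
        times_divide_eq_right)
  \<comment> \<open>Adding or subtracting the valid fibre equation changes nothing, so test vectors
    tangent to the base suffice.\<close>
  have split: "(?L (w, a) has_real_derivative ?R (w, a)) (at t) \<longleftrightarrow> (?L (w, 0) has_real_derivative ?R (w, 0)) (at t)"
    for w a
  proof -
    have "?R (w, a) = ?R (w, 0) + ?R (0, a)" using linear_add[OF linR, of "(w, 0)" "(0, a)"] by simp
    moreover have "(?L (w, a) has_real_derivative D) (at t)
        \<longleftrightarrow> ((\<lambda>r. ?L (w, 0) r + ?L (0, a) r) has_real_derivative D) (at t)" for D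
      by (rule has_real_derivative_cong_open[OF I t])
        (use linear_add[OF linear_G, of _ _ "(w, 0)" "(0, a)"] xS in simp)
    moreover have "((\<lambda>r. ?L (w, 0) r + ?L (0, a) r) has_real_derivative ?R (w, 0) + ?R (0, a)) (at t)
        \<longleftrightarrow> (?L (w, 0) has_real_derivative ?R (w, 0)) (at t)"
      using DERIV_add[OF _ zero[of a], of "?L (w, 0)" "?R (w, 0)"]
        DERIV_diff[OF _ zero[of a], of "\<lambda>r. ?L (w, 0) r + ?L (0, a) r" "?R (w, 0) + ?R (0, a)"] by auto
    ultimately show ?thesis by (simp only:)
  qed
  have "geodesic_at G (\<lambda>r. (x r, s r)) t \<longleftrightarrow> (\<forall>w. (?L (w, 0) has_real_derivative ?R (w, 0)) (at t))"
    unfolding lift_geodesic_at_iff[OF t] using split by (auto simp: split_paired_all)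
  also have "\<dots> \<longleftrightarrow> (\<forall>w. ((\<lambda>r. (2 / k) * ?L (w, 0) r) has_real_derivative (2 / k) * ?R (w, 0)) (at t))"
  proof -
    have "((\<lambda>r. (2 / k) * f r) has_real_derivative (2 / k) * D) (at t) \<longleftrightarrow> (f has_real_derivative D) (at t)" for f D
      using DERIV_cmult[of "\<lambda>r. (2 / k) * f r" "(2 / k) * D" t UNIV "k / 2"] DERIV_cmult[of f D t UNIV "2 / k"] k(1)
      by auto
    then show ?thesis by (simp only:)
  qed
  also have "\<dots> \<longleftrightarrow> euler_lagrange_at F x t"
    unfolding euler_lagrange_at_def Let_def R
    using has_real_derivative_cong_open[OF I t L] by simp
  finally show ?thesis .
qed

end

text \<open>As \<open>F\<close> is homogeneous of degree one in the velocity, its fibre derivative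
  has degree zero and is unchanged by the factor \<phi>', while its base derivative picks up
  \<phi>'. This is the factor that the chain rule gives to the time derivative. Homogeneity holds
  for negative factors too, so reversing the orientation is covered.\<close>

lemma euler_lagrange_reparam:
  assumes x: "smooth_on I x" "open I" "x ` I \<subseteq> S" and I': "open I'" "smooth_on I' \<phi>" "\<phi> ` I' \<subseteq> I"
    and nz: "\<And>r. r \<in> I \<Longrightarrow> \<theta> (x r) (vector_derivative x (at r)) \<noteq> 0"
      "\<And>r. r \<in> I' \<Longrightarrow> vector_derivative \<phi> (at r) \<noteq> 0"
    and t: "t \<in> I'" and EL: "euler_lagrange_at F x (\<phi> t)"
  shows "euler_lagrange_at F (x \<circ> \<phi>) t"
proof -
  let ?x' = "\<lambda>r. vector_derivative x (at r)" and ?\<phi>' = "\<lambda>r. vector_derivative \<phi> (at r)"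
  have in_I: "\<phi> r \<in> I" if "r \<in> I'" for r using I'(3) that by auto
  have xS: "x (\<phi> r) \<in> S" if "r \<in> I'" for r using x(3) in_I[OF that] by auto
  have v: "vector_derivative (x \<circ> \<phi>) (at r) = ?\<phi>' r *\<^sub>R ?x' (\<phi> r)" if "r \<in> I'" for r
    by (intro vector_derivative_at vector_diff_chain_at smooth_on_has_vector_derivative[OF I'(2,1) that]
        smooth_on_has_vector_derivative[OF x(1,2) in_I[OF that]])
  have fibre: "frechet_derivative (F ((x \<circ> \<phi>) r)) (at (vector_derivative (x \<circ> \<phi>) (at r))) w
      = frechet_derivative (F (x (\<phi> r))) (at (?x' (\<phi> r))) w" if r: "r \<in> I'" for r w
    using frechet_derivative_F_fibre[OF xS[OF r], of "?x' (\<phi> r)" w] nz(1)[OF in_I[OF r]] nz(2)[OF r]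
      frechet_derivative_F_fibre[OF xS[OF r], of "?\<phi>' r *\<^sub>R ?x' (\<phi> r)" w]
      linear_cmul[OF linear_g[OF xS[OF r]]] linear_cmul[OF linear_g'[OF xS[OF r]]]
      linear_cmul[OF linear_\<theta>[OF xS[OF r]]]
    by (simp add: v[OF r]) (simp add: field_simps)
  have base: "frechet_derivative (\<lambda>y. F y (vector_derivative (x \<circ> \<phi>) (at t))) (at ((x \<circ> \<phi>) t)) w
      = frechet_derivative (\<lambda>y. F y (?x' (\<phi> t))) (at (x (\<phi> t))) w * ?\<phi>' t" for w
  proof -
    have "((\<lambda>y. F y (?x' (\<phi> t))) has_derivative frechet_derivative (\<lambda>y. F y (?x' (\<phi> t))) (at (x (\<phi> t)))) (at (x (\<phi> t)))"
      using frechet_derivative_works differentiable_F[OF xS[OF t] nz(1)[OF in_I[OF t]]] by blast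
    from has_derivative_mult_right[OF this, of "?\<phi>' t"]
    have "((\<lambda>y. F y (?\<phi>' t *\<^sub>R ?x' (\<phi> t))) has_derivative
        (\<lambda>w. ?\<phi>' t * frechet_derivative (\<lambda>y. F y (?x' (\<phi> t))) (at (x (\<phi> t))) w)) (at (x (\<phi> t)))"
      by (rule has_derivative_transform_within_open[OF _ S xS[OF t]]) (simp add: F_scale)
    from fun_cong[OF frechet_derivative_at[OF this], of w] show ?thesis by (simp add: v[OF t] mult.commute)
  qed
  have \<phi>: "(\<phi> has_real_derivative ?\<phi>' t) (at t)"
    using smooth_on_has_vector_derivative[OF I'(2,1) t] by (simp add: has_real_derivative_iff_has_vector_derivative)
  have "((\<lambda>r. frechet_derivative (F (x (\<phi> r))) (at (?x' (\<phi> r))) w) has_real_derivative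
      frechet_derivative (\<lambda>y. F y (?x' (\<phi> t))) (at (x (\<phi> t))) w * ?\<phi>' t) (at t)" for w
    using EL DERIV_chain2[OF _ \<phi>, of "\<lambda>r. frechet_derivative (F (x r)) (at (?x' r)) w"]
    unfolding euler_lagrange_at_def Let_def by blast
  then show ?thesis
    unfolding euler_lagrange_at_def Let_def base
    using has_real_derivative_cong_open[OF I'(1) t fibre] by simp
qed

end

section \<open>Points of the Fefferman space\<close>

context cr_coframe
begin

text \<open>The complex linear extension of this map has the (0,1)-vectors in its kernel. Taking
  these vectors as rows makes the volume form a determinant to which the row rules apply.\<close>

definition coframe_vec :: "'m \<Rightarrow> 'e \<Rightarrow> complex ^ 'n option" where
  "coframe_vec p u = (\<chi> i. case i of None \<Rightarrow> complex_of_real (\<theta> p u) | Some \<alpha> \<Rightarrow> \<theta>c \<alpha> p u)"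

lemma coframe_volume_eq: "coframe_volume \<theta> \<theta>c p v = det (\<chi> j. coframe_vec p (v j))"
  unfolding coframe_volume_def coframe_vec_def
  by (subst det_transpose[symmetric]) (simp add: transpose_def)

lemma coframe_volume_upd:
  "coframe_volume \<theta> \<theta>c p (v(k := u)) = det (\<chi> j. if j = k then coframe_vec p u else coframe_vec p (v j))"
proof -
  have "(\<chi> j. coframe_vec p ((v(k := u)) j)) = (\<chi> j. if j = k then coframe_vec p u else coframe_vec p (v j))"
    by (simp add: vec_eq_iff)
  then show ?thesis by (simp add: coframe_volume_eq)
qed

lemma coframe_vec_add: "p \<in> U \<Longrightarrow> coframe_vec p (u + v) = coframe_vec p u + coframe_vec p v"
  and coframe_vec_scale: "p \<in> U \<Longrightarrow> coframe_vec p (r *\<^sub>R u) = complex_of_real r *s coframe_vec p u"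
  by (auto simp: coframe_vec_def vec_eq_iff linear_add[OF linear_theta] linear_add[OF linear_theta_c]
      linear_cmul[OF linear_theta] linear_cmul[OF linear_theta_c] scaleR_conv_of_real split: option.split)

lemma alternating_coframe_volume:
  assumes p: "p \<in> U" shows "alternating_form (\<lambda>v. a * coframe_volume \<theta> \<theta>c p v)"
  unfolding alternating_form_def
proof (intro conjI allI impI)
  fix v j
  show "linear (\<lambda>u. a * coframe_volume \<theta> \<theta>c p (v(j := u)))"
    unfolding coframe_volume_upd
    by (intro linearI, unfold coframe_vec_add[OF p] coframe_vec_scale[OF p] det_row_add det_row_mul)
      (simp_all add: algebra_simps scaleR_conv_of_real)
next
  fix v :: "'n option \<Rightarrow> 'e" and j k :: "'n option"
  assume "j \<noteq> k \<and> v j = v k"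
  then have "det (\<chi> j. coframe_vec p (v j)) = 0"
    by (intro det_identical_rows[of j k]) (auto simp: row_def vec_eq_iff)
  then show "a * coframe_volume \<theta> \<theta>c p v = 0" by (simp add: coframe_volume_eq)
qed

text \<open>Both \<theta> and all \<theta>c vanish on the conjugate of a (1,0)-vector, so inserting
  it produces a zero row.\<close>

lemma coframe_volume_T10:
  assumes p: "p \<in> U" and W: "W \<in> T10 H J p"
  shows "cx1 (\<lambda>u. a * coframe_volume \<theta> \<theta>c p (v(None := u))) (cx_conj W) = 0"
proof -
  obtain b where b: "W = (\<Sum>\<alpha>\<in>UNIV. cx_scale (b \<alpha>) (Z \<alpha> p))" using T10_expand[OF p W] by blast
  have "cx1 (\<theta>c \<alpha> p) (cx_conj W) = 0" for \<alpha>
    using linear_theta_c[OF p, of \<alpha>]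
    by (simp add: b cx_conj_sum cx1_sum cx_conj_cx_scale cx1_cx_scale theta_c_Z_conj[OF p])
  then have \<theta>c: "\<theta>c \<alpha> p (fst W) + \<i> * \<theta>c \<alpha> p (- snd W) = 0" for \<alpha> by (simp add: cx1_def cx_conj_def)
  have \<theta>: "\<theta> p (fst W) = 0" "\<theta> p (- snd W) = 0"
    using W ker_theta[OF p] subspace_neg[OF subspace_H, of _ p] by (auto simp: T10_iff)
  have "coframe_vec p (fst W) + \<i> *s coframe_vec p (- snd W) = 0"
    using \<theta>c \<theta> by (auto simp: coframe_vec_def vec_eq_iff split: option.split)
  then have "det (\<chi> j. if j = None then coframe_vec p (fst W) + \<i> *s coframe_vec p (- snd W) else coframe_vec p (v j)) = 0"
    by (intro det_zero_row[of None]) (auto simp: row_def vec_eq_iff)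
  then have "coframe_volume \<theta> \<theta>c p (v(None := fst W)) + \<i> * coframe_volume \<theta> \<theta>c p (v(None := - snd W)) = 0"
    by (simp only: coframe_volume_upd det_row_add det_row_mul)
  then have "a * (coframe_volume \<theta> \<theta>c p (v(None := fst W)) + \<i> * coframe_volume \<theta> \<theta>c p (v(None := - snd W))) = 0"
    by simp
  then show ?thesis by (simp add: cx1_def cx_conj_def algebra_simps)
qed

text \<open>The real tangent vectors span the complexified tangent space, so the values of the coframe on
  them contain a basis.\<close>

lemma coframe_volume_nonzero:
  assumes p: "p \<in> U" shows "\<exists>v. coframe_volume \<theta> \<theta>c p v \<noteq> 0"
proof -
  obtain B where B: "B \<subseteq> range (coframe_vec p)" "vec.independent B" "range (coframe_vec p) \<subseteq> vec.span B"
    using vec.maximal_independent_subset by blast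
  have in_span: "coframe_vec p u \<in> vec.span B" for u using B by blast
  \<comment> \<open>The Reeb field gives the unit vector of \<theta>. The complex frame vector
    \<open>Z \<alpha>\<close> gives that of \<theta>c \<alpha>, as a complex combination of the
    values at its real and imaginary parts.\<close>
  have "axis i 1 \<in> vec.span B" for i
  proof (cases i)
    case None
    have "axis i 1 = coframe_vec p (T p)"
      using None theta_T[OF p] theta_c_T[OF p] by (auto simp: vec_eq_iff axis_def coframe_vec_def split: option.split)
    then show ?thesis using in_span by simp
  next
    case (Some \<alpha>)
    have "\<theta> p (fst (Z \<alpha> p)) = 0" "\<theta> p (snd (Z \<alpha> p)) = 0"
      using Z_T10[OF p, of \<alpha>] ker_theta[OF p] by (auto simp: T10_iff)
    moreover have "\<theta>c \<beta> p (fst (Z \<alpha> p)) + \<i> * \<theta>c \<beta> p (snd (Z \<alpha> p)) = (if \<beta> = \<alpha> then 1 else 0)" for \<beta>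
      using theta_c_Z[OF p, of \<beta> \<alpha>] by (simp add: cx1_def)
    ultimately have "axis i 1 = coframe_vec p (fst (Z \<alpha> p)) + \<i> *s coframe_vec p (snd (Z \<alpha> p))"
      using Some by (auto simp: vec_eq_iff axis_def coframe_vec_def split: option.split)
    then show ?thesis using in_span by (simp add: vec.span_add vec.span_scale)
  qed
  then have "x \<in> vec.span B" for x
    by (subst basis_expansion[of x, symmetric]) (intro vec.span_sum vec.span_scale)
  then have span: "vec.span B = UNIV" by blast
  have "card B = CARD('n option)"
    using vec.dim_eq_card[of B UNIV] B(2) span vec.span_UNIV vec_dim_card by metis
  moreover have "finite B" using B(2) by (rule vec.finiteI_independent)
  ultimately obtain f where f: "bij_betw f (UNIV :: 'n option set) B"
    using finite_same_card_bij[OF finite_class.finite_UNIV] by metis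
  then have "\<forall>j. \<exists>u. f j = coframe_vec p u" using B(1) bij_betwE by fastforce
  then obtain v where v: "\<And>j. f j = coframe_vec p (v j)" by metis
  have "rows (\<chi> j. coframe_vec p (v j)) = range f"
    unfolding rows_def row_def by (auto simp: v)
  then have "vec.span (rows (\<chi> j. coframe_vec p (v j))) = UNIV"
    using f span by (simp add: bij_betw_def)
  then have "\<exists>M. M ** (\<chi> j. coframe_vec p (v j)) = mat 1" by (simp add: matrix_left_invertible_span_rows_gen)
  then show ?thesis
    using invertible_det_nz invertible_left_inverse coframe_volume_eq by metis
qed

lemma fefferman_point_in_space:
  assumes p: "p \<in> U" shows "fefferman_point \<theta> \<theta>c p s \<in> fefferman_space H J"
proof -
  have "(\<lambda>v. exp (\<i> * complex_of_real s) * coframe_volume \<theta> \<theta>c p v) \<in> canonical_fibre H J p"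
    using alternating_coframe_volume[OF p] coframe_volume_T10[OF p] by (simp add: canonical_fibre_def)
  moreover have "(\<lambda>v. exp (\<i> * complex_of_real s) * coframe_volume \<theta> \<theta>c p v) \<noteq> (\<lambda>v. 0)"
    using coframe_volume_nonzero[OF p] by (auto simp: fun_eq_iff)
  ultimately show ?thesis unfolding fefferman_point_def fefferman_space_def by blast
qed

end

section \<open>Reparametrizations\<close>

lemma antiderivative_exists:
  fixes f :: "real \<Rightarrow> real"
  assumes I: "open_interval I" and f: "continuous_on I f"
  shows "\<exists>F. \<forall>t\<in>I. (F has_vector_derivative f t) (at t)"
proof -
  obtain t0 where t0: "t0 \<in> I" using I by (auto simp: open_interval_def)
  have "((\<lambda>u. LBINT y=t0..u. f y) has_vector_derivative f t) (at t)" if t: "t \<in> I" for t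
  proof -
    obtain e1 e2 where e: "e1 > 0" "cball t e1 \<subseteq> I" "e2 > 0" "cball t0 e2 \<subseteq> I"
      using I t t0 open_contains_cball unfolding open_interval_def by metis
    define e where "e = min e1 e2"
    have in_I: "t - e \<in> I" "t + e \<in> I" "t0 - e \<in> I" "t0 + e \<in> I" and "e > 0"
      using e by (auto simp: e_def dist_real_def subset_iff)
    \<comment> \<open>A compact interval in \<open>I\<close> containing the base point, with
      \<open>t\<close> in its interior so that the derivative within the interval is the full
      one.\<close>
    define a b where "a = min t t0 - e" and "b = max t t0 + e"
    have "a \<in> I" "b \<in> I" using in_I by (auto simp: a_def b_def min_def max_def)
    then have "{a..b} \<subseteq> I" using I mem_is_interval_1_I[of I a b] by (auto simp: open_interval_def)
    then have "continuous_on {a..b} f" using f continuous_on_subset by blast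
    then have "((\<lambda>u. LBINT y=t0..u. f y) has_vector_derivative f t) (at t within {a..b})"
      using \<open>e > 0\<close> by (intro interval_integral_FTC2) (auto simp: a_def b_def)
    moreover have "at t within {a..b} = at t"
      using \<open>e > 0\<close> by (intro at_within_interior) (auto simp: a_def b_def)
    ultimately show ?thesis by simp
  qed
  then show ?thesis by blast
qed

text \<open>The new parameter is an antiderivative \<Phi> of \<open>f\<close>, and \<psi> is its
  inverse. Two equal values of \<Phi> would give a zero of \<open>f\<close> by the mean value
  theorem, so injectivity needs no knowledge of the sign of \<open>f\<close>.\<close>

lemma reparametrization_by_speed:
  fixes f :: "real \<Rightarrow> real"
  assumes I: "open_interval I" and f: "smooth_on I f" "\<And>t. t \<in> I \<Longrightarrow> f t \<noteq> 0"
  shows "\<exists>I' \<psi>. reparametrization \<psi> I' I \<and> 0 \<in> I' \<and>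
    (\<forall>t\<in>I'. (\<psi> has_vector_derivative inverse (f (\<psi> t))) (at t))"
proof -
  have open_I: "open I" and "is_interval I" using I by (auto simp: open_interval_def)
  obtain t0 where t0: "t0 \<in> I" using I by (auto simp: open_interval_def)
  obtain F where F: "\<And>t. t \<in> I \<Longrightarrow> (F has_vector_derivative f t) (at t)"
    using antiderivative_exists[OF I smooth_on_imp_continuous_on[OF f(1)]] by blast
  \<comment> \<open>Subtracting the value at \<open>t0\<close> puts 0 into the new interval, where
    \<open>chain\<close> states its transversality condition.\<close>
  define \<Phi> where "\<Phi> t = F t - F t0" for t
  have \<Phi>: "(\<Phi> has_real_derivative f t) (at t)" if "t \<in> I" for t
    using F[OF that] unfolding \<Phi>_def has_real_derivative_iff_has_vector_derivative[symmetric]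
    by (auto intro!: derivative_eq_intros)
  have cont: "continuous_on I \<Phi>"
    using \<Phi> DERIV_isCont continuous_at_imp_continuous_on by blast
  have ne: "\<Phi> s \<noteq> \<Phi> t" if st: "s \<in> I" "t \<in> I" "s < t" for s t
  proof
    assume "\<Phi> s = \<Phi> t"
    have sub: "r \<in> I" if "s \<le> r" "r \<le> t" for r
      using st that mem_is_interval_1_I[OF \<open>is_interval I\<close>] by blast
    from MVT2[OF st(3) \<Phi>[OF sub]] obtain r where "s < r" "r < t" "\<Phi> t - \<Phi> s = (t - s) * f r" by auto
    with \<open>\<Phi> s = \<Phi> t\<close> f(2)[OF sub, of r] st show False by auto
  qed
  have inj: "inj_on \<Phi> I"
  proof (rule inj_onI)
    fix s t assume "s \<in> I" "t \<in> I" "\<Phi> s = \<Phi> t"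
    then show "s = t" using ne[of s t] ne[of t s] by (cases s t rule: linorder_cases) auto
  qed
  define I' where "I' = \<Phi> ` I"
  define \<psi> where "\<psi> = inv_into I \<Phi>"
  have \<psi>: "\<psi> (\<Phi> t) = t" if "t \<in> I" for t using inj that by (simp add: \<psi>_def)
  have "open I'" unfolding I'_def by (rule invariance_of_domain[OF cont open_I inj])
  moreover have "is_interval I'"
    using connected_continuous_image[OF cont] \<open>is_interval I\<close> by (simp add: I'_def is_interval_connected_1)
  ultimately have I': "open_interval I'" using t0 by (auto simp: open_interval_def I'_def)
  have d\<psi>: "(\<psi> has_vector_derivative inverse (f (\<psi> t))) (at t)" if "t \<in> I'" for t
  proof -
    from that obtain r where r: "t = \<Phi> r" "r \<in> I" by (auto simp: I'_def)
    have "(\<psi> has_derivative (*) (inverse (f r))) (at (\<Phi> r))"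
      by (rule has_derivative_inverse_strong[OF open_I r(2) cont \<psi> \<Phi>[OF r(2), unfolded has_field_derivative_def]])
        (use f(2)[OF r(2)] in \<open>auto simp: fun_eq_iff\<close>)
    then have "(\<psi> has_real_derivative inverse (f r)) (at (\<Phi> r))" by (simp add: has_field_derivative_def)
    then show ?thesis using r \<psi> by (simp add: has_real_derivative_iff_has_vector_derivative)
  qed
  have "smooth_on I' \<psi>"
    by (rule smooth_on_inverse_function[OF \<open>open I'\<close> open_I f(1) _ f(2) d\<psi>]) (auto simp: I'_def \<psi>)
  moreover have "bij_betw \<psi> I' I"
    unfolding I'_def \<psi>_def by (rule bij_betw_inv_into) (simp add: bij_betw_def inj)
  moreover have "deriv \<psi> t \<noteq> 0" if "t \<in> I'" for t
    using vector_derivative_at[OF d\<psi>[OF that]] f(2)[of "\<psi> t"] that \<psi>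
    by (auto simp: field_derivative_eq_vector_derivative I'_def)
  moreover have "0 \<in> I'" using t0 by (auto simp: I'_def \<Phi>_def intro!: image_eqI[of _ _ t0])
  ultimately show ?thesis using I I' d\<psi> unfolding reparametrization_def by blast
qed

lemma reparametrization_compose:
  assumes "reparametrization \<psi> I' I" "reparametrization \<phi> I'' I'"
  shows "reparametrization (\<psi> \<circ> \<phi>) I'' I"
proof -
  have \<psi>: "open I'" "smooth_on I' \<psi>" "bij_betw \<psi> I' I" "\<And>t. t \<in> I' \<Longrightarrow> deriv \<psi> t \<noteq> 0"
    and \<phi>: "open I''" "smooth_on I'' \<phi>" "bij_betw \<phi> I'' I'" "\<And>t. t \<in> I'' \<Longrightarrow> deriv \<phi> t \<noteq> 0"
    using assms by (auto simp: reparametrization_def open_interval_def)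
  have \<phi>I: "\<phi> t \<in> I'" if "t \<in> I''" for t using \<phi>(3) that bij_betwE by blast
  have "smooth_on I'' (\<lambda>t. \<psi> (\<phi> t))"
    by (rule smooth_on_compose[OF \<phi>(1) \<psi>(1) _ \<psi>(2) \<phi>(2)]) (use \<phi>I in auto)
  moreover have "deriv (\<psi> \<circ> \<phi>) t \<noteq> 0" if "t \<in> I''" for t
  proof -
    have "(\<psi> \<circ> \<phi> has_vector_derivative vector_derivative \<phi> (at t) *\<^sub>R vector_derivative \<psi> (at (\<phi> t))) (at t)"
      by (intro vector_diff_chain_at smooth_on_has_vector_derivative[OF \<phi>(2,1) that]
          smooth_on_has_vector_derivative[OF \<psi>(2,1) \<phi>I[OF that]])
    then show ?thesis
      using \<psi>(4)[OF \<phi>I[OF that]] \<phi>(4)[OF that] vector_derivative_at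
      by (fastforce simp: field_derivative_eq_vector_derivative)
  qed
  ultimately show ?thesis
    using assms bij_betw_trans[OF \<phi>(3) \<psi>(3)] by (auto simp: reparametrization_def o_def)
qed

section \<open>Chains as Kropina geodesics\<close>

lemma vector_derivative_cong_open:
  assumes "open I" "t \<in> I" "\<And>r. r \<in> I \<Longrightarrow> f r = g r"
  shows "vector_derivative f (at t) = vector_derivative g (at t)"
proof -
  have "(f has_vector_derivative D) (at t) \<longleftrightarrow> (g has_vector_derivative D) (at t)" for D
    using has_vector_derivative_transform_within_open[of f D t I g]
      has_vector_derivative_transform_within_open[of g D t I f] assms by auto
  then show ?thesis by (simp add: vector_derivative_def)
qed

lemma euler_lagrange_at_cong:
  assumes I: "open I" "t \<in> I" and eq: "\<And>r. r \<in> I \<Longrightarrow> x r = y r"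
  shows "euler_lagrange_at L x t \<longleftrightarrow> euler_lagrange_at L y t"
proof -
  have "vector_derivative x (at r) = vector_derivative y (at r)" if "r \<in> I" for r
    by (rule vector_derivative_cong_open[OF I(1) that eq])
  then have "((\<lambda>r. frechet_derivative (L (x r)) (at (vector_derivative x (at r))) w) has_real_derivative D) (at t)
    \<longleftrightarrow> ((\<lambda>r. frechet_derivative (L (y r)) (at (vector_derivative y (at r))) w) has_real_derivative D) (at t)"
    for w D
    by (intro has_real_derivative_cong_open[OF I]) (simp add: eq)
  moreover have "vector_derivative x (at t) = vector_derivative y (at t)"
    by (rule vector_derivative_cong_open[OF I eq])
  ultimately show ?thesis by (simp add: euler_lagrange_at_def eq[OF I(2)])
qed

lemma velocity_cong:
  assumes "open I" "t \<in> I" "\<And>r. r \<in> I \<Longrightarrow> \<gamma> r = \<delta> r"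
  shows "velocity A \<gamma> t = velocity A \<delta> t"
  unfolding velocity_def assms(3)[OF assms(2)]
  by (rule vector_derivative_cong_open[OF assms(1,2)]) (simp add: assms(3))

lemma smooth_curve_cong:
  assumes I: "open I" and eq: "\<And>r. r \<in> I \<Longrightarrow> \<gamma> r = \<delta> r" and \<gamma>: "smooth_curve A I \<gamma>"
    and A: "\<And>c. c \<in> A \<Longrightarrow> open (fst c)"
  shows "smooth_curve A I \<delta>"
  unfolding smooth_curve_def
proof (intro conjI ballI)
  show cont: "continuous_on I \<delta>" using \<gamma> eq by (simp add: smooth_curve_def cong: continuous_on_cong)
  fix c assume c: "c \<in> A"
  have "open {t \<in> I. \<delta> t \<in> fst c}"
    using continuous_open_preimage[OF cont I A[OF c]] by (simp add: vimage_def Int_def)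
  moreover have "{t \<in> I. \<gamma> t \<in> fst c} = {t \<in> I. \<delta> t \<in> fst c}" using eq by auto
  moreover have "smooth_on {t \<in> I. \<gamma> t \<in> fst c} (snd c \<circ> \<gamma>)" using \<gamma> c by (simp add: smooth_curve_def)
  ultimately show "smooth_on {t \<in> I. \<delta> t \<in> fst c} (snd c \<circ> \<delta>)"
    using eq smooth_on_cong[of "{t \<in> I. \<delta> t \<in> fst c}" "snd c \<circ> \<gamma>" "snd c \<circ> \<delta>"] by auto
qed

text \<open>The projection of a lift is tied to the chain on \<open>I\<close> alone and may differ
  from it outside, so the two curves need not be equal as functions.\<close>

lemma (in atlas) kropina_geodesic_cong:
  assumes eq: "\<And>r. r \<in> I \<Longrightarrow> \<gamma> r = \<delta> r" and geo: "kropina_geodesic A \<omega> F I \<gamma>"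
  shows "kropina_geodesic A \<omega> F I \<delta>"
proof -
  have I: "open I" using geo by (simp add: kropina_geodesic_def open_interval_def)
  note geo = geo[unfolded kropina_geodesic_def]
  show ?thesis
    unfolding kropina_geodesic_def
  proof (intro conjI ballI impI)
    show "open_interval I" using geo by blast
    show "smooth_curve A I \<delta>"
      by (rule smooth_curve_cong[OF I, of \<gamma>]) (use eq geo open_chart_domain in blast)+
    fix t assume t: "t \<in> I"
    have "velocity A \<delta> t = velocity A \<gamma> t" by (rule velocity_cong[OF I t]) (simp add: eq)
    then show "velocity A \<delta> t \<noteq> 0" "\<omega> (\<delta> t) (velocity A \<delta> t) \<noteq> 0" using geo t eq[OF t] by auto
    fix c assume c: "c \<in> A" "\<delta> t \<in> fst c"
    then have "euler_lagrange_at (in_chart A c F) (snd c \<circ> \<gamma>) t" using geo t eq[OF t] by simp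
    then show "euler_lagrange_at (in_chart A c F) (snd c \<circ> \<delta>) t"
      by (subst (asm) euler_lagrange_at_cong[OF I t, of _ "snd c \<circ> \<delta>"]) (simp_all add: eq)
  qed
qed

context atlas
begin

section \<open>Reparametrized curves, and tensors evaluated along curves\<close>

lemma velocity_compose:
  assumes "smooth_curve A I \<gamma>" "open I" "(\<psi> has_vector_derivative d) (at t)" "\<psi> t \<in> I"
  shows "velocity A (\<gamma> \<circ> \<psi>) t = d *\<^sub>R velocity A \<gamma> (\<psi> t)"
  using vector_diff_chain_at[OF assms(3) curve_has_vector_derivative[OF assms(1,2) chart_at(1) assms(4) chart_at(2)]]
  unfolding velocity_def comp_assoc o_apply by (rule vector_derivative_at)

lemma smooth_curve_compose:
  assumes \<gamma>: "smooth_curve A I \<gamma>" "open I" and \<psi>: "smooth_on I' \<psi>" "open I'" "\<psi> ` I' \<subseteq> I"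
  shows "smooth_curve A I' (\<gamma> \<circ> \<psi>)"
  unfolding smooth_curve_def
proof (intro conjI ballI)
  show cont: "continuous_on I' (\<gamma> \<circ> \<psi>)"
    using \<gamma>(1) \<psi>(3) by (intro continuous_on_compose smooth_on_imp_continuous_on[OF \<psi>(1)])
      (auto simp: smooth_curve_def intro: continuous_on_subset)
  fix c assume c: "c \<in> A"
  let ?S = "{t \<in> I'. (\<gamma> \<circ> \<psi>) t \<in> fst c}"
  have S: "open ?S"
    using continuous_open_preimage[OF cont \<psi>(2) open_chart_domain[OF c]] by (simp add: vimage_def Int_def)
  have "smooth_on ?S (\<lambda>t. (snd c \<circ> \<gamma>) (\<psi> t))"
    by (rule smooth_on_compose[OF S curve_chart_smooth(1)[OF \<gamma> c] _ curve_chart_smooth(2)[OF \<gamma> c]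
          smooth_on_subset[OF \<psi>(1)]]) (use \<psi>(3) in auto)
  then show "smooth_on ?S (snd c \<circ> (\<gamma> \<circ> \<psi>))" by (simp add: o_def)
qed

lemma curve_chart_range:
  "\<gamma> ` I \<subseteq> V \<Longrightarrow> (snd c \<circ> \<gamma>) ` {t \<in> I. \<gamma> t \<in> fst c} \<subseteq> snd c ` (fst c \<inter> V)"
  by auto

text \<open>Smoothness is checked near each time in the chart preferred there, kept fixed for the
  neighbouring times.\<close>

lemma smooth_1form_along_curve:
  assumes a: "smooth_1form A V a" "open V" and \<gamma>: "smooth_curve A I \<gamma>" "open I" "\<gamma> ` I \<subseteq> V"
  shows "smooth_on I (\<lambda>t. a (\<gamma> t) (velocity A \<gamma> t))"
proof (rule smooth_on_local[OF \<gamma>(2)])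
  fix t assume t: "t \<in> I"
  define c where "c = chart_at A (\<gamma> t)"
  have c: "c \<in> A" "\<gamma> t \<in> fst c" by (auto simp: c_def chart_at)
  let ?I = "{t \<in> I. \<gamma> t \<in> fst c}"
  note x = curve_chart_smooth[OF \<gamma>(1,2) c(1)]
  have "smooth_on ?I (\<lambda>t. in_chart A c a ((snd c \<circ> \<gamma>) t) (vector_derivative (snd c \<circ> \<gamma>) (at t)))"
    by (rule smooth_on_linear_family[OF x(1) open_chart_image[OF c(1) a(2)] curve_chart_range[OF \<gamma>(3)] _ _ x(2)
          smooth_on_vector_derivative[OF x(2,1)]])
      (use a c linear_in_chart[OF c(1), of V a] in \<open>auto simp: smooth_1form_def\<close>)
  moreover have "in_chart A c a ((snd c \<circ> \<gamma>) t) (vector_derivative (snd c \<circ> \<gamma>) (at t)) = a (\<gamma> t) (velocity A \<gamma> t)"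
    if "t \<in> ?I" for t
    using that velocity_from_chart[OF \<gamma>(1,2) c(1)] by (simp add: in_chart_at c)
  ultimately have "smooth_on ?I (\<lambda>t. a (\<gamma> t) (velocity A \<gamma> t))"
    using smooth_on_cong[OF x(1)] by (metis (no_types, lifting))
  then show "\<exists>N. open N \<and> t \<in> N \<and> smooth_on N (\<lambda>t. a (\<gamma> t) (velocity A \<gamma> t))"
    using x(1) t c(2) by blast
qed

definition tensor_in_chart :: "('m, 'e) chart \<Rightarrow> ('m \<Rightarrow> 'e \<Rightarrow> 'e \<Rightarrow> real) \<Rightarrow> 'e \<Rightarrow> 'e \<Rightarrow> 'e \<Rightarrow> real" where
  "tensor_in_chart c g y u v =
    g (chart_inv c y) (from_chart A c (chart_inv c y) u) (from_chart A c (chart_inv c y) v)"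

lemma tensor_in_chart_at:
  "c \<in> A \<Longrightarrow> p \<in> fst c \<Longrightarrow> tensor_in_chart c g (snd c p) u v = g p (from_chart A c p u) (from_chart A c p v)"
  by (simp add: tensor_in_chart_def)

lemma linear_tensor_in_chart:
  assumes g: "smooth_sym_2tensor A V g" and c: "c \<in> A" and y: "y \<in> snd c ` (fst c \<inter> V)"
  shows "linear (tensor_in_chart c g y u)" "tensor_in_chart c g y u v = tensor_in_chart c g y v u"
proof -
  obtain p where p: "y = snd c p" "p \<in> fst c" "p \<in> V" using y by auto
  have "linear (g p w)" for w using g p(3) by (simp add: smooth_sym_2tensor_def)
  from linear_compose[OF linear_from_chart[OF c p(2)] this]
  have "linear (\<lambda>v. g p w (from_chart A c p v))" for w by (simp add: o_def)
  then show "linear (tensor_in_chart c g y u)"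
    unfolding p(1) tensor_in_chart_at[OF c p(2), abs_def] .
  have "g p v w = g p w v" for v w using g p(3) by (simp add: smooth_sym_2tensor_def)
  then show "tensor_in_chart c g y u v = tensor_in_chart c g y v u"
    unfolding p(1) tensor_in_chart_at[OF c p(2)] .
qed

text \<open>The velocity moves in both slots: the second is treated as for 1-forms, the first by a
  basis expansion.\<close>

lemma smooth_tensor_along_curve:
  assumes g: "smooth_sym_2tensor A V g" "open V" and \<gamma>: "smooth_curve A I \<gamma>" "open I" "\<gamma> ` I \<subseteq> V"
  shows "smooth_on I (\<lambda>t. g (\<gamma> t) (velocity A \<gamma> t) (velocity A \<gamma> t))"
proof (rule smooth_on_local[OF \<gamma>(2)])
  fix t assume t: "t \<in> I"
  define c where "c = chart_at A (\<gamma> t)"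
  have c: "c \<in> A" "\<gamma> t \<in> fst c" by (auto simp: c_def chart_at)
  let ?I = "{t \<in> I. \<gamma> t \<in> fst c}" and ?S = "snd c ` (fst c \<inter> V)"
  let ?v = "\<lambda>t. vector_derivative (snd c \<circ> \<gamma>) (at t)"
  note x = curve_chart_smooth[OF \<gamma>(1,2) c(1)]
  note v = smooth_on_vector_derivative[OF x(2,1)]
  note S = open_chart_image[OF c(1) g(2)]
  note lin = linear_tensor_in_chart[OF g(1) c(1)]
  have lin': "linear (\<lambda>u. tensor_in_chart c g y u w)" if "y \<in> ?S" for y w
  proof -
    have "(\<lambda>u. tensor_in_chart c g y u w) = tensor_in_chart c g y w" by (rule ext) (rule lin(2)[OF that])
    then show ?thesis using lin(1)[OF that, of w] by (simp only:)
  qed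
  have 1: "smooth_on ?I (\<lambda>t. tensor_in_chart c g ((snd c \<circ> \<gamma>) t) u (?v t))" for u
    by (rule smooth_on_linear_family[OF x(1) S curve_chart_range[OF \<gamma>(3)] lin(1) _ x(2) v])
      (use g c in \<open>auto simp: smooth_sym_2tensor_def tensor_in_chart_def\<close>)
  have "smooth_on ?I (\<lambda>t. \<Sum>b\<in>Basis. (?v t \<bullet> b) *\<^sub>R tensor_in_chart c g ((snd c \<circ> \<gamma>) t) b (?v t))"
    by (intro smooth_on_sum smooth_on_scaleR smooth_on_inner_left x(1) v 1)
  moreover have "(\<Sum>b\<in>Basis. (?v t \<bullet> b) *\<^sub>R tensor_in_chart c g ((snd c \<circ> \<gamma>) t) b (?v t))
      = g (\<gamma> t) (velocity A \<gamma> t) (velocity A \<gamma> t)" if t: "t \<in> ?I" for t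
  proof -
    have "(snd c \<circ> \<gamma>) t \<in> ?S" using t \<gamma>(3) by auto
    from linear_euclidean_expand[OF lin'[OF this, of "?v t"], of "?v t"] show ?thesis
      using t velocity_from_chart[OF \<gamma>(1,2) c(1)] by (simp add: tensor_in_chart_at c)
  qed
  ultimately have "smooth_on ?I (\<lambda>t. g (\<gamma> t) (velocity A \<gamma> t) (velocity A \<gamma> t))"
    using smooth_on_cong[OF x(1)] by (metis (no_types, lifting))
  then show "\<exists>N. open N \<and> t \<in> N \<and> smooth_on N (\<lambda>t. g (\<gamma> t) (velocity A \<gamma> t) (velocity A \<gamma> t))"
    using x(1) t c(2) by blast
qed

end

context cr_coframe
begin

abbreviation K :: "'m \<Rightarrow> 'e \<Rightarrow> real" where "K \<equiv> chain_kropina A J \<theta> Z \<theta>c \<omega> Ric"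

section \<open>Transfer between the manifold and its charts\<close>

lemma coordinates:
  assumes c: "c \<in> A"
  shows "kropina_coordinates (snd c ` (fst c \<inter> U)) (tensor_in_chart c herm) (in_chart A c \<theta>) (in_chart A c \<beta>) (real CARD('n) + 2)"
proof (rule kropina_coordinates.intro)
  show "open (snd c ` (fst c \<inter> U))" by (rule open_chart_image[OF c U])
  show "real CARD('n) + 2 > 0" by simp
  show "smooth_on (snd c ` (fst c \<inter> U)) (\<lambda>y. in_chart A c \<theta> y u)"
    "smooth_on (snd c ` (fst c \<inter> U)) (\<lambda>y. in_chart A c \<beta> y u)"
    "smooth_on (snd c ` (fst c \<inter> U)) (\<lambda>y. tensor_in_chart c herm y u v)" for u v
    using smooth_theta smooth_beta smooth_herm c
    by (auto simp: smooth_1form_def smooth_sym_2tensor_def tensor_in_chart_def)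
  fix y u v assume y: "y \<in> snd c ` (fst c \<inter> U)"
  then obtain p where p: "y = snd c p" "p \<in> fst c" "p \<in> U" by auto
  show "linear (in_chart A c \<theta> y)" "linear (in_chart A c \<beta> y)"
    using smooth_theta smooth_beta linear_in_chart[OF c _ y, of \<theta>] linear_in_chart[OF c _ y, of \<beta>]
    by (auto simp: smooth_1form_def)
  show "linear (tensor_in_chart c herm y u)" "tensor_in_chart c herm y u v = tensor_in_chart c herm y v u"
    by (rule linear_tensor_in_chart[OF smooth_herm c y])+
  show "\<exists>u. in_chart A c \<theta> y u \<noteq> 0"
    using theta_T[OF p(3)] c p by (intro exI[of _ "to_chart A c p (T p)"]) (simp add: in_chart_at)
  assume u: "in_chart A c \<theta> y u = 0" "\<And>v. in_chart A c \<theta> y v = 0 \<Longrightarrow> tensor_in_chart c herm y u v = 0"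
  have "from_chart A c p u = 0"
  proof (rule herm_nondegenerate[OF p(3)])
    show "from_chart A c p u \<in> H p" using u(1) c p by (simp add: in_chart_at flip: ker_theta)
    show "herm p (from_chart A c p u) v = 0" if "v \<in> H p" for v
      using u(2)[of "to_chart A c p v"] that c p by (simp add: in_chart_at tensor_in_chart_at flip: ker_theta)
  qed
  then show "u = 0" using to_chart_from_chart[OF c p(2), of u] linear_0[OF linear_transition]
    by (simp add: to_chart_eq chart_at c p)
qed

lemma kropina_in_chart:
  "in_chart A c K = kropina_coordinates.F (tensor_in_chart c herm) (in_chart A c \<theta>) (in_chart A c \<beta>) (real CARD('n) + 2)"
  if "c \<in> A"
  unfolding fun_eq_iff kropina_coordinates.F_def[OF coordinates[OF that]]
  by (simp add: in_chart_def tensor_in_chart_def chain_kropina_eq)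

lemma fefferman_in_chart:
  "fefferman_metric_in_chart A J \<theta> Z \<theta>c \<omega> Ric c
    = kropina_coordinates.G (tensor_in_chart c herm) (in_chart A c \<theta>) (in_chart A c \<beta>) (real CARD('n) + 2)"
  if "c \<in> A"
  unfolding fun_eq_iff kropina_coordinates.G_def[OF coordinates[OF that]]
  by (simp add: fefferman_metric_in_chart_def Let_def in_chart_def tensor_in_chart_def fefferman_metric_eq)

lemma kropina: "kropina_metric A U \<theta> K"
  unfolding kropina_metric_def
proof (intro conjI)
  show "smooth_1form A U \<theta>" by (rule smooth_theta)
  show "\<forall>p\<in>U. \<exists>u. \<theta> p u \<noteq> 0" using theta_T by (metis zero_neq_one)
  \<comment> \<open>The 1-form term is absorbed into the numerator by multiplying it with \<theta>.
    The added product vanishes on the kernel of \<theta>, so nondegeneracy there is that of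
    \<open>herm\<close>.\<close>
  let ?g = "\<lambda>p u v. herm p u v - (\<theta> p u * \<beta> p v + \<theta> p v * \<beta> p u) / (real CARD('n) + 2)"
  have "smooth_sym_2tensor A U ?g"
    unfolding smooth_sym_2tensor_def
  proof (intro conjI ballI allI)
    fix p u v assume p: "p \<in> U"
    have herm: "herm p u v = herm p v u" "linear (herm p u)"
      using smooth_herm p by (auto simp: smooth_sym_2tensor_def)
    show "?g p u v = ?g p v u" by (simp add: herm(1) add.commute)
    have "linear (\<beta> p)" using smooth_beta p by (simp add: smooth_1form_def)
    then show "linear (?g p u)"
      using herm(2) linear_theta[OF p]
      by (intro linearI) (simp_all add: linear_add linear_cmul algebra_simps add_divide_distrib)
  next
    fix c u v assume c: "c \<in> A"
    have "smooth_on (snd c ` (fst c \<inter> U)) (\<lambda>y. tensor_in_chart c herm y u v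
        - (in_chart A c \<theta> y u * in_chart A c \<beta> y v + in_chart A c \<theta> y v * in_chart A c \<beta> y u) / (real CARD('n) + 2))"
      using smooth_theta smooth_beta smooth_herm c open_chart_image[OF c U]
      by (intro smooth_on_diff smooth_on_add smooth_on_mult smooth_on_divide smooth_on_const)
        (auto simp: smooth_1form_def smooth_sym_2tensor_def tensor_in_chart_def)
    then show "smooth_on (snd c ` (fst c \<inter> U))
        (\<lambda>y. ?g (chart_inv c y) (from_chart A c (chart_inv c y) u) (from_chart A c (chart_inv c y) v))"
      by (simp add: tensor_in_chart_def in_chart_def)
  qed
  moreover have "u = 0" if p: "p \<in> U" and u: "\<theta> p u = 0" "\<forall>v. \<theta> p v = 0 \<longrightarrow> ?g p u v = 0" for p u
    by (rule herm_nondegenerate[OF p]) (use u in \<open>auto simp flip: ker_theta[OF p]\<close>)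
  moreover have "K p u = ?g p u u / \<theta> p u" if "\<theta> p u \<noteq> 0" for p u
    using that by (simp add: chain_kropina_eq field_simps)
  ultimately show "\<exists>g. smooth_sym_2tensor A U g \<and>
      (\<forall>p\<in>U. \<forall>u. \<theta> p u = 0 \<and> (\<forall>v. \<theta> p v = 0 \<longrightarrow> g p u v = 0) \<longrightarrow> u = 0) \<and>
      (\<forall>p\<in>U. \<forall>u. \<theta> p u \<noteq> 0 \<longrightarrow> K p u = g p u u / \<theta> p u)"
    by blast
qed

lemma null_geodesic_iff:
  assumes \<gamma>: "smooth_curve A I \<gamma>" "open I" "\<gamma> ` I \<subseteq> U" and s: "smooth_on I s"
    and k: "k \<noteq> 0" "\<And>t. t \<in> I \<Longrightarrow> \<theta> (\<gamma> t) (velocity A \<gamma> t) = k"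
    and null: "\<And>t. t \<in> I \<Longrightarrow> fefferman_metric A J \<theta> Z \<theta>c \<omega> Ric (\<gamma> t)
      (velocity A \<gamma> t, deriv s t) (velocity A \<gamma> t, deriv s t) = 0"
    and c: "c \<in> A" "t \<in> I" "\<gamma> t \<in> fst c"
  shows "geodesic_at (fefferman_metric_in_chart A J \<theta> Z \<theta>c \<omega> Ric c) (\<lambda>r. (snd c (\<gamma> r), s r)) t
    \<longleftrightarrow> euler_lagrange_at (in_chart A c K) (snd c \<circ> \<gamma>) t"
proof -
  interpret kropina_coordinates "snd c ` (fst c \<inter> U)" "tensor_in_chart c herm" "in_chart A c \<theta>" "in_chart A c \<beta>" "real CARD('n) + 2"
    by (rule coordinates[OF c(1)])
  let ?I = "{t \<in> I. \<gamma> t \<in> fst c}"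
  note x = curve_chart_smooth[OF \<gamma>(1,2) c(1)]
  have "geodesic_at G (\<lambda>r. ((snd c \<circ> \<gamma>) r, s r)) t \<longleftrightarrow> euler_lagrange_at F (snd c \<circ> \<gamma>) t"
  proof (rule null_geodesic_iff_euler_lagrange[OF x(2) curve_chart_range[OF \<gamma>(3)] smooth_on_subset[OF s] x(1) k(1)])
    show "in_chart A c \<theta> ((snd c \<circ> \<gamma>) r) (vector_derivative (snd c \<circ> \<gamma>) (at r)) = k" if "r \<in> ?I" for r
      using that k(2)[of r] velocity_from_chart[OF \<gamma>(1,2) c(1), of r] by (simp add: in_chart_at c)
    show "G ((snd c \<circ> \<gamma>) r, s r) (vector_derivative (snd c \<circ> \<gamma>) (at r), vector_derivative s (at r))
        (vector_derivative (snd c \<circ> \<gamma>) (at r), vector_derivative s (at r)) = 0" if "r \<in> ?I" for r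
      using that null[of r] velocity_from_chart[OF \<gamma>(1,2) c(1), of r]
      unfolding fefferman_in_chart[OF c(1), symmetric]
      by (simp add: fefferman_metric_in_chart_def Let_def c field_derivative_eq_vector_derivative)
  qed (use c in auto)
  then show ?thesis by (simp add: fefferman_in_chart[OF c(1)] kropina_in_chart[OF c(1)] o_def)
qed

section \<open>Projections of null geodesics and lifts of Kropina geodesics\<close>

lemma chain_imp_kropina_geodesic:
  assumes "chain A H J U \<theta> Z \<theta>c \<omega> Ric I \<delta>"
  shows "kropina_geodesic A \<theta> K I \<delta>"
proof -
  obtain \<Gamma> s where geo: "fefferman_null_geodesic A H J U \<theta> Z \<theta>c \<omega> Ric I \<Gamma> s"
    and \<Gamma>: "\<And>t. t \<in> I \<Longrightarrow> fst (\<Gamma> t) = \<delta> t" and zero: "0 \<in> I"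
    and nonzero: "fefferman_metric A J \<theta> Z \<theta>c \<omega> Ric (\<delta> 0) (0, (real CARD('n) + 2)) (velocity A \<delta> 0, deriv s 0) \<noteq> 0"
    using assms unfolding chain_def by blast
  define \<gamma> where "\<gamma> = fst \<circ> \<Gamma>"
  have eq: "\<gamma> t = \<delta> t" if "t \<in> I" for t using \<Gamma>[OF that] by (simp add: \<gamma>_def)
  note geo = geo[unfolded fefferman_null_geodesic_def Let_def, folded \<gamma>_def]
  have I: "open_interval I" "open I" and \<gamma>: "smooth_curve A I \<gamma>" "\<gamma> ` I \<subseteq> U" and s: "smooth_on I s"
    and G: "\<And>c t. c \<in> A \<Longrightarrow> t \<in> I \<Longrightarrow> \<gamma> t \<in> fst c \<Longrightarrow>
      geodesic_at (fefferman_metric_in_chart A J \<theta> Z \<theta>c \<omega> Ric c) (\<lambda>r. (snd c (\<gamma> r), s r)) t"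
    and null: "\<And>t. t \<in> I \<Longrightarrow> fefferman_metric A J \<theta> Z \<theta>c \<omega> Ric (\<gamma> t)
      (velocity A \<gamma> t, deriv s t) (velocity A \<gamma> t, deriv s t) = 0"
    using geo by (simp_all add: open_interval_def)
  let ?f = "\<lambda>t. \<theta> (\<gamma> t) (velocity A \<gamma> t)"
  have df: "(?f has_real_derivative 0) (at t)" if t: "t \<in> I" for t
  proof -
    define c where "c = chart_at A (\<gamma> t)"
    have c: "c \<in> A" "\<gamma> t \<in> fst c" by (auto simp: c_def chart_at)
    let ?I = "{t \<in> I. \<gamma> t \<in> fst c}"
    note x = curve_chart_smooth[OF \<gamma>(1) I(2) c(1)]
    have "((\<lambda>r. in_chart A c \<theta> ((snd c \<circ> \<gamma>) r) (vector_derivative (snd c \<circ> \<gamma>) (at r))) has_real_derivative 0) (at t)"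
      by (rule kropina_coordinates.geodesic_theta_constant[OF coordinates[OF c(1)] x(2)
            curve_chart_range[OF \<gamma>(2)] smooth_on_subset[OF s] x(1)])
        (use t c G[OF c(1) t] fefferman_in_chart[OF c(1)] in auto)
    then show ?thesis
      by (rule has_field_derivative_transform_within_open[OF _ x(1)])
        (use t c velocity_from_chart[OF \<gamma>(1) I(2) c(1)] in \<open>auto simp: in_chart_at\<close>)
  qed
  \<comment> \<open>The conservation law was obtained at each time in a chart there; since the
    interval is connected, one constant serves for all times and all charts.\<close>
  have "convex I" using I by (simp add: open_interval_def is_interval_convex_1)
  then obtain k where k: "\<And>t. t \<in> I \<Longrightarrow> ?f t = k"
    using has_field_derivative_zero_constant[of I ?f, OF _ has_field_derivative_at_within[OF df]] by blast
  have velocity: "velocity A \<delta> 0 = velocity A \<gamma> 0"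
    by (rule velocity_cong[OF I(2) zero]) (simp add: eq)
  have "\<gamma> 0 \<in> U" using zero \<gamma>(2) by blast
  \<comment> \<open>The pairing of \<open>K\<close> with the lifted velocity is \<theta>(\<gamma>'),
    so the transversality condition at parameter 0 says that the constant is nonzero.\<close>
  have "k \<noteq> 0"
  proof
    assume "k = 0"
    then have "\<theta> (\<delta> 0) (velocity A \<delta> 0) = 0" using k[OF zero] eq[OF zero] velocity by simp
    moreover have "herm (\<delta> 0) 0 w = 0" "\<theta> (\<delta> 0) 0 = 0" "\<beta> (\<delta> 0) 0 = 0" for w
      using smooth_herm linear_theta smooth_beta linear_0 \<open>\<gamma> 0 \<in> U\<close> eq[OF zero]
      unfolding smooth_sym_2tensor_def smooth_1form_def by metis+
    ultimately show False using nonzero by (simp add: fefferman_metric_eq)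
  qed
  have "kropina_geodesic A \<theta> K I \<gamma>"
    unfolding kropina_geodesic_def
  proof (intro conjI ballI impI)
    fix t assume t: "t \<in> I"
    show "\<theta> (\<gamma> t) (velocity A \<gamma> t) \<noteq> 0" using k[OF t] \<open>k \<noteq> 0\<close> by simp
    then show "velocity A \<gamma> t \<noteq> 0" using linear_0[OF linear_theta, of "\<gamma> t"] \<gamma>(2) t by auto
    show "euler_lagrange_at (in_chart A c K) (snd c \<circ> \<gamma>) t" if "c \<in> A" "\<gamma> t \<in> fst c" for c
      using null_geodesic_iff[OF \<gamma>(1) I(2) \<gamma>(2) s \<open>k \<noteq> 0\<close> k null that(1) t that(2)] G[OF that(1) t that(2)] by simp
  qed (use I \<gamma> in auto)
  then show ?thesis using kropina_geodesic_cong[of I \<gamma> \<delta>] eq by blast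
qed

text \<open>The lift of a geodesic with \<open>\<theta>(\<gamma>') = 1\<close> to a null curve solves \<open>s' = - (n + 2) F(\<gamma>') / 2\<close>.\<close>

lemma kropina_geodesic_imp_chain:
  assumes geo: "kropina_geodesic A \<theta> K I \<delta>" and \<delta>U: "\<delta> ` I \<subseteq> U"
  shows "up_to_reparam (chain A H J U \<theta> Z \<theta>c \<omega> Ric) I \<delta>"
proof -
  have I: "open_interval I" "open I" and \<delta>: "smooth_curve A I \<delta>"
    and nz: "\<And>t. t \<in> I \<Longrightarrow> \<theta> (\<delta> t) (velocity A \<delta> t) \<noteq> 0"
    and EL: "\<And>c t. c \<in> A \<Longrightarrow> t \<in> I \<Longrightarrow> \<delta> t \<in> fst c \<Longrightarrow> euler_lagrange_at (in_chart A c K) (snd c \<circ> \<delta>) t"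
    using geo by (auto simp: kropina_geodesic_def open_interval_def)
  obtain I' \<psi> where \<psi>: "reparametrization \<psi> I' I" "0 \<in> I'"
    "\<And>t. t \<in> I' \<Longrightarrow> (\<psi> has_vector_derivative inverse (\<theta> (\<delta> (\<psi> t)) (velocity A \<delta> (\<psi> t)))) (at t)"
    using reparametrization_by_speed[OF I(1) smooth_1form_along_curve[OF smooth_theta U \<delta> I(2) \<delta>U] nz] by blast
  have I': "open_interval I'" "open I'" and s\<psi>: "smooth_on I' \<psi>" and \<psi>I: "\<psi> ` I' \<subseteq> I"
    using \<psi>(1) by (auto simp: reparametrization_def open_interval_def bij_betw_def)
  define \<gamma> where "\<gamma> = \<delta> \<circ> \<psi>"
  have \<gamma>: "smooth_curve A I' \<gamma>" unfolding \<gamma>_def by (rule smooth_curve_compose[OF \<delta> I(2) s\<psi> I'(2) \<psi>I])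
  have \<gamma>U: "\<gamma> ` I' \<subseteq> U" using \<psi>I \<delta>U by (auto simp: \<gamma>_def)
  have unit: "\<theta> (\<gamma> t) (velocity A \<gamma> t) = 1" if t: "t \<in> I'" for t
  proof -
    have "\<psi> t \<in> I" using t \<psi>I by auto
    then show ?thesis
      using velocity_compose[OF \<delta> I(2) \<psi>(3)[OF t]] nz[of "\<psi> t"] \<delta>U linear_cmul[OF linear_theta, of "\<delta> (\<psi> t)"]
      by (auto simp: \<gamma>_def)
  qed
  let ?v = "\<lambda>t. velocity A \<gamma> t"
  \<comment> \<open>With \<theta>(\<gamma>') = 1 the quantity -(n + 2) F / 2 loses its denominator
    and becomes this combination, which is smooth along the curve. It is the function to be
    integrated, not the form \<sigma> of the Fefferman metric.\<close>
  define \<sigma> where "\<sigma> t = \<beta> (\<gamma> t) (?v t) - (real CARD('n) + 2) / 2 * herm (\<gamma> t) (?v t) (?v t)" for t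
  have \<sigma>: "smooth_on I' \<sigma>"
    unfolding \<sigma>_def
    by (intro smooth_on_diff smooth_on_mult smooth_on_const I' smooth_1form_along_curve[OF smooth_beta U \<gamma> I'(2) \<gamma>U]
        smooth_tensor_along_curve[OF smooth_herm U \<gamma> I'(2) \<gamma>U])
  obtain s where ds: "\<And>t. t \<in> I' \<Longrightarrow> (s has_vector_derivative \<sigma> t) (at t)"
    using antiderivative_exists[OF I'(1) smooth_on_imp_continuous_on[OF \<sigma>]] by blast
  have s: "smooth_on I' s" by (rule smooth_on_antiderivative[OF I'(2) ds \<sigma>])
  have deriv_s: "deriv s t = \<sigma> t" if "t \<in> I'" for t
    using vector_derivative_at[OF ds[OF that]] by (simp add: field_derivative_eq_vector_derivative)
  have null: "fefferman_metric A J \<theta> Z \<theta>c \<omega> Ric (\<gamma> t) (?v t, deriv s t) (?v t, deriv s t) = 0"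
    if t: "t \<in> I'" for t
    by (simp add: fefferman_metric_eq unit[OF t] deriv_s[OF t] \<sigma>_def)
  define \<Gamma> where "\<Gamma> t = (fefferman_point \<theta> \<theta>c (\<gamma> t) (s t) :: 'm \<times> (('n option \<Rightarrow> 'e) \<Rightarrow> complex) set)" for t
  have fst_\<Gamma>: "fst \<circ> \<Gamma> = \<gamma>" by (simp add: fun_eq_iff \<Gamma>_def fefferman_point_def)
  have "fefferman_null_geodesic A H J U \<theta> Z \<theta>c \<omega> Ric I' \<Gamma> s"
    unfolding fefferman_null_geodesic_def Let_def fst_\<Gamma>
  proof (intro conjI ballI impI)
    show "\<Gamma> t \<in> fefferman_space H J" if "t \<in> I'" for t
      using fefferman_point_in_space \<gamma>U that by (auto simp: \<Gamma>_def)
    show "\<Gamma> t = fefferman_point \<theta> \<theta>c (\<gamma> t) (s t)" for t by (simp add: \<Gamma>_def)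
    fix c t assume c: "c \<in> A" and t: "t \<in> I'" and ct: "\<gamma> t \<in> fst c"
    let ?I = "{t \<in> I. \<delta> t \<in> fst c}" and ?I' = "{t \<in> I'. \<gamma> t \<in> fst c}"
    note x = curve_chart_smooth[OF \<delta> I(2) c]
    have "euler_lagrange_at (in_chart A c K) ((snd c \<circ> \<delta>) \<circ> \<psi>) t"
      unfolding kropina_in_chart[OF c]
    proof (rule kropina_coordinates.euler_lagrange_reparam[OF coordinates[OF c] x(2,1) curve_chart_range[OF \<delta>U],
          where I' = ?I' and \<phi> = \<psi>])
      show "open ?I'" by (rule curve_chart_smooth(1)[OF \<gamma> I'(2) c])
      show "smooth_on ?I' \<psi>" using s\<psi> by (rule smooth_on_subset) auto
      show "\<psi> ` ?I' \<subseteq> ?I" using \<psi>I by (auto simp: \<gamma>_def)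
      show "in_chart A c \<theta> ((snd c \<circ> \<delta>) r) (vector_derivative (snd c \<circ> \<delta>) (at r)) \<noteq> 0" if "r \<in> ?I" for r
        using that nz[of r] velocity_from_chart[OF \<delta> I(2) c, of r] by (simp add: in_chart_at c)
      show "vector_derivative \<psi> (at r) \<noteq> 0" if "r \<in> ?I'" for r
        using that \<psi>(1) by (auto simp: reparametrization_def field_derivative_eq_vector_derivative)
      show "t \<in> ?I'" using t ct by simp
      show "euler_lagrange_at (kropina_coordinates.F (tensor_in_chart c herm) (in_chart A c \<theta>) (in_chart A c \<beta>) (real CARD('n) + 2))
          (snd c \<circ> \<delta>) (\<psi> t)"
        using EL[OF c, of "\<psi> t"] t ct \<psi>I unfolding kropina_in_chart[OF c] by (auto simp: \<gamma>_def)
    qed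
    then have "euler_lagrange_at (in_chart A c K) (snd c \<circ> \<gamma>) t" by (simp only: \<gamma>_def comp_assoc)
    then show "geodesic_at (fefferman_metric_in_chart A J \<theta> Z \<theta>c \<omega> Ric c) (\<lambda>r. (snd c (\<gamma> r), s r)) t"
      using null_geodesic_iff[OF \<gamma> I'(2) \<gamma>U s _ unit null c t ct] by simp
  qed (use I' \<gamma>U \<gamma> s null in auto)
  moreover have "fefferman_metric A J \<theta> Z \<theta>c \<omega> Ric (\<gamma> 0) (0, (real CARD('n) + 2)) (?v 0, deriv s 0) \<noteq> 0"
  proof -
    have "\<gamma> 0 \<in> U" using \<gamma>U \<psi>(2) by auto
    then have "herm (\<gamma> 0) 0 w = 0" "\<theta> (\<gamma> 0) 0 = 0" "\<beta> (\<gamma> 0) 0 = 0" for w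
      using smooth_herm linear_theta smooth_beta linear_0
      unfolding smooth_sym_2tensor_def smooth_1form_def by metis+
    then show ?thesis by (simp add: fefferman_metric_eq unit[OF \<psi>(2)])
  qed
  ultimately have "chain A H J U \<theta> Z \<theta>c \<omega> Ric I' \<gamma>"
    unfolding chain_def using \<psi>(2) fst_\<Gamma> by (metis comp_apply)
  then show ?thesis unfolding up_to_reparam_def \<gamma>_def using \<psi>(1) by blast
qed

text \<open>A chain is a Kropina geodesic in its own parameter. A Kropina geodesic becomes a chain
  only after normalizing \<theta>(\<gamma>'), so that direction composes two changes of
  parameter.\<close>

lemma chains_are_kropina_geodesics:
  assumes "\<gamma> ` I \<subseteq> U"
  shows "up_to_reparam (chain A H J U \<theta> Z \<theta>c \<omega> Ric) I \<gamma> \<longleftrightarrow> up_to_reparam (kropina_geodesic A \<theta> K) I \<gamma>"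
proof
  assume "up_to_reparam (kropina_geodesic A \<theta> K) I \<gamma>"
  then obtain I' \<psi> where \<psi>: "reparametrization \<psi> I' I" "kropina_geodesic A \<theta> K I' (\<gamma> \<circ> \<psi>)"
    unfolding up_to_reparam_def by blast
  then have "(\<gamma> \<circ> \<psi>) ` I' \<subseteq> U" using assms by (auto simp: reparametrization_def bij_betw_def)
  from kropina_geodesic_imp_chain[OF \<psi>(2) this] show "up_to_reparam (chain A H J U \<theta> Z \<theta>c \<omega> Ric) I \<gamma>"
    unfolding up_to_reparam_def using reparametrization_compose[OF \<psi>(1)] by (metis o_assoc)
qed (use chain_imp_kropina_geodesic in \<open>auto simp: up_to_reparam_def\<close>)

end

theorem theorem1p1:
  fixes A :: "('m::{t2_space,second_countable_topology}, 'e::euclidean_space) chart set"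
    and H :: "'m \<Rightarrow> 'e set"
    and J :: "'m \<Rightarrow> 'e \<Rightarrow> 'e"
    and U :: "'m set"
    and \<theta> :: "'m \<Rightarrow> 'e \<Rightarrow> real"
    and T :: "'m \<Rightarrow> 'e"
    and Z :: "'n::finite \<Rightarrow> 'm \<Rightarrow> 'e \<times> 'e"
    and \<theta>c :: "'n \<Rightarrow> 'm \<Rightarrow> 'e \<Rightarrow> complex"
    and \<omega> :: "'n \<Rightarrow> 'n \<Rightarrow> 'm \<Rightarrow> 'e \<Rightarrow> complex"
    and \<tau> :: "'n \<Rightarrow> 'n \<Rightarrow> 'm \<Rightarrow> complex"
    and Ric :: "'n \<Rightarrow> 'n \<Rightarrow> 'm \<Rightarrow> complex"
  assumes "smooth_atlas A"
    and "DIM('e) = 2 * CARD('n) + 1"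
    and "nondegenerate_cr A H J"
    and "open U"
    and "annihilator_form A H U \<theta>"
    and "admissible_coframe A H J U \<theta> T Z \<theta>c"
    and "tanaka_webster A J U \<theta> Z \<theta>c \<omega> \<tau>"
    and "ricci_tensor A U \<theta> \<theta>c \<omega> Ric"
  shows "kropina_metric A U \<theta> (chain_kropina A J \<theta> Z \<theta>c \<omega> Ric) \<and>
    (\<forall>I \<gamma>. open_interval I \<and> \<gamma> ` I \<subseteq> U \<longrightarrow>
       (locally_on (up_to_reparam (chain A H J U \<theta> Z \<theta>c \<omega> Ric)) I \<gamma> \<longleftrightarrow>
        locally_on (up_to_reparam (kropina_geodesic A \<theta> (chain_kropina A J \<theta> Z \<theta>c \<omega> Ric))) I \<gamma>))"
proof -
  interpret cr_coframe A H J U \<theta> T Z \<theta>c \<omega> \<tau> Ric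
    using assms by (intro cr_coframe.intro atlas.intro cr_coframe_axioms.intro)
  have "locally_on (up_to_reparam (chain A H J U \<theta> Z \<theta>c \<omega> Ric)) I \<gamma>
      \<longleftrightarrow> locally_on (up_to_reparam (kropina_geodesic A \<theta> (chain_kropina A J \<theta> Z \<theta>c \<omega> Ric))) I \<gamma>"
    if "\<gamma> ` I \<subseteq> U" for I \<gamma>
  proof -
    have "up_to_reparam (chain A H J U \<theta> Z \<theta>c \<omega> Ric) I' \<gamma>
        \<longleftrightarrow> up_to_reparam (kropina_geodesic A \<theta> (chain_kropina A J \<theta> Z \<theta>c \<omega> Ric)) I' \<gamma>"
      if "I' \<subseteq> I" for I'
      using chains_are_kropina_geodesics[of \<gamma> I'] that \<open>\<gamma> ` I \<subseteq> U\<close> by blast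
    then show ?thesis unfolding locally_on_def by metis
  qed
  with kropina show ?thesis by blast
qed

end
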